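(* Let $(Y,\omega,b)$ be an l.c.p-s. manifold of dimension $n+k$ with $\omega$ of constant rank $2k$, let $E=\ker\omega$, $\pi:E^*\to Y$, fix a splitting $TY=G\oplus E$, and let $U\subset E^*$ be a neighborhood of the zero section on which $\omega_G=\pi^*\omega-d\theta_G-\pi^*b\wedge\theta_G$ is nondegenerate. Then the graph $\Gamma_s$ of a smooth section $s:Y\to U\subset E^*$ is coisotropic in $(U,\omega_G,\pi^*b)$ if and only if the two-form $$\omega_G(s):=\omega-d^b(p_G^*(s))\in\Omega^2(Y)$$ is maximally degenerate, i.e. $(\omega_G(s))^{k+1}=0$.
   Context: An l.c.p-s. (locally conformal pre-symplectic) manifold is a triple $(Y,\omega,b)$ with $b$ a closed one-form and $\omega$ a two-form of constant rank with $d\omega+b\wedge\omega=0$. For a closed one-form $b$ put $d^b\alpha=d\alpha+b\wedge\alpha$. Given the splitting $TY=G\oplus E$, $p_G:TY\to E$ is the projection along $G$, and $p_G^*:E^*\to T^*Y$ is $\langle p_G^*(s),v\rangle=\langle s,p_G(v)\rangle$. The one-form $\theta_G$ on $E^*$ is $\theta_{G,\widehat\alpha}(\xi)=\widehat\alpha(p_G\circ T\pi(\xi))$ for $\xi\in T_{\widehat\alpha}E^*$. The total space $E^*$ has dimension $2n$. A submanifold $\Gamma$ is coisotropic with respect to a nondegenerate two-form $\Omega$ if $(T\Gamma)^\Omega\subset T\Gamma$. *)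

theory Defs
  imports
    "HOL-Analysis.Analysis"
    "HOL-Combinatorics.Permutations"
    "HOL-Library.Function_Algebras"
begin

section \<open>Functions as real vector spaces\<close>

instantiation "fun" :: (type, real_vector) real_vector
begin

definition scaleR_fun_def: "scaleR a f = (\<lambda>x. a *\<^sub>R f x)"

instance
  by standard (simp_all add: scaleR_fun_def fun_eq_iff scaleR_add_right scaleR_add_left)

end


section \<open>Calculus on open subsets of coordinate space\<close>

text \<open>
  Dimensions occur as natural numbers (the dual bundle below has rank
  \<open>n - k\<close>, possibly 0), so \<open>\<real>\<^sup>N\<close> is the set of real sequences vanishing
  from index \<open>N\<close> on.  The product topology of \<^typ>\<open>nat \<Rightarrow> real\<close> induces the Euclidean
  topology on it.
\<close>

definition Rn :: "nat \<Rightarrow> (nat \<Rightarrow> real) set" where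
  "Rn N = {x. \<forall>i\<ge>N. x i = 0}"

definition open_Rn :: "nat \<Rightarrow> (nat \<Rightarrow> real) set \<Rightarrow> bool" where
  "open_Rn N W \<longleftrightarrow> openin (top_of_set (Rn N)) W"

definition pd :: "nat \<Rightarrow> ((nat \<Rightarrow> real) \<Rightarrow> real) \<Rightarrow> (nat \<Rightarrow> real) \<Rightarrow> real" where
  "pd i f x = deriv (\<lambda>t. f (x(i := t))) (x i)"

primrec Ck_on :: "nat \<Rightarrow> nat \<Rightarrow> (nat \<Rightarrow> real) set \<Rightarrow> ((nat \<Rightarrow> real) \<Rightarrow> real) \<Rightarrow> bool" where
  "Ck_on N 0 W f \<longleftrightarrow> continuous_on W f"
| "Ck_on N (Suc r) W f \<longleftrightarrow> continuous_on W f \<and>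
     (\<forall>i<N. (\<forall>x\<in>W. (\<lambda>t. f (x(i := t))) differentiable at (x i)) \<and> Ck_on N r W (pd i f))"

definition smooth_on :: "nat \<Rightarrow> (nat \<Rightarrow> real) set \<Rightarrow> ((nat \<Rightarrow> real) \<Rightarrow> real) \<Rightarrow> bool" where
  "smooth_on N W f \<longleftrightarrow> (\<forall>r. Ck_on N r W f)"

definition dir_deriv ::
    "nat \<Rightarrow> ((nat \<Rightarrow> real) \<Rightarrow> real) \<Rightarrow> (nat \<Rightarrow> real) \<Rightarrow> (nat \<Rightarrow> real) \<Rightarrow> real" where
  "dir_deriv N f x u = (\<Sum>i<N. pd i f x * u i)"

definition dmap ::
    "nat \<Rightarrow> ((nat \<Rightarrow> real) \<Rightarrow> nat \<Rightarrow> real) \<Rightarrow> (nat \<Rightarrow> real) \<Rightarrow> (nat \<Rightarrow> real) \<Rightarrow> nat \<Rightarrow> real" where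
  "dmap N F x u = (\<lambda>j. dir_deriv N (\<lambda>z. F z j) x u)"


section \<open>Smooth manifolds\<close>

text \<open>
  A chart is a domain together with a coordinate map, whose values outside the domain are
  irrelevant.  A manifold is given by an atlas; its points are those covered by the charts, and
  its topology is the one determined by the charts.
\<close>

type_synonym 'p chart = "'p set \<times> ('p \<Rightarrow> nat \<Rightarrow> real)"

record 'p manifold =
  mdim :: nat
  charts :: "'p chart set"

definition points :: "'p manifold \<Rightarrow> 'p set" where
  "points M = (\<Union>c\<in>charts M. fst c)"

definition cinv :: "'p chart \<Rightarrow> (nat \<Rightarrow> real) \<Rightarrow> 'p" where
  "cinv c = inv_into (fst c) (snd c)"

definition open_in_mfd :: "'p manifold \<Rightarrow> 'p set \<Rightarrow> bool" where
  "open_in_mfd M W \<longleftrightarrow> W \<subseteq> points M \<and> (\<forall>c\<in>charts M. open_Rn (mdim M) (snd c ` (W \<inter> fst c)))"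

definition mfd_topology :: "'p manifold \<Rightarrow> 'p topology" where
  "mfd_topology M = topology (open_in_mfd M)"

definition smooth_atlas :: "'p manifold \<Rightarrow> bool" where
  "smooth_atlas M \<longleftrightarrow>
     (\<forall>c\<in>charts M. inj_on (snd c) (fst c)) \<and>
     (\<forall>c\<in>charts M. \<forall>d\<in>charts M.
        open_Rn (mdim M) (snd c ` (fst c \<inter> fst d)) \<and>
        (\<forall>j<mdim M. smooth_on (mdim M) (snd c ` (fst c \<inter> fst d)) (\<lambda>x. snd d (cinv c x) j)))"

definition smooth_manifold :: "'p manifold \<Rightarrow> bool" where
  "smooth_manifold M \<longleftrightarrow> smooth_atlas M \<and>
     Hausdorff_space (mfd_topology M) \<and> second_countable (mfd_topology M)"

lemma istopology_open_in_mfd: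
  assumes "smooth_atlas M"
  shows "istopology (open_in_mfd M)"
proof -
  have inj: "inj_on (snd c) (fst c)" if "c \<in> charts M" for c
    using assms that by (auto simp: smooth_atlas_def)
  have I: "snd c ` ((S \<inter> T) \<inter> fst c) = snd c ` (S \<inter> fst c) \<inter> snd c ` (T \<inter> fst c)"
    if "c \<in> charts M" for c S T
    using inj[OF that] by (auto simp: inj_on_def)
  have U: "snd c ` (\<Union>K \<inter> fst c) = \<Union>((\<lambda>S. snd c ` (S \<inter> fst c)) ` K)" for c :: "'a chart" and K
    by auto
  show ?thesis
    unfolding istopology_def open_in_mfd_def open_Rn_def
    by (auto simp: I U intro!: openin_Int openin_Union)
qed

definition smooth_map :: "'p manifold \<Rightarrow> 'q manifold \<Rightarrow> ('p \<Rightarrow> 'q) \<Rightarrow> bool" where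
  "smooth_map M M' f \<longleftrightarrow> f ` points M \<subseteq> points M' \<and>
     (\<forall>c\<in>charts M. \<forall>d\<in>charts M'.
        open_Rn (mdim M) (snd c ` {p\<in>fst c. f p \<in> fst d}) \<and>
        (\<forall>j<mdim M'. smooth_on (mdim M) (snd c ` {p\<in>fst c. f p \<in> fst d})
           (\<lambda>x. snd d (f (cinv c x)) j)))"


section \<open>Tangent vectors\<close>

text \<open>
  A tangent vector at \<open>p\<close> is the family of its coordinate vectors in the charts around \<open>p\<close>
  (related by the Jacobians of the transition maps), extended by 0 to all other
  indices; the vector space structure is pointwise.
\<close>

type_synonym 'p tvec = "'p chart \<Rightarrow> nat \<Rightarrow> real"

definition tangent :: "'p manifold \<Rightarrow> 'p \<Rightarrow> 'p tvec set" where
  "tangent M p = {v.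
     (\<forall>c. c \<notin> charts M \<or> p \<notin> fst c \<longrightarrow> v c = 0) \<and>
     (\<forall>c\<in>charts M. p \<in> fst c \<longrightarrow> v c \<in> Rn (mdim M)) \<and>
     (\<forall>c\<in>charts M. \<forall>d\<in>charts M. p \<in> fst c \<and> p \<in> fst d \<longrightarrow>
        v d = dmap (mdim M) (snd d \<circ> cinv c) (snd c p) (v c))}"

text \<open>The tangent vector at \<open>p\<close> whose coordinate vector in the chart \<open>c\<close> is \<open>u\<close>.\<close>

definition coord_vec :: "'p manifold \<Rightarrow> 'p chart \<Rightarrow> 'p \<Rightarrow> (nat \<Rightarrow> real) \<Rightarrow> 'p tvec" where
  "coord_vec M c p u = (\<lambda>d. if d \<in> charts M \<and> p \<in> fst d
     then dmap (mdim M) (snd d \<circ> cinv c) (snd c p) u else 0)"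

definition chart_at :: "'p manifold \<Rightarrow> 'p \<Rightarrow> 'p chart" where
  "chart_at M p = (SOME c. c \<in> charts M \<and> p \<in> fst c)"

definition tangent_map ::
    "'p manifold \<Rightarrow> 'q manifold \<Rightarrow> ('p \<Rightarrow> 'q) \<Rightarrow> 'p \<Rightarrow> 'p tvec \<Rightarrow> 'q tvec" where
  "tangent_map M M' f p v = (let c = chart_at M p in
     (\<lambda>d. if d \<in> charts M' \<and> f p \<in> fst d
       then dmap (mdim M) (snd d \<circ> f \<circ> cinv c) (snd c p) (v c) else 0))"

definition smooth_vector_field_on ::
    "'p manifold \<Rightarrow> 'p set \<Rightarrow> ('p \<Rightarrow> 'p tvec) \<Rightarrow> bool" where
  "smooth_vector_field_on M W X \<longleftrightarrow>
     (\<forall>p\<in>W. X p \<in> tangent M p) \<and>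
     (\<forall>c\<in>charts M. \<forall>i<mdim M.
        smooth_on (mdim M) (snd c ` (W \<inter> fst c)) (\<lambda>x. X (cinv c x) c i))"

definition local_frame ::
    "'p manifold \<Rightarrow> ('p \<Rightarrow> 'p tvec set) \<Rightarrow> nat \<Rightarrow> 'p set \<Rightarrow> (nat \<Rightarrow> 'p \<Rightarrow> 'p tvec) \<Rightarrow> bool" where
  "local_frame M V m W e \<longleftrightarrow> open_in_mfd M W \<and>
     (\<forall>j<m. smooth_vector_field_on M W (e j)) \<and>
     (\<forall>p\<in>W. inj_on (\<lambda>j. e j p) {..<m} \<and> independent ((\<lambda>j. e j p) ` {..<m}) \<and>
        span ((\<lambda>j. e j p) ` {..<m}) = V p)"

definition smooth_subbundle :: "'p manifold \<Rightarrow> nat \<Rightarrow> ('p \<Rightarrow> 'p tvec set) \<Rightarrow> bool" where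
  "smooth_subbundle M m V \<longleftrightarrow> (\<forall>p\<in>points M. \<exists>W e. p \<in> W \<and> local_frame M V m W e)"

definition open_interval_mfd :: "real \<Rightarrow> real manifold" where
  "open_interval_mfd \<epsilon> =
     \<lparr>mdim = 1, charts = {({-\<epsilon><..<\<epsilon>}, \<lambda>t i. if i = 0 then t else 0)}\<rparr>"

text \<open>
  The tangent space of a submanifold \<open>S\<close> of \<open>M\<close>, inside the tangent space of \<open>M\<close>: the velocities at
  \<open>q\<close> of the smooth curves through \<open>q\<close> that run in \<open>S\<close>.
\<close>

definition sub_tangent :: "'p manifold \<Rightarrow> 'p set \<Rightarrow> 'p \<Rightarrow> 'p tvec set" where
  "sub_tangent M S q = {tangent_map (open_interval_mfd \<epsilon>) M \<gamma> 0 w | \<epsilon> \<gamma> w.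
     \<epsilon> > 0 \<and> smooth_map (open_interval_mfd \<epsilon>) M \<gamma> \<and> \<gamma> ` {-\<epsilon><..<\<epsilon>} \<subseteq> S \<and> \<gamma> 0 = q \<and>
     w \<in> tangent (open_interval_mfd \<epsilon>) 0}"


section \<open>Differential forms\<close>

text \<open>
  A form of degree \<open>r\<close> sends a point and a list of \<open>r\<close> tangent vectors to a number.  Its
  values on other lists or away from the manifold are irrelevant, so vanishing is stated by
  \<open>form_zero\<close> instead of equality of functions.
\<close>

type_synonym 'p form = "'p \<Rightarrow> 'p tvec list \<Rightarrow> real"

definition alternating_on :: "'v::real_vector set \<Rightarrow> nat \<Rightarrow> ('v list \<Rightarrow> real) \<Rightarrow> bool" where
  "alternating_on V r f \<longleftrightarrow> (\<forall>vs. length vs = r \<and> set vs \<subseteq> V \<longrightarrow>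
     (\<forall>i<r. \<forall>u\<in>V. \<forall>w\<in>V. f (vs[i := u + w]) = f (vs[i := u]) + f (vs[i := w])) \<and>
     (\<forall>i<r. \<forall>u\<in>V. \<forall>a. f (vs[i := a *\<^sub>R u]) = a * f (vs[i := u])) \<and>
     (\<forall>i<r. \<forall>j<r. i \<noteq> j \<and> vs ! i = vs ! j \<longrightarrow> f vs = 0))"

text \<open>
  The local expression of a form in the chart \<open>c\<close>, evaluated on constant vector fields.
\<close>

definition coeff ::
    "'p manifold \<Rightarrow> 'p chart \<Rightarrow> 'p form \<Rightarrow> (nat \<Rightarrow> real) list \<Rightarrow> (nat \<Rightarrow> real) \<Rightarrow> real" where
  "coeff M c \<alpha> us x = \<alpha> (cinv c x) (map (coord_vec M c (cinv c x)) us)"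

definition smooth_form :: "'p manifold \<Rightarrow> nat \<Rightarrow> 'p form \<Rightarrow> bool" where
  "smooth_form M r \<alpha> \<longleftrightarrow>
     (\<forall>p\<in>points M. alternating_on (tangent M p) r (\<alpha> p)) \<and>
     (\<forall>c\<in>charts M. \<forall>us. length us = r \<and> set us \<subseteq> Rn (mdim M) \<longrightarrow>
        smooth_on (mdim M) (snd c ` fst c) (coeff M c \<alpha> us))"

definition form_zero :: "'p manifold \<Rightarrow> nat \<Rightarrow> 'p form \<Rightarrow> bool" where
  "form_zero M r \<alpha> \<longleftrightarrow>
     (\<forall>p\<in>points M. \<forall>vs. length vs = r \<and> set vs \<subseteq> tangent M p \<longrightarrow> \<alpha> p vs = 0)"

text \<open>
  Wedge product of forms of degrees \<open>p\<close> and \<open>q\<close>, normalised so that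
  \<open>(a \<and> b)(u, v) = a u * b v - a v * b u\<close> for one-forms.
\<close>

definition wedge :: "nat \<Rightarrow> nat \<Rightarrow> 'p form \<Rightarrow> 'p form \<Rightarrow> 'p form" where
  "wedge p q \<alpha> \<beta> = (\<lambda>x vs.
     (\<Sum>\<sigma> | \<sigma> permutes {..<p + q}. of_int (sign \<sigma>) *
        \<alpha> x (take p (permute_list \<sigma> vs)) * \<beta> x (drop p (permute_list \<sigma> vs)))
     / (fact p * fact q))"

primrec wedge_power :: "'p form \<Rightarrow> nat \<Rightarrow> 'p form" where
  "wedge_power \<omega> 0 = (\<lambda>x vs. 1)"
| "wedge_power \<omega> (Suc m) = wedge 2 (2 * m) \<omega> (wedge_power \<omega> m)"

text \<open>
  The exterior derivative, from
  \<open>d\<alpha>(X\<^sub>0, \<dots>, X\<^sub>r) = \<Sum>\<^sub>i (-1)\<^sup>i X\<^sub>i(\<alpha>(X\<^sub>0, \<dots>, X\<^sub>r without X\<^sub>i))\<close> for the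
  (commuting) constant vector fields of a chart.  For a smooth form the result
  does not depend on the chart.
\<close>

definition ext_deriv :: "'p manifold \<Rightarrow> 'p form \<Rightarrow> 'p form" where
  "ext_deriv M \<alpha> = (\<lambda>p vs. let c = chart_at M p in
     (\<Sum>i<length vs. (-1) ^ i *
        dir_deriv (mdim M) (coeff M c \<alpha> (map (\<lambda>v. v c) (take i vs @ drop (Suc i) vs)))
          (snd c p) ((vs ! i) c)))"

definition twisted_deriv :: "'p manifold \<Rightarrow> 'p form \<Rightarrow> nat \<Rightarrow> 'p form \<Rightarrow> 'p form" where
  "twisted_deriv M b r \<alpha> = ext_deriv M \<alpha> + wedge 1 r b \<alpha>"

definition pullback ::
    "'p manifold \<Rightarrow> 'q manifold \<Rightarrow> ('p \<Rightarrow> 'q) \<Rightarrow> 'q form \<Rightarrow> 'p form" where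
  "pullback M M' f \<alpha> = (\<lambda>p vs. \<alpha> (f p) (map (tangent_map M M' f p) vs))"

definition form_kernel :: "'p manifold \<Rightarrow> 'p form \<Rightarrow> 'p \<Rightarrow> 'p tvec set" where
  "form_kernel M \<omega> p = {v \<in> tangent M p. \<forall>w\<in>tangent M p. \<omega> p [v, w] = 0}"

definition form_rank :: "'p manifold \<Rightarrow> 'p form \<Rightarrow> 'p \<Rightarrow> nat" where
  "form_rank M \<omega> p = dim (tangent M p) - dim (form_kernel M \<omega> p)"

definition nondegenerate_on :: "'p manifold \<Rightarrow> 'p set \<Rightarrow> 'p form \<Rightarrow> bool" where
  "nondegenerate_on M W \<Omega> \<longleftrightarrow>
     (\<forall>q\<in>W. \<forall>v\<in>tangent M q. (\<forall>w\<in>tangent M q. \<Omega> q [v, w] = 0) \<longrightarrow> v = 0)"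

definition coisotropic :: "'p manifold \<Rightarrow> 'p form \<Rightarrow> 'p set \<Rightarrow> bool" where
  "coisotropic M \<Omega> S \<longleftrightarrow>
     (\<forall>q\<in>S. {v \<in> tangent M q. \<forall>w\<in>sub_tangent M S q. \<Omega> q [v, w] = 0} \<subseteq> sub_tangent M S q)"


section \<open>Locally conformal pre-symplectic manifolds\<close>

definition lcps :: "'p manifold \<Rightarrow> 'p form \<Rightarrow> 'p form \<Rightarrow> bool" where
  "lcps Y \<omega> b \<longleftrightarrow> smooth_manifold Y \<and>
     smooth_form Y 1 b \<and> form_zero Y 2 (ext_deriv Y b) \<and>
     smooth_form Y 2 \<omega> \<and> (\<exists>r. \<forall>p\<in>points Y. form_rank Y \<omega> p = r) \<and>
     form_zero Y 3 (twisted_deriv Y b 2 \<omega>)"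

definition splitting ::
    "'p manifold \<Rightarrow> ('p \<Rightarrow> 'p tvec set) \<Rightarrow> ('p \<Rightarrow> 'p tvec set) \<Rightarrow> bool" where
  "splitting Y G E \<longleftrightarrow> (\<exists>r. smooth_subbundle Y r G) \<and>
     (\<forall>p\<in>points Y. G p \<inter> E p = {0} \<and> {g + e | g e. g \<in> G p \<and> e \<in> E p} = tangent Y p)"

definition proj_along :: "'v::real_vector set \<Rightarrow> 'v set \<Rightarrow> 'v \<Rightarrow> 'v" where
  "proj_along G E v = (THE e. e \<in> E \<and> v - e \<in> G)"

text \<open>Linear functionals on a subspace, extended by 0 outside it.\<close>

definition dual_space :: "'v::real_vector set \<Rightarrow> ('v \<Rightarrow> real) set" where
  "dual_space V = {\<alpha>. (\<forall>u\<in>V. \<forall>w\<in>V. \<alpha> (u + w) = \<alpha> u + \<alpha> w) \<and>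
     (\<forall>a. \<forall>u\<in>V. \<alpha> (a *\<^sub>R u) = a * \<alpha> u) \<and> (\<forall>u. u \<notin> V \<longrightarrow> \<alpha> u = 0)}"

type_synonym 'p covec = "'p \<times> ('p tvec \<Rightarrow> real)"

text \<open>
  The total space of the dual of a rank \<open>m\<close> subbundle \<open>E\<close> of the tangent bundle, with the charts
  given by a chart of the base and a local frame of \<open>E\<close>; its projection is \<^const>\<open>fst\<close>.
\<close>

definition dual_chart ::
    "'p manifold \<Rightarrow> ('p \<Rightarrow> 'p tvec set) \<Rightarrow> nat \<Rightarrow> 'p chart \<Rightarrow> 'p set \<Rightarrow>
     (nat \<Rightarrow> 'p \<Rightarrow> 'p tvec) \<Rightarrow> 'p covec chart" where
  "dual_chart Y E m c W e =
     ({(p, \<alpha>). p \<in> W \<and> \<alpha> \<in> dual_space (E p)},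
      \<lambda>(p, \<alpha>) i. if i < mdim Y then snd c p i
                  else if i < mdim Y + m then \<alpha> (e (i - mdim Y) p) else 0)"

definition dual_bundle :: "'p manifold \<Rightarrow> ('p \<Rightarrow> 'p tvec set) \<Rightarrow> nat \<Rightarrow> 'p covec manifold" where
  "dual_bundle Y E m = \<lparr>mdim = mdim Y + m,
     charts = {dual_chart Y E m c W e | c W e.
       c \<in> charts Y \<and> W \<subseteq> fst c \<and> local_frame Y E m W e}\<rparr>"

definition zero_section :: "'p manifold \<Rightarrow> 'p covec set" where
  "zero_section Y = {(p, \<lambda>_. 0) | p. p \<in> points Y}"

definition theta ::
    "'p manifold \<Rightarrow> ('p \<Rightarrow> 'p tvec set) \<Rightarrow> ('p \<Rightarrow> 'p tvec set) \<Rightarrow> nat \<Rightarrow> 'p covec form" where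
  "theta Y G E m = (\<lambda>q vs. snd q (proj_along (G (fst q)) (E (fst q))
     (tangent_map (dual_bundle Y E m) Y fst q (vs ! 0))))"

definition omega_G ::
    "'p manifold \<Rightarrow> 'p form \<Rightarrow> 'p form \<Rightarrow> ('p \<Rightarrow> 'p tvec set) \<Rightarrow> ('p \<Rightarrow> 'p tvec set) \<Rightarrow> nat \<Rightarrow>
     'p covec form" where
  "omega_G Y \<omega> b G E m =
     pullback (dual_bundle Y E m) Y fst \<omega>
     - ext_deriv (dual_bundle Y E m) (theta Y G E m)
     - wedge 1 1 (pullback (dual_bundle Y E m) Y fst b) (theta Y G E m)"

text \<open>The one-form \<open>p\<^sub>G\<^sup>*(s)\<close> on the base, for a section \<open>s\<close> of the dual bundle.\<close>

definition pG_star ::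
    "('p \<Rightarrow> 'p tvec set) \<Rightarrow> ('p \<Rightarrow> 'p tvec set) \<Rightarrow> ('p \<Rightarrow> 'p covec) \<Rightarrow> 'p form" where
  "pG_star G E s = (\<lambda>p vs. snd (s p) (proj_along (G p) (E p) (vs ! 0)))"

definition omega_G_section ::
    "'p manifold \<Rightarrow> 'p form \<Rightarrow> 'p form \<Rightarrow> ('p \<Rightarrow> 'p tvec set) \<Rightarrow> ('p \<Rightarrow> 'p tvec set) \<Rightarrow>
     ('p \<Rightarrow> 'p covec) \<Rightarrow> 'p form" where
  "omega_G_section Y \<omega> b G E s = \<omega> - twisted_deriv Y b 1 (pG_star G E s)"

end

theory Submission
  imports Defs
begin

text \<open>
  Let \<open>\<Gamma>\<close> be the graph of \<open>s\<close> and \<open>p\<close> a point of \<open>Y\<close>.  The criterion is pointwise, and it is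
  linear algebra on \<open>T = T\<^bsub>s p\<^esub>E\<^sup>*\<close>, of dimension \<open>2 n\<close>, and its subspace \<open>S = T\<^bsub>s p\<^esub>\<Gamma>\<close>, of
  dimension \<open>n + k\<close>.  Since \<open>\<omega>\<^sub>G\<close> is nondegenerate, the orthogonal complement \<open>C\<close> of \<open>S\<close> has
  dimension \<open>n - k\<close>, and the radical \<open>S \<inter> C\<close> of the restriction of \<open>\<omega>\<^sub>G\<close> to \<open>S\<close> has dimension at
  most \<open>n - k\<close>.  So \<open>C \<subseteq> S\<close> if and only if the radical is as large as possible, that is, if the
  restriction has rank at most \<open>2 k\<close>, that is, if its \<open>(k + 1)\<close>-st power vanishes
  (\<open>coisotropic_iff_pf_vanishes\<close>).

  It remains to identify the restriction.  The tangent map of \<open>s\<close> is an isomorphism from \<open>T\<^sub>pY\<close> onto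
  \<open>S\<close> (\<open>sub_tangent_section_image\<close>, \<open>T_L\<close>), and it takes the restriction of \<open>\<omega>\<^sub>G\<close> to
  \<open>s\<^sup>* \<omega>\<^sub>G = \<omega> - d\<^sup>b(p\<^sub>G\<^sup>* s)\<close>, because \<open>\<pi> \<circ> s = id\<close>, because \<open>s\<^sup>* \<theta>\<^sub>G = p\<^sub>G\<^sup>* s\<close>, and because \<open>s\<^sup>*\<close>
  commutes with \<open>d\<close> (\<open>omega_G_pullback\<close>).

  Three groups of facts carry this.  For the wedge powers, an expansion as a sum over permutations
  shows that \<open>\<sigma>\<^sup>m\<close> vanishes on vectors with a nontrivial combination in the radical of \<open>\<sigma>\<close>
  (\<open>pf_row_dependent\<close>) and does not vanish on a symplectic basis (\<open>pf_std_symp_pos\<close>).  For calculus on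
  manifolds, total derivatives in the form of Caratheodory give the chain rule for tangent maps
  (\<open>tangent_map_comp\<close>) and naturality of the exterior derivative (\<open>one_form_pullback_deriv\<close>).  For the
  dual bundle, both the transition maps and the form \<open>\<theta>\<^sub>G\<close> are expressed through coefficients of vector
  fields with respect to frames; that these coefficients are differentiable is \<open>tdiff_frame_coeffs\<close>.
\<close>

section \<open>Neighbourhoods in coordinate space\<close>

text \<open>
  The point itself is kept in the filter: a map that takes nearby points to \<open>x\<close> can then be
  composed without treating the points with value \<open>x\<close> separately.
\<close>

definition nbh :: "nat \<Rightarrow> (nat \<Rightarrow> real) \<Rightarrow> (nat \<Rightarrow> real) filter" where
  "nbh N x = inf (nhds x) (principal (Rn N))"

lemma Rn_upd: "x \<in> Rn N \<Longrightarrow> i < N \<Longrightarrow> x(i := t) \<in> Rn N"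
  by (auto simp: Rn_def)

lemma Rn_eqI: "x \<in> Rn N \<Longrightarrow> y \<in> Rn N \<Longrightarrow> (\<And>i. i < N \<Longrightarrow> x i = y i) \<Longrightarrow> x = y"
  unfolding Rn_def by (auto simp: fun_eq_iff) (metis not_less)

lemma tendsto_coord_nbh: "((\<lambda>y. y i) \<longlongrightarrow> x i) (nbh N x)"
proof -
  have "((\<lambda>y::nat\<Rightarrow>real. y i) \<longlongrightarrow> x i) (nhds x)"
    using continuous_on_product_coordinates[of i]
    by (metis UNIV_I continuous_on_eq_continuous_at continuous_within open_UNIV tendsto_nhds_iff)
  then show ?thesis unfolding nbh_def by (meson inf_le1 tendsto_mono)
qed

text \<open>
  A basic open set of the product topology constrains finitely many coordinates only, and points of
  \<open>\<real>\<^sup>N\<close> agree from \<open>N\<close> on; so the neighbourhoods are the cubes in the first \<open>N\<close> coordinates.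
\<close>

lemma eventually_nbh_iff:
  assumes "x \<in> Rn N"
  shows "eventually P (nbh N x) \<longleftrightarrow> (\<exists>\<delta>>0. \<forall>y\<in>Rn N. (\<forall>i<N. \<bar>y i - x i\<bar> < \<delta>) \<longrightarrow> P y)"
proof
  assume "eventually P (nbh N x)"
  then obtain S where S: "open S" "x \<in> S" "\<And>y. y \<in> S \<Longrightarrow> y \<in> Rn N \<Longrightarrow> P y"
    by (auto simp: nbh_def eventually_inf_principal eventually_nhds)
  have "openin (product_topology (\<lambda>i. euclidean) UNIV) S"
    using S(1) by (simp add: open_fun_def)
  from product_topology_open_contains_basis[OF this S(2)]
  obtain X where X: "x \<in> PiE UNIV X" "\<And>i. open (X i)" "PiE UNIV X \<subseteq> S"
    by auto
  have "\<exists>\<delta>>0. \<forall>t. \<bar>t - x i\<bar> < \<delta> \<longrightarrow> t \<in> X i" for i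
  proof -
    have "open (X i)" "x i \<in> X i" using X(1,2) by auto
    then show ?thesis unfolding open_dist dist_real_def by blast
  qed
  then obtain \<delta> where \<delta>: "\<And>i. \<delta> i > 0" "\<And>i t. \<bar>t - x i\<bar> < \<delta> i \<Longrightarrow> t \<in> X i"
    by metis
  define d where "d = Min (insert 1 (\<delta> ` {..<N}))"
  have d: "d > 0" "\<And>i. i < N \<Longrightarrow> d \<le> \<delta> i"
    using \<delta>(1) by (auto simp: d_def)
  have "P y" if y: "y \<in> Rn N" "\<forall>i<N. \<bar>y i - x i\<bar> < d" for y
  proof -
    have "y i \<in> X i" for i
    proof (cases "i < N")
      case True then show ?thesis using y d by (metis \<delta>(2) order_less_le_trans)
    next
      case False then show ?thesis using y assms \<delta>(1)[of i] \<delta>(2)[of "x i" i] by (auto simp: Rn_def)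
    qed
    then have "y \<in> PiE UNIV X" by auto
    then show ?thesis using X(3) S(3) y(1) by blast
  qed
  then show "\<exists>\<delta>>0. \<forall>y\<in>Rn N. (\<forall>i<N. \<bar>y i - x i\<bar> < \<delta>) \<longrightarrow> P y" using d by blast
next
  assume "\<exists>\<delta>>0. \<forall>y\<in>Rn N. (\<forall>i<N. \<bar>y i - x i\<bar> < \<delta>) \<longrightarrow> P y"
  then obtain \<delta> where \<delta>: "\<delta> > 0" "\<forall>y\<in>Rn N. (\<forall>i<N. \<bar>y i - x i\<bar> < \<delta>) \<longrightarrow> P y" by blast
  have "\<forall>\<^sub>F y in nbh N x. \<forall>i\<in>{..<N}. \<bar>y i - x i\<bar> < \<delta>"
    using tendsto_coord_nbh \<delta>(1)
    by (intro eventually_ball_finite) (auto simp: tendsto_iff dist_real_def)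
  moreover have "\<forall>\<^sub>F y in nbh N x. y \<in> Rn N" by (simp add: nbh_def eventually_inf_principal)
  ultimately show "eventually P (nbh N x)" by eventually_elim (use \<delta>(2) in auto)
qed

lemma eventually_nbh_Rn: "\<forall>\<^sub>F y in nbh N x. y \<in> Rn N"
  by (simp add: nbh_def eventually_inf_principal)

lemma eventually_nbh_self: "x \<in> Rn N \<Longrightarrow> eventually P (nbh N x) \<Longrightarrow> P x"
  by (auto simp: eventually_nbh_iff)

lemma filterlim_nbh:
  assumes "\<And>i. i < M \<Longrightarrow> ((\<lambda>y. F y i) \<longlongrightarrow> z i) G" "\<forall>\<^sub>F y in G. F y \<in> Rn M" "z \<in> Rn M"
  shows "filterlim F (nbh M z) G"
  unfolding filterlim_iff
proof (intro allI impI)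
  fix P assume "eventually P (nbh M z)"
  then obtain \<delta> where \<delta>: "\<delta> > 0" "\<forall>y\<in>Rn M. (\<forall>i<M. \<bar>y i - z i\<bar> < \<delta>) \<longrightarrow> P y"
    using assms(3) by (auto simp: eventually_nbh_iff)
  have "\<forall>\<^sub>F y in G. \<forall>i\<in>{..<M}. \<bar>F y i - z i\<bar> < \<delta>"
    using assms(1) \<delta>(1)
    by (intro eventually_ball_finite) (auto simp: tendsto_iff dist_real_def)
  then show "\<forall>\<^sub>F y in G. P (F y)" using assms(2) by eventually_elim (use \<delta>(2) in auto)
qed

lemma open_Rn_imp_eventually:
  assumes "open_Rn N W" "x \<in> W" shows "\<forall>\<^sub>F y in nbh N x. y \<in> W"
proof -
  obtain S where "open S" "W = Rn N \<inter> S" using assms(1) by (auto simp: open_Rn_def openin_open)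
  then show ?thesis using assms(2) by (auto simp: nbh_def eventually_inf_principal eventually_nhds)
qed

lemma open_Rn_subset: "open_Rn N W \<Longrightarrow> W \<subseteq> Rn N"
  by (auto simp: open_Rn_def openin_open)

lemma open_RnI:
  assumes "W \<subseteq> Rn N" "\<And>x. x \<in> W \<Longrightarrow> \<forall>\<^sub>F y in nbh N x. y \<in> W"
  shows "open_Rn N W"
  unfolding open_Rn_def
proof (subst openin_subopen, intro ballI)
  fix x assume x: "x \<in> W"
  from assms(2)[OF x] obtain S where "open S" "x \<in> S" "\<And>y. y \<in> S \<Longrightarrow> y \<in> Rn N \<Longrightarrow> y \<in> W"
    by (auto simp: nbh_def eventually_inf_principal eventually_nhds)
  then show "\<exists>T. openin (top_of_set (Rn N)) T \<and> x \<in> T \<and> T \<subseteq> W"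
    using assms(1) x by (intro exI[of _ "Rn N \<inter> S"]) (auto simp: openin_open)
qed

lemma continuous_on_open_Rn_tendsto:
  assumes "open_Rn N W" "continuous_on W f" "x \<in> W"
  shows "(f \<longlongrightarrow> (f x :: real)) (nbh N x)"
proof -
  obtain S where S: "open S" "W = Rn N \<inter> S" using assms(1) by (auto simp: open_Rn_def openin_open)
  show ?thesis
  proof (rule topological_tendstoI)
    fix T assume T: "open T" "f x \<in> T"
    have "openin (top_of_set W) (W \<inter> f -` T)" using assms(2) T(1) by (simp add: continuous_openin_preimage_gen)
    then obtain R where R: "open R" "W \<inter> f -` T = W \<inter> R" by (auto simp: openin_open)
    have "x \<in> S \<inter> R" using R assms(3) T S by auto
    moreover have "\<forall>y\<in>S \<inter> R. y \<in> Rn N \<longrightarrow> f y \<in> T" using R S by auto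
    ultimately show "\<forall>\<^sub>F y in nbh N x. f y \<in> T"
      unfolding nbh_def eventually_inf_principal eventually_nhds using S(1) R(1)
      by (metis open_Int)
  qed
qed

lemma continuous_onI_nbh:
  fixes f :: "(nat \<Rightarrow> real) \<Rightarrow> real"
  assumes "W \<subseteq> Rn N" "\<And>x. x \<in> W \<Longrightarrow> (f \<longlongrightarrow> f x) (nbh N x)"
  shows "continuous_on W f"
  unfolding continuous_on
proof
  fix x assume "x \<in> W"
  then have "(f \<longlongrightarrow> f x) (nbh N x)" by (rule assms)
  moreover have "at x within W \<le> nbh N x"
    unfolding at_within_def nbh_def using assms(1) by (intro inf_mono) auto
  ultimately show "(f \<longlongrightarrow> f x) (at x within W)" by (rule tendsto_mono[rotated])
qed

lemma filterlim_upd_nbh: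
  assumes "x \<in> Rn N" "i < N"
  shows "filterlim (\<lambda>t. x(i := t)) (nbh N x) (nhds (x i))"
proof (rule filterlim_nbh)
  show "((\<lambda>t. (x(i := t)) j) \<longlongrightarrow> x j) (nhds (x i))" for j
    by (cases "j = i") (auto simp: filterlim_ident)
qed (use assms in \<open>auto simp: Rn_upd\<close>)

section \<open>Total derivatives\<close>

text \<open>
  Caratheodory's form of the total derivative: the increment of \<open>f\<close> is a combination of the
  increments of the coordinates whose coefficients are continuous at \<open>x\<close>.  Compared with an
  estimate of a remainder, this reduces the product rule and the chain rule to algebra.
\<close>

definition has_pds :: "nat \<Rightarrow> ((nat \<Rightarrow> real) \<Rightarrow> real) \<Rightarrow> (nat \<Rightarrow> real) \<Rightarrow> (nat \<Rightarrow> real) \<Rightarrow> bool" where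
  "has_pds N f x D \<longleftrightarrow> (\<exists>\<phi>. (\<forall>i<N. (\<phi> i \<longlongrightarrow> D i) (nbh N x)) \<and>
     (\<forall>\<^sub>F y in nbh N x. f y = f x + (\<Sum>i<N. \<phi> i y * (y i - x i))))"

text \<open>
  The coefficients are necessarily the partial derivatives (\<open>has_pds_pd\<close>), so they need not be named.
\<close>

definition tdiff :: "nat \<Rightarrow> ((nat \<Rightarrow> real) \<Rightarrow> real) \<Rightarrow> (nat \<Rightarrow> real) \<Rightarrow> bool" where
  "tdiff N f x \<longleftrightarrow> has_pds N f x (\<lambda>i. pd i f x)"

lemma has_pdsE:
  assumes "has_pds N f x D"
  obtains \<phi> where "\<And>i. i < N \<Longrightarrow> (\<phi> i \<longlongrightarrow> D i) (nbh N x)"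
    "\<forall>\<^sub>F y in nbh N x. f y = f x + (\<Sum>i<N. \<phi> i y * (y i - x i))"
  using assms by (auto simp: has_pds_def)

lemma has_pds_imp_DERIV:
  assumes "has_pds N f x D" "x \<in> Rn N" "i < N"
  shows "((\<lambda>t. f (x(i := t))) has_real_derivative D i) (at (x i))"
proof -
  obtain \<phi> where \<phi>: "\<And>i. i < N \<Longrightarrow> (\<phi> i \<longlongrightarrow> D i) (nbh N x)"
    "\<forall>\<^sub>F y in nbh N x. f y = f x + (\<Sum>i<N. \<phi> i y * (y i - x i))"
    by (rule has_pdsE[OF assms(1)]) (rule that)
  have lim: "filterlim (\<lambda>t. x(i := t)) (nbh N x) (nhds (x i))" by (rule filterlim_upd_nbh) fact+
  have 1: "\<forall>\<^sub>F t in nhds (x i). f (x(i := t)) = f x + (\<Sum>j<N. \<phi> j (x(i := t)) * ((x(i := t)) j - x j))"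
    using lim \<phi>(2) by (auto simp: filterlim_iff)
  have s: "(\<Sum>j<N. \<phi> j (x(i := t)) * ((x(i := t)) j - x j)) = \<phi> i (x(i := t)) * (t - x i)" for t
    using sum.remove[of "{..<N}" i "\<lambda>j. \<phi> j (x(i := t)) * ((x(i := t)) j - x j)"] assms(3) by simp
  have 2: "\<forall>\<^sub>F t in at (x i). \<phi> i (x(i := t)) = (f (x(i := t)) - f (x(i := x i))) / (t - x i)"
    using 1 unfolding s eventually_nhds_conv_at
    by (auto elim: eventually_mono simp: eventually_at_filter)
  have "((\<lambda>t. \<phi> i (x(i := t))) \<longlongrightarrow> D i) (nhds (x i))"
    using filterlim_compose[OF \<phi>(1)[OF assms(3)] lim] .
  then have "((\<lambda>t. \<phi> i (x(i := t))) \<longlongrightarrow> D i) (at (x i))"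
    by (simp add: tendsto_nhds_iff)
  then have "((\<lambda>t. (f (x(i := t)) - f (x(i := x i))) / (t - x i)) \<longlongrightarrow> D i) (at (x i))"
    by (rule Lim_transform_eventually[OF _ 2])
  then show ?thesis unfolding has_field_derivative_iff by simp
qed

lemma has_pds_pd: "has_pds N f x D \<Longrightarrow> x \<in> Rn N \<Longrightarrow> i < N \<Longrightarrow> pd i f x = D i"
  unfolding pd_def by (rule DERIV_imp_deriv) (rule has_pds_imp_DERIV)

lemma has_pds_cong_D:
  assumes "has_pds N f x D" "\<And>i. i < N \<Longrightarrow> D i = D' i" shows "has_pds N f x D'"
proof -
  obtain \<phi> where "\<And>i. i < N \<Longrightarrow> (\<phi> i \<longlongrightarrow> D i) (nbh N x)"
    "\<forall>\<^sub>F y in nbh N x. f y = f x + (\<Sum>i<N. \<phi> i y * (y i - x i))"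
    by (rule has_pdsE[OF assms(1)]) (rule that)
  then show ?thesis unfolding has_pds_def using assms(2) by (intro exI[of _ \<phi>]) auto
qed

lemma has_pds_tdiff: "has_pds N f x D \<Longrightarrow> x \<in> Rn N \<Longrightarrow> tdiff N f x"
  unfolding tdiff_def by (rule has_pds_cong_D) (auto simp: has_pds_pd)

lemma has_pds_dir_deriv: "has_pds N f x D \<Longrightarrow> x \<in> Rn N \<Longrightarrow> dir_deriv N f x u = (\<Sum>i<N. D i * u i)"
  unfolding dir_deriv_def by (intro sum.cong) (auto simp: has_pds_pd)

lemma has_pds_cong:
  assumes "has_pds N f x D" "\<forall>\<^sub>F y in nbh N x. f y = g y" "x \<in> Rn N" shows "has_pds N g x D"
proof -
  obtain \<phi> where \<phi>: "\<And>i. i < N \<Longrightarrow> (\<phi> i \<longlongrightarrow> D i) (nbh N x)"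
    "\<forall>\<^sub>F y in nbh N x. f y = f x + (\<Sum>i<N. \<phi> i y * (y i - x i))"
    by (rule has_pdsE[OF assms(1)]) (rule that)
  have "f x = g x" by (rule eventually_nbh_self[OF assms(3,2)])
  have "\<forall>\<^sub>F y in nbh N x. g y = g x + (\<Sum>i<N. \<phi> i y * (y i - x i))"
    using \<phi>(2) assms(2) by eventually_elim (simp add: \<open>f x = g x\<close>)
  then show ?thesis using \<phi>(1) by (auto simp: has_pds_def)
qed

lemma tdiff_cong:
  "tdiff N f x \<Longrightarrow> \<forall>\<^sub>F y in nbh N x. f y = g y \<Longrightarrow> x \<in> Rn N \<Longrightarrow> tdiff N g x"
  unfolding tdiff_def[of N f] by (rule has_pds_tdiff[OF has_pds_cong])

lemma dir_deriv_cong: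
  assumes "tdiff N f x" "\<forall>\<^sub>F y in nbh N x. f y = g y" "x \<in> Rn N"
  shows "dir_deriv N f x u = dir_deriv N g x u"
  using has_pds_dir_deriv[OF has_pds_cong[OF assms(1)[unfolded tdiff_def] assms(2,3)] assms(3)]
  by (simp add: dir_deriv_def[of N f])

lemma has_pds_tendsto:
  assumes "has_pds N f x D" shows "(f \<longlongrightarrow> f x) (nbh N x)"
proof -
  obtain \<phi> where \<phi>: "\<And>i. i < N \<Longrightarrow> (\<phi> i \<longlongrightarrow> D i) (nbh N x)"
    "\<forall>\<^sub>F y in nbh N x. f y = f x + (\<Sum>i<N. \<phi> i y * (y i - x i))"
    by (rule has_pdsE[OF assms(1)]) (rule that)
  have "((\<lambda>y. f x + (\<Sum>i<N. \<phi> i y * (y i - x i))) \<longlongrightarrow> f x + (\<Sum>i<N. D i * (x i - x i))) (nbh N x)"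
    by (intro tendsto_intros tendsto_coord_nbh \<phi>(1)) auto
  then have "((\<lambda>y. f x + (\<Sum>i<N. \<phi> i y * (y i - x i))) \<longlongrightarrow> f x) (nbh N x)" by simp
  then show ?thesis by (rule Lim_transform_eventually) (use \<phi>(2) in \<open>auto elim: eventually_mono\<close>)
qed

lemma has_pds_const: "has_pds N (\<lambda>_. c) x (\<lambda>_. 0)"
  unfolding has_pds_def by (intro exI[of _ "\<lambda>_ _. 0"]) auto

lemma has_pds_coord:
  assumes "j < N" shows "has_pds N (\<lambda>y. y j) x (\<lambda>i. if i = j then 1 else 0)"
proof -
  have "(\<Sum>i<N. (if i = j then 1 else 0) * (y i - x i)) = y j - x j" for y
    using assms by (simp add: if_distrib[of "\<lambda>a. a * _"] cong: if_cong)
  then show ?thesis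
    unfolding has_pds_def by (intro exI[of _ "\<lambda>i _. if i = j then 1 else 0"]) auto
qed

lemma has_pds_add:
  assumes "has_pds N f x D" "has_pds N g x D'"
  shows "has_pds N (\<lambda>y. f y + g y) x (\<lambda>i. D i + D' i)"
proof -
  obtain \<phi> where \<phi>: "\<And>i. i < N \<Longrightarrow> (\<phi> i \<longlongrightarrow> D i) (nbh N x)"
    "\<forall>\<^sub>F y in nbh N x. f y = f x + (\<Sum>i<N. \<phi> i y * (y i - x i))"
    by (rule has_pdsE[OF assms(1)]) (rule that)
  obtain \<psi> where \<psi>: "\<And>i. i < N \<Longrightarrow> (\<psi> i \<longlongrightarrow> D' i) (nbh N x)"
    "\<forall>\<^sub>F y in nbh N x. g y = g x + (\<Sum>i<N. \<psi> i y * (y i - x i))"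
    by (rule has_pdsE[OF assms(2)]) (rule that)
  have "\<forall>\<^sub>F y in nbh N x. f y + g y = f x + g x + (\<Sum>i<N. (\<phi> i y + \<psi> i y) * (y i - x i))"
    using \<phi>(2) \<psi>(2) by eventually_elim (simp add: sum.distrib distrib_right)
  then show ?thesis unfolding has_pds_def
    by (intro exI[of _ "\<lambda>i y. \<phi> i y + \<psi> i y"]) (auto intro!: tendsto_intros \<phi>(1) \<psi>(1))
qed

lemma has_pds_mult:
  assumes "has_pds N f x D" "has_pds N g x D'"
  shows "has_pds N (\<lambda>y. f y * g y) x (\<lambda>i. D i * g x + f x * D' i)"
proof -
  obtain \<phi> where \<phi>: "\<And>i. i < N \<Longrightarrow> (\<phi> i \<longlongrightarrow> D i) (nbh N x)"
    "\<forall>\<^sub>F y in nbh N x. f y = f x + (\<Sum>i<N. \<phi> i y * (y i - x i))"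
    by (rule has_pdsE[OF assms(1)]) (rule that)
  obtain \<psi> where \<psi>: "\<And>i. i < N \<Longrightarrow> (\<psi> i \<longlongrightarrow> D' i) (nbh N x)"
    "\<forall>\<^sub>F y in nbh N x. g y = g x + (\<Sum>i<N. \<psi> i y * (y i - x i))"
    by (rule has_pdsE[OF assms(2)]) (rule that)
  have "\<forall>\<^sub>F y in nbh N x. f y * g y = f x * g x + (\<Sum>i<N. (\<phi> i y * g y + f x * \<psi> i y) * (y i - x i))"
    using \<phi>(2) \<psi>(2)
  proof eventually_elim
    case (elim y)
    have "f y * g y = (f y - f x) * g y + f x * (g y - g x) + f x * g x" by algebra
    also have "f y - f x = (\<Sum>i<N. \<phi> i y * (y i - x i))" using elim by linarith
    also have "g y - g x = (\<Sum>i<N. \<psi> i y * (y i - x i))" using elim by linarith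
    finally show ?case by (simp add: sum_distrib_left sum_distrib_right algebra_simps sum.distrib sum_subtractf)
  qed
  then show ?thesis unfolding has_pds_def
    by (intro exI[of _ "\<lambda>i y. \<phi> i y * g y + f x * \<psi> i y"])
      (auto intro!: tendsto_intros \<phi>(1) \<psi>(1) has_pds_tendsto[OF assms(2)])
qed

lemma has_pds_sum:
  assumes "\<And>a. a \<in> A \<Longrightarrow> has_pds N (f a) x (D a)"
  shows "has_pds N (\<lambda>y. \<Sum>a\<in>A. f a y) x (\<lambda>i. \<Sum>a\<in>A. D a i)"
  using assms by (induction A rule: infinite_finite_induct) (auto intro: has_pds_const has_pds_add)

lemma tdiff_const: "x \<in> Rn N \<Longrightarrow> tdiff N (\<lambda>_. c) x"
  by (rule has_pds_tdiff[OF has_pds_const])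

lemma tdiff_coord: "j < N \<Longrightarrow> x \<in> Rn N \<Longrightarrow> tdiff N (\<lambda>y. y j) x"
  by (rule has_pds_tdiff[OF has_pds_coord])

lemma tdiff_mult: "tdiff N f x \<Longrightarrow> tdiff N g x \<Longrightarrow> x \<in> Rn N \<Longrightarrow> tdiff N (\<lambda>y. f y * g y) x"
  unfolding tdiff_def[of _ f] tdiff_def[of _ g] by (rule has_pds_tdiff[OF has_pds_mult])

lemma tdiff_sum: "(\<And>a. a \<in> A \<Longrightarrow> tdiff N (f a) x) \<Longrightarrow> x \<in> Rn N \<Longrightarrow> tdiff N (\<lambda>y. \<Sum>a\<in>A. f a y) x"
  by (rule has_pds_tdiff[OF has_pds_sum]) (auto simp: tdiff_def)

lemma tdiff_tendsto: "tdiff N f x \<Longrightarrow> (f \<longlongrightarrow> f x) (nbh N x)"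
  unfolding tdiff_def by (rule has_pds_tendsto)

lemma filterlim_tdiff:
  assumes "\<And>j. j < M \<Longrightarrow> tdiff N (\<lambda>y. F y j) x" "\<forall>\<^sub>F y in nbh N x. F y \<in> Rn M" "x \<in> Rn N"
  shows "filterlim F (nbh M (F x)) (nbh N x)"
  by (rule filterlim_nbh) (use assms eventually_nbh_self in \<open>auto intro: tdiff_tendsto\<close>)

lemma has_pds_compose:
  assumes F: "\<And>j. j < M \<Longrightarrow> has_pds N (\<lambda>y. F y j) x (DF j)" and R: "\<forall>\<^sub>F y in nbh N x. F y \<in> Rn M"
    and x: "x \<in> Rn N" and g: "has_pds M g (F x) D"
  shows "has_pds N (\<lambda>y. g (F y)) x (\<lambda>i. \<Sum>j<M. D j * DF j i)"
proof -
  have "\<forall>j. \<exists>\<phi>. j < M \<longrightarrow> (\<forall>i<N. (\<phi> i \<longlongrightarrow> DF j i) (nbh N x)) \<and>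
      (\<forall>\<^sub>F y in nbh N x. F y j = F x j + (\<Sum>i<N. \<phi> i y * (y i - x i)))"
    using F by (simp add: has_pds_def)
  from choice[OF this] obtain \<phi> where "\<forall>j. j < M \<longrightarrow> (\<forall>i<N. (\<phi> j i \<longlongrightarrow> DF j i) (nbh N x)) \<and>
      (\<forall>\<^sub>F y in nbh N x. F y j = F x j + (\<Sum>i<N. \<phi> j i y * (y i - x i)))"
    by blast
  then have \<phi>: "\<And>j i. j < M \<Longrightarrow> i < N \<Longrightarrow> (\<phi> j i \<longlongrightarrow> DF j i) (nbh N x)"
      "\<And>j. j < M \<Longrightarrow> (\<forall>\<^sub>F y in nbh N x. F y j = F x j + (\<Sum>i<N. \<phi> j i y * (y i - x i)))"
    by auto
  obtain \<psi> where \<psi>: "\<And>j. j < M \<Longrightarrow> (\<psi> j \<longlongrightarrow> D j) (nbh M (F x))"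
    "\<forall>\<^sub>F z in nbh M (F x). g z = g (F x) + (\<Sum>j<M. \<psi> j z * (z j - F x j))"
    using g by (auto simp: has_pds_def)
  have lim: "filterlim F (nbh M (F x)) (nbh N x)"
    by (rule filterlim_nbh) (use F R x eventually_nbh_self in \<open>auto intro: has_pds_tendsto\<close>)
  have "\<forall>\<^sub>F y in nbh N x. \<forall>j\<in>{..<M}. F y j = F x j + (\<Sum>i<N. \<phi> j i y * (y i - x i))"
    using \<phi>(2) by (intro eventually_ball_finite) auto
  moreover have "\<forall>\<^sub>F y in nbh N x. g (F y) = g (F x) + (\<Sum>j<M. \<psi> j (F y) * (F y j - F x j))"
    using lim \<psi>(2) by (auto simp: filterlim_iff)
  ultimately have "\<forall>\<^sub>F y in nbh N x. g (F y) = g (F x) + (\<Sum>i<N. (\<Sum>j<M. \<psi> j (F y) * \<phi> j i y) * (y i - x i))"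
  proof eventually_elim
    case (elim y)
    have "g (F y) = g (F x) + (\<Sum>j<M. \<psi> j (F y) * (\<Sum>i<N. \<phi> j i y * (y i - x i)))"
      unfolding elim(2) using elim(1) by (intro arg_cong2[where f = "(+)"] sum.cong) auto
    also have "(\<Sum>j<M. \<psi> j (F y) * (\<Sum>i<N. \<phi> j i y * (y i - x i))) = (\<Sum>i<N. (\<Sum>j<M. \<psi> j (F y) * \<phi> j i y) * (y i - x i))"
      by (simp add: sum_distrib_left sum_distrib_right mult.assoc) (rule sum.swap)
    finally show ?case .
  qed
  moreover have "((\<lambda>y. \<Sum>j<M. \<psi> j (F y) * \<phi> j i y) \<longlongrightarrow> (\<Sum>j<M. D j * DF j i)) (nbh N x)" if "i < N" for i
    using that by (intro tendsto_intros \<phi>(1) filterlim_compose[OF \<psi>(1) lim]) auto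
  ultimately show ?thesis unfolding has_pds_def
    by (intro exI[of _ "\<lambda>i y. \<Sum>j<M. \<psi> j (F y) * \<phi> j i y"]) auto
qed

lemma tdiff_compose:
  assumes "\<And>j. j < M \<Longrightarrow> tdiff N (\<lambda>y. F y j) x" "\<forall>\<^sub>F y in nbh N x. F y \<in> Rn M"
    "x \<in> Rn N" "tdiff M g (F x)"
  shows "tdiff N (\<lambda>y. g (F y)) x"
  using assms unfolding tdiff_def[of _ _ "F x"] tdiff_def[of _ "\<lambda>y. F y _"]
  by (intro has_pds_tdiff[OF has_pds_compose]) auto

lemma dir_deriv_compose:
  assumes "\<And>j. j < M \<Longrightarrow> tdiff N (\<lambda>y. F y j) x" "\<forall>\<^sub>F y in nbh N x. F y \<in> Rn M"
    "x \<in> Rn N" "tdiff M g (F x)"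
  shows "dir_deriv N (\<lambda>y. g (F y)) x u = dir_deriv M g (F x) (\<lambda>j. dir_deriv N (\<lambda>y. F y j) x u)"
proof -
  have "has_pds N (\<lambda>y. g (F y)) x (\<lambda>i. \<Sum>j<M. pd j g (F x) * pd i (\<lambda>y. F y j) x)"
    using assms unfolding tdiff_def by (intro has_pds_compose) auto
  then show ?thesis unfolding dir_deriv_def[of M]
    by (simp add: has_pds_dir_deriv assms(3))
      (simp add: dir_deriv_def sum_distrib_left sum_distrib_right mult.assoc, rule sum.swap)
qed

section \<open>Continuously differentiable functions\<close>

lemma eventually_nbhE:
  assumes "eventually P (nbh N x)" "x \<in> Rn N"
  obtains \<delta> where "\<delta> > 0" "\<And>y. y \<in> Rn N \<Longrightarrow> (\<forall>i<N. \<bar>y i - x i\<bar> < \<delta>) \<Longrightarrow> P y"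
proof -
  obtain \<delta> where "\<delta> > 0" "\<forall>y\<in>Rn N. (\<forall>i<N. \<bar>y i - x i\<bar> < \<delta>) \<longrightarrow> P y"
    using assms(1) unfolding eventually_nbh_iff[OF assms(2)] by (elim exE conjE)
  then show thesis by (intro that) auto
qed

lemma Ck_on_continuous: "Ck_on N r W f \<Longrightarrow> continuous_on W f"
  by (cases r) auto

lemma Ck_on_subset: "Ck_on N r W f \<Longrightarrow> W' \<subseteq> W \<Longrightarrow> Ck_on N r W' f"
  by (induction r arbitrary: f) (auto intro: continuous_on_subset)

text \<open>
  The mean value theorem along a coordinate line, with the end points in either order.
\<close>

lemma mvt_coord:
  assumes W: "\<And>t. t \<in> closed_segment a b \<Longrightarrow> x(i := t) \<in> W"
    and C: "\<And>x. x \<in> W \<Longrightarrow> (\<lambda>t. f (x(i := t))) differentiable at (x i)"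
  shows "\<exists>\<xi>\<in>closed_segment a b. f (x(i := b)) - f (x(i := a)) = pd i f (x(i := \<xi>)) * (b - a)"
proof -
  have D: "((\<lambda>t. f (x(i := t))) has_real_derivative pd i f (x(i := t))) (at t)" if "t \<in> closed_segment a b" for t
    using C[OF W[OF that]] by (simp add: pd_def field_differentiable_derivI real_differentiable_def field_differentiable_def DERIV_deriv_iff_real_differentiable)
  consider "a = b" | "a < b" | "b < a" by linarith
  then show ?thesis
  proof cases
    case 1 then show ?thesis by auto
  next
    case 2
    then obtain z where "a < z" "z < b" "f (x(i := b)) - f (x(i := a)) = (b - a) * pd i f (x(i := z))"
      using MVT2[of a b "\<lambda>t. f (x(i := t))" "\<lambda>t. pd i f (x(i := t))"] D
      by (auto simp: closed_segment_eq_real_ivl)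
    then show ?thesis using 2 by (intro bexI[of _ z]) (auto simp: closed_segment_eq_real_ivl)
  next
    case 3
    then obtain z where "b < z" "z < a" "f (x(i := a)) - f (x(i := b)) = (a - b) * pd i f (x(i := z))"
      using MVT2[of b a "\<lambda>t. f (x(i := t))" "\<lambda>t. pd i f (x(i := t))"] D
      by (auto simp: closed_segment_eq_real_ivl)
    then show ?thesis using 3 by (intro bexI[of _ z]) (auto simp: closed_segment_eq_real_ivl algebra_simps)
  qed
qed

text \<open>
  The classical argument that continuous partial derivatives give a total derivative: walk from
  \<open>x\<close> to \<open>y\<close> changing one coordinate at a time and apply the mean value theorem to each step.
\<close>

lemma Ck_on_imp_tdiff:
  assumes W: "open_Rn N W" and f: "Ck_on N (Suc r) W f" and x: "x \<in> W"
  shows "tdiff N f x"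
proof -
  have xN: "x \<in> Rn N" using W x open_Rn_subset by blast
  obtain \<delta>0 where \<delta>0: "\<delta>0 > 0" "\<And>y. y \<in> Rn N \<Longrightarrow> (\<forall>i<N. \<bar>y i - x i\<bar> < \<delta>0) \<Longrightarrow> y \<in> W"
    by (rule eventually_nbhE[OF open_Rn_imp_eventually[OF W x] xN]) (rule that)
  \<comment> \<open>The \<open>i\<close>-th corner of the walk; its first \<open>i\<close> coordinates are already those of \<open>y\<close>.\<close>
  define z where "z y i = (\<lambda>j. if j < i then y j else x j)" for y :: "nat \<Rightarrow> real" and i :: nat
  define \<phi> where "\<phi> i y = (if y i = x i then pd i f (z y i)
      else (f (z y (Suc i)) - f (z y i)) / (y i - x i))" for i y
  have zS: "z y (Suc i) = (z y i)(i := y i)" "z y i = (z y i)(i := x i)" for y i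
    by (auto simp: z_def fun_eq_iff less_Suc_eq)
  have key: "\<exists>w\<in>Rn N. (\<forall>j<N. \<bar>w j - x j\<bar> < \<delta>) \<and> \<phi> i y = pd i f w"
    if i: "i < N" and y: "y \<in> Rn N" "\<forall>j<N. \<bar>y j - x j\<bar> < \<delta>" and \<delta>: "\<delta> \<le> \<delta>0" for i y \<delta>
  proof -
    have "\<delta> > 0" using y(2) i by (metis abs_ge_zero le_less_trans)
    have box: "(z y i)(i := t) \<in> Rn N \<and> (\<forall>j<N. \<bar>((z y i)(i := t)) j - x j\<bar> < \<delta>)"
      if t: "t \<in> closed_segment (x i) (y i)" for t
    proof -
      have "\<bar>t - x i\<bar> < \<delta>" using t y(2) i by (auto simp: closed_segment_eq_real_ivl split: if_splits)
      then show ?thesis using y xN i \<open>\<delta> > 0\<close> by (auto simp: z_def Rn_def)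
    qed
    obtain \<xi> where \<xi>: "\<xi> \<in> closed_segment (x i) (y i)"
      "f ((z y i)(i := y i)) - f ((z y i)(i := x i)) = pd i f ((z y i)(i := \<xi>)) * (y i - x i)"
      using mvt_coord[of "x i" "y i" "z y i" i W f] box \<delta>0(2) \<delta> f i by fastforce
    show ?thesis
    proof (cases "y i = x i")
      case True
      then show ?thesis using box[of "x i"] zS(2)[of y i] by (auto simp: \<phi>_def)
    next
      case False
      then have "\<phi> i y = pd i f ((z y i)(i := \<xi>))"
        using \<xi>(2) zS[of y i] by (simp add: \<phi>_def field_simps)
      then show ?thesis using box[OF \<xi>(1)] by blast
    qed
  qed
  have "(\<phi> i \<longlongrightarrow> pd i f x) (nbh N x)" if i: "i < N" for i
  proof (rule tendstoI)
    fix e :: real assume "e > 0"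
    have "(pd i f \<longlongrightarrow> pd i f x) (nbh N x)"
      using f i by (intro continuous_on_open_Rn_tendsto[OF W _ x]) (auto intro: Ck_on_continuous)
    then have "\<forall>\<^sub>F y in nbh N x. dist (pd i f y) (pd i f x) < e" using \<open>e > 0\<close> by (rule tendstoD)
    then obtain d where d: "d > 0" "\<And>y. y \<in> Rn N \<Longrightarrow> (\<forall>i<N. \<bar>y i - x i\<bar> < d) \<Longrightarrow> dist (pd i f y) (pd i f x) < e"
      by (rule eventually_nbhE[OF _ xN]) (rule that)
    show "\<forall>\<^sub>F y in nbh N x. dist (\<phi> i y) (pd i f x) < e"
      unfolding eventually_nbh_iff[OF xN]
    proof (intro exI[of _ "min d \<delta>0"] conjI ballI impI)
      show "min d \<delta>0 > 0" using d \<delta>0 by simp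
      fix y assume y: "y \<in> Rn N" "\<forall>i<N. \<bar>y i - x i\<bar> < min d \<delta>0"
      from key[OF i y] obtain w where "w \<in> Rn N" "\<forall>j<N. \<bar>w j - x j\<bar> < min d \<delta>0" "\<phi> i y = pd i f w" by auto
      then show "dist (\<phi> i y) (pd i f x) < e" using d(2)[of w] by auto
    qed
  qed
  moreover have "f y = f x + (\<Sum>i<N. \<phi> i y * (y i - x i))" if y: "y \<in> Rn N" for y
  proof -
    have "z y N = y" using y xN by (auto simp: z_def Rn_def fun_eq_iff)
    moreover have "z y 0 = x" by (simp add: z_def)
    moreover have "(\<Sum>i<N. f (z y (Suc i)) - f (z y i)) = f (z y N) - f (z y 0)"
      by (rule sum_lessThan_telescope)
    moreover have "\<phi> i y * (y i - x i) = f (z y (Suc i)) - f (z y i)" for i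
      using zS[of y i] by (auto simp: \<phi>_def)
    ultimately show ?thesis by simp
  qed
  then have "\<forall>\<^sub>F y in nbh N x. f y = f x + (\<Sum>i<N. \<phi> i y * (y i - x i))"
    using eventually_nbh_Rn[of N x] by (auto elim!: eventually_mono)
  ultimately show ?thesis unfolding tdiff_def has_pds_def by blast
qed

text \<open>
  Two applications of the mean value theorem, first in direction \<open>i\<close> and then in direction \<open>j\<close>.
  The second difference on the left does not change when \<open>i\<close> and \<open>j\<close> are exchanged, and this is
  where the symmetry of second derivatives comes from.
\<close>

lemma second_difference:
  assumes C: "\<And>x. x \<in> W \<Longrightarrow> (\<lambda>t. f (x(i := t))) differentiable at (x i)"
    and C2: "\<And>x. x \<in> W \<Longrightarrow> (\<lambda>t. pd i f (x(j := t))) differentiable at (x j)"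
    and ij: "i \<noteq> j" and h: "h > 0"
    and W: "\<And>s t. \<bar>s - x i\<bar> \<le> h \<Longrightarrow> \<bar>t - x j\<bar> \<le> h \<Longrightarrow> x(i := s, j := t) \<in> W"
  shows "\<exists>s t. \<bar>s - x i\<bar> \<le> h \<and> \<bar>t - x j\<bar> \<le> h \<and>
    f (x(i := x i + h, j := x j + h)) - f (x(i := x i + h)) - f (x(j := x j + h)) + f x
      = pd j (pd i f) (x(i := s, j := t)) * h\<^sup>2"
proof -
  define g where "g t = f (x(i := t, j := x j + h)) - f (x(i := t, j := x j))" for t
  have D: "(g has_real_derivative (pd i f (x(i := t, j := x j + h)) - pd i f (x(i := t, j := x j)))) (at t)"
    if t: "x i \<le> t" "t \<le> x i + h" for t
  proof -
    have "((\<lambda>t. f (x(i := t, j := c))) has_real_derivative pd i f (x(i := t, j := c))) (at t)"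
      if c: "\<bar>c - x j\<bar> \<le> h" for c
    proof -
      have "x(i := t, j := c) \<in> W" using t c by (intro W) auto
      from C[OF this] show ?thesis using ij
        by (simp add: pd_def DERIV_deriv_iff_real_differentiable fun_upd_twist)
    qed
    then show ?thesis unfolding g_def using h by (intro derivative_intros) auto
  qed
  from MVT2[of "x i" "x i + h" g, OF _ D] h obtain s where s: "x i < s" "s < x i + h"
    "g (x i + h) - g (x i) = h * (pd i f (x(i := s, j := x j + h)) - pd i f (x(i := s, j := x j)))"
    by auto
  have D2: "((\<lambda>t. pd i f (x(i := s, j := t))) has_real_derivative pd j (pd i f) (x(i := s, j := t))) (at t)"
    if t: "x j \<le> t" "t \<le> x j + h" for t
  proof -
    have "x(i := s, j := t) \<in> W" using t s by (intro W) auto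
    from C2[OF this] show ?thesis using ij
      by (simp add: pd_def[of j] DERIV_deriv_iff_real_differentiable)
  qed
  from MVT2[of "x j" "x j + h" "\<lambda>t. pd i f (x(i := s, j := t))", OF _ D2] h obtain t where t: "x j < t" "t < x j + h"
    "pd i f (x(i := s, j := x j + h)) - pd i f (x(i := s, j := x j)) = h * pd j (pd i f) (x(i := s, j := t))"
    by auto
  have "x(i := x i, j := x j + h) = x(j := x j + h)" "x(i := x i + h, j := x j) = x(i := x i + h)"
     "x(i := x i, j := x j) = x" using ij by (auto simp: fun_eq_iff)
  then have "f (x(i := x i + h, j := x j + h)) - f (x(i := x i + h)) - f (x(j := x j + h)) + f x = g (x i + h) - g (x i)"
    by (simp add: g_def)
  also have "\<dots> = pd j (pd i f) (x(i := s, j := t)) * h\<^sup>2"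
    unfolding s(3) t(3) by (simp add: power2_eq_square)
  finally show ?thesis using s t by (intro exI[of _ s] exI[of _ t]) auto
qed

text \<open>
  If the mixed derivatives differed at \<open>x\<close>, then by continuity their values would differ throughout a
  small cube around \<open>x\<close>, including the points at which both represent the same second difference.
\<close>

lemma pd_commute:
  assumes W: "open_Rn N W" and f: "Ck_on N 2 W f" and x: "x \<in> W" and ij: "i < N" "j < N"
  shows "pd i (pd j f) x = pd j (pd i f) x"
proof (cases "i = j")
  case False
  have xN: "x \<in> Rn N" using W x open_Rn_subset by blast
  have f1: "\<And>x i. x \<in> W \<Longrightarrow> i < N \<Longrightarrow> (\<lambda>t. f (x(i := t))) differentiable at (x i)"
    "\<And>x i j. x \<in> W \<Longrightarrow> i < N \<Longrightarrow> j < N \<Longrightarrow> (\<lambda>t. pd i f (x(j := t))) differentiable at (x j)"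
    "\<And>i j. i < N \<Longrightarrow> j < N \<Longrightarrow> continuous_on W (pd j (pd i f))"
    using f by (auto simp: numeral_2_eq_2)
  let ?a = "pd i (pd j f)" and ?b = "pd j (pd i f)"
  show ?thesis
  proof (rule ccontr)
    assume ne: "?a x \<noteq> ?b x"
    define e where "e = \<bar>?a x - ?b x\<bar> / 2"
    have e: "e > 0" using ne by (simp add: e_def)
    have "\<forall>\<^sub>F y in nbh N x. dist (?a y) (?a x) < e \<and> dist (?b y) (?b x) < e \<and> y \<in> W"
      by (intro eventually_conj tendstoD[OF continuous_on_open_Rn_tendsto[OF W _ x] e] f1(3)
          open_Rn_imp_eventually[OF W x] ij)
    then obtain d where d: "d > 0" "\<And>y. y \<in> Rn N \<Longrightarrow> (\<forall>i<N. \<bar>y i - x i\<bar> < d) \<Longrightarrow>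
        dist (?a y) (?a x) < e \<and> dist (?b y) (?b x) < e \<and> y \<in> W"
      by (rule eventually_nbhE[OF _ xN]) (rule that)
    define h where "h = d / 2"
    have h: "h > 0" "h < d" using d by (auto simp: h_def)
    have box: "dist (?a y) (?a x) < e \<and> dist (?b y) (?b x) < e \<and> y \<in> W"
      if "y = x(i := s, j := t)" "\<bar>s - x i\<bar> \<le> h" "\<bar>t - x j\<bar> \<le> h" for s t y
      using that h d(1) ij xN by (intro d(2)) (auto simp: Rn_def)
    obtain s t where 1: "\<bar>s - x i\<bar> \<le> h" "\<bar>t - x j\<bar> \<le> h"
      "f (x(i := x i + h, j := x j + h)) - f (x(i := x i + h)) - f (x(j := x j + h)) + f x = ?b (x(i := s, j := t)) * h\<^sup>2"
      using second_difference[of W f i j h x, OF f1(1)[OF _ ij(1)] f1(2)[OF _ ij] False h(1)] box by blast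
    obtain s' t' where 2: "\<bar>s' - x j\<bar> \<le> h" "\<bar>t' - x i\<bar> \<le> h"
      "f (x(j := x j + h, i := x i + h)) - f (x(j := x j + h)) - f (x(i := x i + h)) + f x = ?a (x(j := s', i := t')) * h\<^sup>2"
      using second_difference[of W f j i h x, OF f1(1)[OF _ ij(2)] f1(2)[OF _ ij(2,1)] False[symmetric] h(1)]
        box[OF fun_upd_twist] False by blast
    have eqs: "x(j := x j + h, i := x i + h) = x(i := x i + h, j := x j + h)" "x(j := s', i := t') = x(i := t', j := s')"
      using False by (auto simp: fun_upd_twist)
    then have "?b (x(i := s, j := t)) * h\<^sup>2 = ?a (x(i := t', j := s')) * h\<^sup>2"
      using 1(3) 2(3)[unfolded eqs] by linarith
    then have "?b (x(i := s, j := t)) = ?a (x(i := t', j := s'))" using h by simp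
    moreover have "dist (?b (x(i := s, j := t))) (?b x) < e" using box[OF refl 1(1,2)] by simp
    moreover have "dist (?a (x(i := t', j := s'))) (?a x) < e" using box[OF refl 2(2,1)] by simp
    ultimately show False unfolding e_def dist_real_def by argo
  qed
qed simp

lemma eventually_upd:
  assumes "open_Rn N W" "x \<in> W" "i < N"
  shows "\<forall>\<^sub>F t in nhds (x i). x(i := t) \<in> W"
proof -
  have "x \<in> Rn N" using assms open_Rn_subset by blast
  from filterlim_upd_nbh[OF this assms(3)] open_Rn_imp_eventually[OF assms(1,2)]
  show ?thesis by (auto simp: filterlim_iff)
qed

lemma pd_cong_on:
  assumes "open_Rn N W" "x \<in> W" "i < N" "\<And>x. x \<in> W \<Longrightarrow> f x = g x"
  shows "pd i f x = pd i g x"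
  unfolding pd_def
  by (rule deriv_cong_ev[OF eventually_mono[OF eventually_upd[OF assms(1-3)] assms(4)] refl])

lemma Ck_on_cong:
  assumes "open_Rn N W" "\<And>x. x \<in> W \<Longrightarrow> f x = g x" "Ck_on N r W f"
  shows "Ck_on N r W g"
  using assms(2,3)
proof (induction r arbitrary: f g)
  case 0
  then show ?case using continuous_on_cong[of W W f g] by simp
next
  case (Suc r)
  have "(\<lambda>t. g (x(i := t))) differentiable at (x i)" if "x \<in> W" "i < N" for x i
  proof -
    have "(\<lambda>t. f (x(i := t))) differentiable at (x i)" using Suc.prems that by auto
    moreover have "\<forall>\<^sub>F t in nhds (x i). f (x(i := t)) = g (x(i := t))"
      by (rule eventually_mono[OF eventually_upd[OF assms(1) that]]) (rule Suc.prems(1))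
    ultimately show ?thesis
      unfolding real_differentiable_def by (metis DERIV_cong_ev)
  qed
  moreover have "Ck_on N r W (pd i g)" if "i < N" for i
  proof (rule Suc.IH[of "pd i f"])
    show "pd i f x = pd i g x" if "x \<in> W" for x
      using pd_cong_on[OF assms(1) that \<open>i < N\<close> Suc.prems(1)] .
    show "Ck_on N r W (pd i f)" using Suc.prems(2) that by simp
  qed
  moreover have "continuous_on W g" using Suc.prems continuous_on_cong[of W W f g] by simp
  ultimately show ?case by simp
qed

lemma Ck_on_const: "open_Rn N W \<Longrightarrow> Ck_on N r W (\<lambda>_. c)"
proof (induction r arbitrary: c)
  case (Suc r)
  have "pd i (\<lambda>_. c) = (\<lambda>_. 0)" for i by (simp add: pd_def fun_eq_iff)
  then show ?case using Suc by simp
qed simp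

lemma Ck_on_lincomb:
  assumes W: "open_Rn N W"
  shows "Ck_on N r W f \<Longrightarrow> Ck_on N r W g \<Longrightarrow> Ck_on N r W (\<lambda>x. f x + g x * c)"
proof (induction r arbitrary: f g)
  case 0 then show ?case by (auto intro!: continuous_intros)
next
  case (Suc r)
  have D: "((\<lambda>t. f (x(i := t))) has_real_derivative pd i f x) (at (x i))"
    "((\<lambda>t. g (x(i := t))) has_real_derivative pd i g x) (at (x i))"
    if "x \<in> W" "i < N" for x i
    using Suc.prems that by (auto simp: pd_def DERIV_deriv_iff_real_differentiable)
  have pd_eq: "pd i (\<lambda>x. f x + g x * c) x = pd i f x + pd i g x * c" if "x \<in> W" "i < N" for x i
    unfolding pd_def[of i "\<lambda>x. f x + g x * c"]
    by (intro DERIV_imp_deriv DERIV_add DERIV_cmult_right D that)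
  have "Ck_on N r W (pd i (\<lambda>x. f x + g x * c))" if "i < N" for i
  proof (rule Ck_on_cong[OF W, of "\<lambda>x. pd i f x + pd i g x * c"])
    show "Ck_on N r W (\<lambda>x. pd i f x + pd i g x * c)"
      by (rule Suc.IH) (use Suc.prems that in simp_all)
  qed (use that pd_eq in simp)
  moreover have "(\<lambda>t. f (x(i := t)) + g (x(i := t)) * c) differentiable at (x i)" if "x \<in> W" "i < N" for x i
    unfolding real_differentiable_def using DERIV_add[OF D(1) DERIV_cmult_right[OF D(2)], OF that that] by blast
  moreover have "continuous_on W (\<lambda>x. f x + g x * c)"
    using Suc.prems by (intro continuous_intros) auto
  ultimately show ?case by simp
qed

lemma Ck_on_sum:
  assumes "open_Rn N W" "\<And>a. a \<in> A \<Longrightarrow> Ck_on N r W (f a)"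
  shows "Ck_on N r W (\<lambda>x. \<Sum>a\<in>A. f a x * u a)"
  using assms(2)
proof (induction A rule: infinite_finite_induct)
  case (insert a A)
  have "Ck_on N r W (\<lambda>x. (\<Sum>a\<in>A. f a x * u a) + f a x * u a)"
    by (rule Ck_on_lincomb[OF assms(1)]) (use insert in auto)
  then show ?case using insert by (simp add: add.commute)
qed (use assms(1) Ck_on_const in auto)

text \<open>
  Smoothness of the curves that realise tangent vectors: composing with a line turns a partial
  derivative into a linear combination of the partial derivatives of \<open>f\<close>, so the order of
  differentiability is preserved by induction.
\<close>

lemma Ck_on_line:
  assumes V: "open_Rn N V" and x: "x \<in> Rn N" and u: "u \<in> Rn N"
    and V': "open_Rn 1 V'" "\<And>z. z \<in> V' \<Longrightarrow> (\<lambda>i. x i + z 0 * u i) \<in> V"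
  shows "Ck_on N r V f \<Longrightarrow> Ck_on 1 r V' (\<lambda>z. f (\<lambda>i. x i + z 0 * u i))"
proof (induction r arbitrary: f)
  case 0
  have "continuous_on V' (\<lambda>z. (\<lambda>i. x i + z 0 * u i))"
    by (intro continuous_on_coordinatewise_then_product continuous_intros
       continuous_on_subset[OF continuous_on_product_coordinates]) auto
  moreover have "continuous_on V f" using 0 by simp
  moreover have "(\<lambda>z i. x i + z 0 * u i) ` V' \<subseteq> V" by (rule image_subsetI) (rule V'(2))
  ultimately show ?case
    using continuous_on_compose2[of V f V' "\<lambda>z i. x i + z 0 * u i"] by simp
next
  case (Suc r)
  define l where "l z = (\<lambda>i. x i + z 0 * u i)" for z :: "nat \<Rightarrow> real"
  have "has_pds 1 (\<lambda>z. f (l z)) z (\<lambda>_. \<Sum>i<N. pd i f (l z) * u i)" if z: "z \<in> V'" for z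
  proof -
    have zN: "z \<in> Rn 1" using z V'(1) open_Rn_subset by blast
    have "has_pds 1 (\<lambda>z. l z j) z (\<lambda>i. u j)" for j
    proof -
      have "has_pds 1 (\<lambda>z. x j + z 0 * u j) z (\<lambda>i. 0 + ((if i = 0 then 1 else 0) * u j + z 0 * 0))"
        by (intro has_pds_add has_pds_mult has_pds_const has_pds_coord) auto
      then show ?thesis unfolding l_def by (rule has_pds_cong_D) auto
    qed
    moreover have "l z \<in> Rn N" for z using x u by (auto simp: Rn_def l_def)
    moreover have "has_pds N f (l z) (\<lambda>i. pd i f (l z))"
      using Ck_on_imp_tdiff[OF V Suc.prems, of "l z"] V'(2)[OF z] by (simp add: tdiff_def l_def)
    ultimately show ?thesis using zN
      by (intro has_pds_compose[of N 1 l z "\<lambda>j _. u j" f "\<lambda>i. pd i f (l z)"]) auto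
  qed
  note pds = this
  have V'R: "V' \<subseteq> Rn 1" using V'(1) open_Rn_subset by blast
  have eq: "(\<Sum>i<N. pd i f (l z) * u i) = pd 0 (\<lambda>z. f (l z)) z" if "z \<in> V'" for z
    using has_pds_pd[OF pds[OF that]] that V'R by auto
  moreover have "Ck_on 1 r V' (\<lambda>z. \<Sum>i<N. pd i f (l z) * u i)"
    using Suc by (intro Ck_on_sum V'(1)) (auto simp: l_def)
  ultimately have "Ck_on 1 r V' (pd 0 (\<lambda>z. f (l z)))"
    using Ck_on_cong[of 1 V' "\<lambda>z. \<Sum>i<N. pd i f (l z) * u i" "pd 0 (\<lambda>z. f (l z))" r] V'(1) by blast
  moreover have "(\<lambda>t. f (l (z(0 := t)))) differentiable at (z 0)" if "z \<in> V'" for z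
    using has_pds_imp_DERIV[OF pds[OF that]] that V'R unfolding real_differentiable_def by auto
  moreover have "continuous_on V' (\<lambda>z. f (l z))"
    by (rule continuous_onI_nbh[OF V'R]) (rule has_pds_tendsto[OF pds])
  ultimately show ?case by (simp add: l_def)
qed

section \<open>Coefficients with respect to a moving frame\<close>

text \<open>
  At a zero of the first factor the product rule asks only for continuity of the second one.
\<close>

lemma has_pds_mult_zero:
  assumes "has_pds N f x D" "f x = 0" "(g \<longlongrightarrow> g x) (nbh N x)"
  shows "has_pds N (\<lambda>y. f y * g y) x (\<lambda>i. D i * g x)"
proof -
  obtain \<phi> where \<phi>: "\<And>i. i < N \<Longrightarrow> (\<phi> i \<longlongrightarrow> D i) (nbh N x)"
    "\<forall>\<^sub>F y in nbh N x. f y = f x + (\<Sum>i<N. \<phi> i y * (y i - x i))"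
    by (rule has_pdsE[OF assms(1)]) (rule that)
  have "\<forall>\<^sub>F y in nbh N x. f y * g y = f x * g x + (\<Sum>i<N. (\<phi> i y * g y) * (y i - x i))"
    using \<phi>(2) by eventually_elim (simp add: assms(2) sum_distrib_left sum_distrib_right mult_ac)
  then show ?thesis unfolding has_pds_def
    by (intro exI[of _ "\<lambda>i y. \<phi> i y * g y"]) (auto intro!: tendsto_intros \<phi>(1) assms(3))
qed

text \<open>
  Coefficients with respect to a differentiable moving frame are differentiable.  Pairing with
  functionals \<open>D a\<close> dual to the frame at \<open>x0\<close> turns the equation for the coefficients into
  \<open>c = y + E c\<close> with \<open>y\<close> and \<open>E\<close> differentiable and \<open>E x0 = 0\<close>.  This bounds \<open>c\<close> near \<open>x0\<close>,
  hence makes it continuous there, and a product of \<open>E\<close> with something continuous is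
  differentiable at a zero of \<open>E\<close>.
\<close>

lemma tdiff_frame_coeffs:
  fixes c :: "'a \<Rightarrow> (nat \<Rightarrow> real) \<Rightarrow> real"
  assumes A: "finite A" and x0: "x0 \<in> Rn N"
    and f: "\<And>a i. a \<in> A \<Longrightarrow> i < M \<Longrightarrow> tdiff N (\<lambda>x. f a x i) x0"
    and w: "\<And>i. i < M \<Longrightarrow> tdiff N (\<lambda>x. w x i) x0"
    and eq: "\<forall>\<^sub>F x in nbh N x0. \<forall>i<M. w x i = (\<Sum>a\<in>A. c a x * f a x i)"
    and D: "\<And>a b. a \<in> A \<Longrightarrow> b \<in> A \<Longrightarrow> (\<Sum>i<M. D a i * f b x0 i) = (if a = b then 1 else 0)"
    and a: "a \<in> A"
  shows "tdiff N (c a) x0"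
proof -
  define y where "y a x = (\<Sum>i<M. D a i * w x i)" for a x
  define E where "E a b x = (if a = b then 1 else 0) + (\<Sum>i<M. - D a i * f b x i)" for a b x
  have y: "tdiff N (y a) x0" if "a \<in> A" for a
    unfolding y_def using w x0 by (intro tdiff_sum tdiff_mult tdiff_const) auto
  have E: "tdiff N (E a b) x0" "E a b x0 = 0" if "a \<in> A" "b \<in> A" for a b
  proof -
    have "tdiff N (\<lambda>x. \<Sum>i<M. - D a i * f b x i) x0"
      using f x0 that by (intro tdiff_sum tdiff_mult tdiff_const) auto
    from has_pds_tdiff[OF has_pds_add[OF has_pds_const this[unfolded tdiff_def]] x0]
    show "tdiff N (E a b) x0" by (simp add: E_def[abs_def])
    show "E a b x0 = 0" using D[OF that] by (simp add: E_def sum_negf)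
  qed
  have c_eq: "\<forall>\<^sub>F x in nbh N x0. \<forall>a\<in>A. c a x = y a x + (\<Sum>b\<in>A. E a b x * c b x)"
    using eq
  proof eventually_elim
    case (elim x)
    show ?case
    proof
      fix a assume a: "a \<in> A"
      have "y a x = (\<Sum>i<M. D a i * (\<Sum>b\<in>A. c b x * f b x i))" unfolding y_def using elim by auto
      also have "\<dots> = (\<Sum>b\<in>A. (\<Sum>i<M. D a i * f b x i) * c b x)"
        unfolding sum_distrib_left sum_distrib_right by (subst sum.swap) (simp add: mult_ac)
      finally have "y a x = (\<Sum>b\<in>A. (\<Sum>i<M. D a i * f b x i) * c b x)" .
      moreover have "(\<Sum>b\<in>A. E a b x * c b x) = (\<Sum>b\<in>A. (if a = b then 1 else 0) * c b x) - (\<Sum>b\<in>A. (\<Sum>i<M. D a i * f b x i) * c b x)"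
        by (simp add: E_def left_diff_distrib sum_subtractf sum_negf)
      moreover have "(\<Sum>b\<in>A. (if a = b then 1 else 0) * c b x) = c a x"
        using A a by (simp add: if_distrib[of "\<lambda>a. a * _"] cong: if_cong)
      ultimately show "c a x = y a x + (\<Sum>b\<in>A. E a b x * c b x)" by simp
    qed
  qed
  \<comment> \<open>The sum of the moduli of the coefficients is controlled by that of \<open>y\<close> once the moduli of the
    entries of \<open>E\<close> sum to less than \<open>1/2\<close>.\<close>
  define S where "S x = (\<Sum>a\<in>A. \<bar>c a x\<bar>)" for x
  define Y where "Y x = (\<Sum>a\<in>A. \<bar>y a x\<bar>)" for x
  define e where "e x = (\<Sum>a\<in>A. \<Sum>b\<in>A. \<bar>E a b x\<bar>)" for x
  have e0: "(e \<longlongrightarrow> 0) (nbh N x0)"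
  proof -
    have "(e \<longlongrightarrow> (\<Sum>a\<in>A. \<Sum>b\<in>A. \<bar>E a b x0\<bar>)) (nbh N x0)"
      unfolding e_def[abs_def] by (intro tendsto_intros tdiff_tendsto E)
    then show ?thesis using E(2) by simp
  qed
  have Y0: "(Y \<longlongrightarrow> Y x0) (nbh N x0)" unfolding Y_def[abs_def] by (intro tendsto_intros tdiff_tendsto y)
  have Sn: "S x \<ge> 0" "\<And>b. b \<in> A \<Longrightarrow> \<bar>c b x\<bar> \<le> S x" for x
    unfolding S_def by (auto intro: sum_nonneg member_le_sum A)
  have bound: "\<forall>\<^sub>F x in nbh N x0. \<forall>a\<in>A. \<bar>c a x - y a x\<bar> \<le> (\<Sum>b\<in>A. \<bar>E a b x\<bar>) * S x"
    using c_eq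
  proof eventually_elim
    case (elim x)
    show ?case
    proof
      fix a assume "a \<in> A"
      then have "\<bar>c a x - y a x\<bar> = \<bar>\<Sum>b\<in>A. E a b x * c b x\<bar>" using elim by auto
      also have "\<dots> \<le> (\<Sum>b\<in>A. \<bar>E a b x * c b x\<bar>)" by (rule sum_abs)
      also have "\<dots> \<le> (\<Sum>b\<in>A. \<bar>E a b x\<bar> * S x)" using Sn by (intro sum_mono) (auto simp: abs_mult intro: mult_left_mono)
      finally show "\<bar>c a x - y a x\<bar> \<le> (\<Sum>b\<in>A. \<bar>E a b x\<bar>) * S x" by (simp add: sum_distrib_right)
    qed
  qed
  have "\<forall>\<^sub>F x in nbh N x0. e x < 1/2" using order_tendstoD(2)[OF e0, of "1/2"] by simp
  then have S2: "\<forall>\<^sub>F x in nbh N x0. S x \<le> 2 * Y x"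
    using bound
  proof eventually_elim
    case (elim x)
    have "S x \<le> (\<Sum>a\<in>A. \<bar>y a x\<bar> + (\<Sum>b\<in>A. \<bar>E a b x\<bar>) * S x)"
      unfolding S_def[of x, symmetric]
      by (subst S_def, intro sum_mono) (use elim(2) in fastforce)
    also have "\<dots> = Y x + e x * S x" by (simp add: Y_def e_def sum.distrib sum_distrib_right)
    also have "\<dots> \<le> Y x + 1/2 * S x" using elim(1) Sn(1) by (intro add_left_mono mult_right_mono) auto
    finally show ?case by simp
  qed
  have cont: "(c a \<longlongrightarrow> c a x0) (nbh N x0)" if a: "a \<in> A" for a
  proof -
    have "c a x0 = y a x0" using eventually_nbh_self[OF x0 c_eq] E(2) a by simp
    have "((\<lambda>x. c a x - y a x) \<longlongrightarrow> 0) (nbh N x0)"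
    proof (rule Lim_null_comparison)
      show "((\<lambda>x. e x * (2 * Y x)) \<longlongrightarrow> 0) (nbh N x0)"
        using tendsto_mult[OF e0 tendsto_mult[OF tendsto_const[of 2] Y0]] by simp
      show "\<forall>\<^sub>F x in nbh N x0. norm (c a x - y a x) \<le> e x * (2 * Y x)"
        using bound S2
      proof eventually_elim
        case (elim x)
        have "(\<Sum>b\<in>A. \<bar>E a b x\<bar>) \<le> e x" unfolding e_def
          by (rule member_le_sum[where f = "\<lambda>a. \<Sum>b\<in>A. \<bar>E a b x\<bar>"]) (auto intro: sum_nonneg a A)
        then have "(\<Sum>b\<in>A. \<bar>E a b x\<bar>) * S x \<le> e x * (2 * Y x)"
          using elim(2) Sn(1) by (intro mult_mono) (auto simp: e_def intro!: sum_nonneg)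
        then show ?case using elim(1) a by fastforce
      qed
    qed
    from tendsto_add[OF this tdiff_tendsto[OF y[OF a]]] show ?thesis
      using \<open>c a x0 = y a x0\<close> by simp
  qed
  have "has_pds N (\<lambda>x. y a x + (\<Sum>b\<in>A. E a b x * c b x)) x0
      (\<lambda>i. pd i (y a) x0 + (\<Sum>b\<in>A. pd i (E a b) x0 * c b x0))"
    using y E cont a unfolding tdiff_def by (intro has_pds_add has_pds_sum has_pds_mult_zero) auto
  from has_pds_tdiff[OF this x0] show ?thesis
    by (rule tdiff_cong[OF _ _ x0]) (use c_eq a in \<open>auto elim!: eventually_mono\<close>)
qed

section \<open>Naturality of the exterior derivative of a one-form in coordinates\<close>

lemma dir_deriv_sum_mult:
  assumes "\<And>j. j \<in> J \<Longrightarrow> tdiff N (f j) x" "\<And>j. j \<in> J \<Longrightarrow> tdiff N (g j) x" "x \<in> Rn N"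
  shows "dir_deriv N (\<lambda>y. \<Sum>j\<in>J. f j y * g j y) x u =
    (\<Sum>j\<in>J. dir_deriv N (f j) x u * g j x + f j x * dir_deriv N (g j) x u)"
proof -
  have "has_pds N (\<lambda>y. \<Sum>j\<in>J. f j y * g j y) x (\<lambda>i. \<Sum>j\<in>J. pd i (f j) x * g j x + f j x * pd i (g j) x)"
    using assms unfolding tdiff_def by (intro has_pds_sum has_pds_mult) auto
  from has_pds_dir_deriv[OF this assms(3)]
  have "dir_deriv N (\<lambda>y. \<Sum>j\<in>J. f j y * g j y) x u = (\<Sum>i<N. \<Sum>j\<in>J. (pd i (f j) x * g j x + f j x * pd i (g j) x) * u i)"
    by (simp add: sum_distrib_right)
  also have "\<dots> = (\<Sum>j\<in>J. \<Sum>i<N. (pd i (f j) x * g j x + f j x * pd i (g j) x) * u i)" by (rule sum.swap)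
  finally show ?thesis
    by (simp add: dir_deriv_def sum_distrib_left sum_distrib_right sum.distrib algebra_simps)
qed

lemma tdiff_dir_deriv:
  assumes "open_Rn N V" "x \<in> V" "Ck_on N 2 V f"
  shows "tdiff N (\<lambda>y. dir_deriv N f y w) x"
proof -
  have "x \<in> Rn N" using assms open_Rn_subset by blast
  moreover have "tdiff N (pd i f) x" if "i < N" for i
    using assms that by (intro Ck_on_imp_tdiff[of N V 0]) (auto simp: numeral_2_eq_2)
  ultimately show ?thesis unfolding dir_deriv_def by (intro tdiff_sum tdiff_mult tdiff_const) auto
qed

lemma dir_deriv_commute:
  assumes "open_Rn N V" "x \<in> V" "Ck_on N 2 V f"
  shows "dir_deriv N (\<lambda>y. dir_deriv N f y w) x u = dir_deriv N (\<lambda>y. dir_deriv N f y u) x w"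
proof -
  have x: "x \<in> Rn N" using assms open_Rn_subset by blast
  have t: "tdiff N (pd i f) x" if "i < N" for i
    using assms that by (intro Ck_on_imp_tdiff[of N V 0]) (auto simp: numeral_2_eq_2)
  have pd0: "pd i (\<lambda>_. c) x = 0" for c i by (simp add: pd_def)
  have "dir_deriv N (\<lambda>y. dir_deriv N f y w) x u = (\<Sum>i<N. \<Sum>k<N. pd k (pd i f) x * u k * w i)" for u w
    unfolding dir_deriv_def[of N f]
    by (subst dir_deriv_sum_mult) (auto simp: t x tdiff_const pd0 dir_deriv_def sum_distrib_right)
  then show ?thesis
    by (simp add: pd_commute[OF assms(1,3,2)] mult_ac) (subst sum.swap, auto simp: pd_commute[OF assms(1,3,2)] mult_ac)
qed

text \<open>
  \<open>d(F\<^sup>* \<beta>) = F\<^sup>*(d\<beta>)\<close> for a one-form \<open>\<beta> = \<Sum>\<^sub>j \<beta>\<^sub>j dz\<^sub>j\<close>, evaluated on two vectors: by the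
  chain rule the two sides differ by the terms with second derivatives of \<open>F\<close>, and these cancel by
  symmetry.
\<close>

lemma one_form_pullback_deriv:
  assumes V: "open_Rn N V" "x \<in> V"
    and F: "\<And>j. j < M \<Longrightarrow> Ck_on N 2 V (\<lambda>y. F y j)" "\<And>y. y \<in> V \<Longrightarrow> F y \<in> Rn M"
    and \<beta>: "\<And>j. j < M \<Longrightarrow> tdiff M (\<beta> j) (F x)"
    and LU: "\<And>j. j < M \<Longrightarrow> LU j = dir_deriv N (\<lambda>y. F y j) x u"
    and LW: "\<And>j. j < M \<Longrightarrow> LW j = dir_deriv N (\<lambda>y. F y j) x w"
  shows "dir_deriv N (\<lambda>y. \<Sum>j<M. \<beta> j (F y) * dir_deriv N (\<lambda>y. F y j) y w) x u
       - dir_deriv N (\<lambda>y. \<Sum>j<M. \<beta> j (F y) * dir_deriv N (\<lambda>y. F y j) y u) x w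
       = dir_deriv M (\<lambda>z. \<Sum>j<M. \<beta> j z * LW j) (F x) LU - dir_deriv M (\<lambda>z. \<Sum>j<M. \<beta> j z * LU j) (F x) LW"
proof -
  have x: "x \<in> Rn N" using V open_Rn_subset by blast
  have Ft: "tdiff N (\<lambda>y. F y j) x" if "j < M" for j
    using V F(1)[OF that] by (intro Ck_on_imp_tdiff[of N V 1]) (auto simp: numeral_2_eq_2)
  have FR: "\<forall>\<^sub>F y in nbh N x. F y \<in> Rn M"
    using open_Rn_imp_eventually[OF V] F(2) by (auto elim: eventually_mono)
  have Fx: "F x \<in> Rn M" using F(2) V by auto
  have \<beta>F: "tdiff N (\<lambda>y. \<beta> j (F y)) x" if "j < M" for j
    by (rule tdiff_compose[of M N F x, OF Ft FR x \<beta>[OF that]])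
  have \<beta>F': "dir_deriv N (\<lambda>y. \<beta> j (F y)) x u = dir_deriv M (\<beta> j) (F x) (\<lambda>j. dir_deriv N (\<lambda>y. F y j) x u)" if "j < M" for j u
    by (rule dir_deriv_compose[of M N F x, OF Ft FR x \<beta>[OF that]])
  have c: "dir_deriv M (\<beta> j) (F x) (\<lambda>j. dir_deriv N (\<lambda>y. F y j) x u) = dir_deriv M (\<beta> j) (F x) LU"
    "dir_deriv M (\<beta> j) (F x) (\<lambda>j. dir_deriv N (\<lambda>y. F y j) x w) = dir_deriv M (\<beta> j) (F x) LW" for j
    unfolding dir_deriv_def[of M] using LU LW by auto
  have d0: "dir_deriv M (\<lambda>_. c) (F x) u = 0" for c u
    using has_pds_dir_deriv[OF has_pds_const Fx] by simp
  have lhs: "dir_deriv N (\<lambda>y. \<Sum>j<M. \<beta> j (F y) * dir_deriv N (\<lambda>y. F y j) y w) x u =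
    (\<Sum>j<M. dir_deriv M (\<beta> j) (F x) (\<lambda>j. dir_deriv N (\<lambda>y. F y j) x u) * dir_deriv N (\<lambda>y. F y j) x w
       + \<beta> j (F x) * dir_deriv N (\<lambda>y. dir_deriv N (\<lambda>y. F y j) y w) x u)" for u w
    by (subst dir_deriv_sum_mult[OF \<beta>F tdiff_dir_deriv[OF V F(1)] x]) (simp_all add: \<beta>F')
  have rhs: "dir_deriv M (\<lambda>z. \<Sum>j<M. \<beta> j z * LW j) (F x) LU = (\<Sum>j<M. dir_deriv M (\<beta> j) (F x) LU * LW j)" for LU LW
    by (subst dir_deriv_sum_mult[OF \<beta> tdiff_const[OF Fx] Fx]) (simp_all add: d0)
  have "dir_deriv N (\<lambda>y. dir_deriv N (\<lambda>y. F y j) y w) x u = dir_deriv N (\<lambda>y. dir_deriv N (\<lambda>y. F y j) y u) x w" if "j < M" for j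
    by (rule dir_deriv_commute[OF V F(1)[OF that]])
  then have "(\<Sum>j<M. \<beta> j (F x) * dir_deriv N (\<lambda>y. dir_deriv N (\<lambda>y. F y j) y w) x u)
      = (\<Sum>j<M. \<beta> j (F x) * dir_deriv N (\<lambda>y. dir_deriv N (\<lambda>y. F y j) y u) x w)"
    by (intro sum.cong) auto
  moreover have "(\<Sum>j<M. dir_deriv M (\<beta> j) (F x) LU * dir_deriv N (\<lambda>y. F y j) x w) =
      (\<Sum>j<M. dir_deriv M (\<beta> j) (F x) LU * LW j)"
    "(\<Sum>j<M. dir_deriv M (\<beta> j) (F x) LW * dir_deriv N (\<lambda>y. F y j) x u) =
      (\<Sum>j<M. dir_deriv M (\<beta> j) (F x) LW * LU j)"
    using LU LW by auto
  ultimately show ?thesis unfolding lhs rhs c by (simp add: sum.distrib)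
qed

section \<open>Pfaffian sums and wedge powers\<close>

text \<open>
  For an antisymmetric matrix \<open>A\<close> this is the Pfaffian up to the factor \<open>2\<^sup>m m!\<close>.
\<close>

definition pf :: "nat \<Rightarrow> (nat \<Rightarrow> nat \<Rightarrow> real) \<Rightarrow> real" where
  "pf m A = (\<Sum>\<pi> | \<pi> permutes {..<2 * m}. of_int (sign \<pi>) * (\<Prod>i<m. A (\<pi> (2 * i)) (\<pi> (2 * i + 1))))"

lemma pf_0: "pf 0 A = 1"
  by (simp add: pf_def)

lemma pf_cong:
  assumes "\<And>i j. i < 2 * m \<Longrightarrow> j < 2 * m \<Longrightarrow> A i j = B i j"
  shows "pf m A = pf m B"
  unfolding pf_def
proof (intro sum.cong refl arg_cong2[where f = "(*)"] prod.cong)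
  fix \<pi> i assume "\<pi> \<in> {\<pi>. \<pi> permutes {..<2 * m}}" "i \<in> {..<m}"
  then have "\<pi> (2 * i) \<in> {..<2*m}" "\<pi> (2 * i + 1) \<in> {..<2*m}" by (auto simp: permutes_in_image simp del: lessThan_iff)
  then show "A (\<pi> (2 * i)) (\<pi> (2 * i + 1)) = B (\<pi> (2 * i)) (\<pi> (2 * i + 1))" using assms by auto
qed

text \<open>
  The inner sum runs over permutations of the last \<open>2 m\<close> indices.  Such a permutation can be
  absorbed into \<open>\<pi>\<close>, so each of the \<open>(2 m)!\<close> of them contributes the same full sum.
\<close>

lemma sum_first_pair_pf:
  "(\<Sum>\<pi> | \<pi> permutes {..<2 + 2 * m}. of_int (sign \<pi>) * A (\<pi> 0) (\<pi> 1) * pf m (\<lambda>i j. A (\<pi> (i + 2)) (\<pi> (j + 2))))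
     = fact (2 * m) * pf (Suc m) A"
proof -
  define g where "g \<pi> = of_int (sign \<pi>) * (\<Prod>i<Suc m. A (\<pi> (2 * i)) (\<pi> (2 * i + 1)))" for \<pi>
  let ?P = "{\<pi>. \<pi> permutes {..<2 + 2 * m}}"
  have step: "(\<Sum>\<pi>\<in>?P. of_int (sign \<pi>) * A (\<pi> 0) (\<pi> 1) * (of_int (sign \<rho>) * (\<Prod>i<m. A (\<pi> (\<rho> (2 * i) + 2)) (\<pi> (\<rho> (2 * i + 1) + 2)))))
    = (\<Sum>\<pi>\<in>?P. g \<pi>)" if \<rho>: "\<rho> permutes {..<2 * m}" for \<rho>
  proof -
    \<comment> \<open>\<open>\<rho>\<close> moved up by two places, leaving the first pair fixed.\<close>
    define \<rho>' where "\<rho>' = map_permutation {..<2 * m} (\<lambda>i. i + 2) \<rho>"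
    have bij: "bij_betw (\<lambda>i. i + 2) {..<2 * m} {2..<2 + 2 * m}"
      by (rule bij_betwI[of _ _ _ "\<lambda>i. i - 2"]) auto
    have \<rho>': "\<rho>' permutes {2..<2 + 2 * m}"
      unfolding \<rho>'_def by (rule map_permutation_permutes[OF bij \<rho>])
    then have \<rho>'P: "\<rho>' permutes {..<2 + 2 * m}" by (rule permutes_subset) auto
    have sgn: "sign \<rho>' = sign \<rho>"
      unfolding \<rho>'_def by (rule sign_map_permutation[OF _ \<rho>]) (auto simp: inj_on_def)
    have v: "\<rho>' (i + 2) = \<rho> i + 2" if "i < 2 * m" for i
      unfolding \<rho>'_def using map_permutation_apply[of "\<lambda>i. i + 2" "{..<2 * m}" i \<rho>] that by (auto simp: inj_on_def)
    have v0: "\<rho>' 0 = 0" "\<rho>' 1 = 1" using permutes_not_in[OF \<rho>'] by auto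
    have "g (\<pi> \<circ> \<rho>') = of_int (sign \<pi>) * A (\<pi> 0) (\<pi> 1) * (of_int (sign \<rho>) * (\<Prod>i<m. A (\<pi> (\<rho> (2 * i) + 2)) (\<pi> (\<rho> (2 * i + 1) + 2))))"
      if \<pi>: "\<pi> \<in> ?P" for \<pi>
    proof -
      have s: "sign (\<pi> \<circ> \<rho>') = sign \<pi> * sign \<rho>"
        unfolding sgn[symmetric] using \<pi> \<rho>'P by (intro sign_compose) (auto intro: permutes_imp_permutation[of "{..<2 + 2 * m}"])
      have "(\<Prod>i<Suc m. A ((\<pi> \<circ> \<rho>') (2 * i)) ((\<pi> \<circ> \<rho>') (2 * i + 1)))
        = A (\<pi> 0) (\<pi> 1) * (\<Prod>i<m. A ((\<pi> \<circ> \<rho>') (2 * i + 2)) ((\<pi> \<circ> \<rho>') (2 * i + 1 + 2)))"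
        unfolding prod.lessThan_Suc_shift using v0 by simp
      also have "(\<Prod>i<m. A ((\<pi> \<circ> \<rho>') (2 * i + 2)) ((\<pi> \<circ> \<rho>') (2 * i + 1 + 2))) =
         (\<Prod>i<m. A (\<pi> (\<rho> (2 * i) + 2)) (\<pi> (\<rho> (2 * i + 1) + 2)))"
      proof (intro prod.cong refl)
        fix i assume "i \<in> {..<m}"
        then show "A ((\<pi> \<circ> \<rho>') (2 * i + 2)) ((\<pi> \<circ> \<rho>') (2 * i + 1 + 2)) = A (\<pi> (\<rho> (2 * i) + 2)) (\<pi> (\<rho> (2 * i + 1) + 2))"
          using v[of "2 * i"] v[of "2 * i + 1"] by simp
      qed
      finally show ?thesis unfolding g_def s by simp
    qed
    then show ?thesis
      using sum_permutations_compose_right[OF \<rho>'P, of g] by simp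
  qed
  have "(\<Sum>\<pi>\<in>?P. of_int (sign \<pi>) * A (\<pi> 0) (\<pi> 1) * pf m (\<lambda>i j. A (\<pi> (i + 2)) (\<pi> (j + 2))))
    = (\<Sum>\<rho> | \<rho> permutes {..<2 * m}. \<Sum>\<pi>\<in>?P. of_int (sign \<pi>) * A (\<pi> 0) (\<pi> 1) * (of_int (sign \<rho>) * (\<Prod>i<m. A (\<pi> (\<rho> (2 * i) + 2)) (\<pi> (\<rho> (2 * i + 1) + 2)))))"
    unfolding pf_def sum_distrib_left by (rule sum.swap)
  also have "\<dots> = (\<Sum>\<rho> | \<rho> permutes {..<2 * m}. \<Sum>\<pi>\<in>?P. g \<pi>)"
    by (intro sum.cong refl step) auto
  also have "\<dots> = fact (2 * m) * pf (Suc m) A"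
    using card_permutations[of "{..<2 * m}" "2 * m"] by (simp add: pf_def g_def)
  finally show ?thesis .
qed

text \<open>
  The coefficient comes from the normalisation of the wedge product: every further factor divides
  by \<open>2! (2 m)!\<close>, of which \<open>(2 m)!\<close> is the number of equal terms in \<open>sum_first_pair_pf\<close>.
\<close>

lemma wedge_power_eq_pf:
  "length vs = 2 * m \<Longrightarrow> wedge_power \<omega> m x vs = pf m (\<lambda>i j. \<omega> x [vs ! i, vs ! j]) / 2 ^ m"
proof (induction m arbitrary: vs)
  case 0 then show ?case by (simp add: pf_0)
next
  case (Suc m)
  let ?A = "\<lambda>i j. \<omega> x [vs ! i, vs ! j]"
  have t: "of_int (sign \<pi>) * \<omega> x (take 2 (permute_list \<pi> vs)) * wedge_power \<omega> m x (drop 2 (permute_list \<pi> vs))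
    = (of_int (sign \<pi>) * ?A (\<pi> 0) (\<pi> 1) * pf m (\<lambda>i j. ?A (\<pi> (i + 2)) (\<pi> (j + 2)))) / 2 ^ m" for \<pi>
  proof -
    have l: "length (permute_list \<pi> vs) = 2 + 2 * m" using Suc.prems by simp
    have nth: "permute_list \<pi> vs ! i = vs ! \<pi> i" if "i < 2 + 2 * m" for i
      using that Suc.prems by (simp add: permute_list_def del: upt_Suc)
    have "take 2 (permute_list \<pi> vs) = [vs ! \<pi> 0, vs ! \<pi> 1]"
    proof (rule nth_equalityI)
      show "length (take 2 (permute_list \<pi> vs)) = length [vs ! \<pi> 0, vs ! \<pi> 1]" using l by simp
      fix i assume "i < length (take 2 (permute_list \<pi> vs))"
      then have i: "i < 2" by simp
      then have "i = 0 \<or> i = 1" by auto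
      then show "take 2 (permute_list \<pi> vs) ! i = [vs ! \<pi> 0, vs ! \<pi> 1] ! i"
        using nth[of i] i by auto
    qed
    moreover have "wedge_power \<omega> m x (drop 2 (permute_list \<pi> vs)) = pf m (\<lambda>i j. ?A (\<pi> (i + 2)) (\<pi> (j + 2))) / 2 ^ m"
      using l nth by (subst Suc.IH) (auto intro!: pf_cong simp: add.commute)
    ultimately show ?thesis by simp
  qed
  have "wedge_power \<omega> (Suc m) x vs = (fact (2 * m) * pf (Suc m) ?A) / 2 ^ m / (fact 2 * fact (2 * m))"
    unfolding wedge_power.simps wedge_def t sum_divide_distrib[symmetric] sum_first_pair_pf[of ?A m] ..
  then show ?case by simp
qed

text \<open>
  The invariance says that \<open>i\<close> and \<open>j\<close> index the same vector; composing with their transposition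
  pairs the terms of the sum with opposite signs.
\<close>

lemma pf_repeated_index:
  assumes "i < 2 * m" "j < 2 * m" "i \<noteq> j"
    and inv: "\<And>r s. r < 2 * m \<Longrightarrow> s < 2 * m \<Longrightarrow> A (Transposition.transpose i j r) (Transposition.transpose i j s) = A r s"
  shows "pf m A = 0"
proof -
  let ?\<tau> = "Transposition.transpose i j"
  have \<tau>: "?\<tau> permutes {..<2 * m}" using assms by (intro permutes_swap_id) auto
  define g where "g \<pi> = of_int (sign \<pi>) * (\<Prod>i<m. A (\<pi> (2 * i)) (\<pi> (2 * i + 1)))" for \<pi>
  have "g (?\<tau> \<circ> \<pi>) = - g \<pi>" if \<pi>: "\<pi> permutes {..<2 * m}" for \<pi>
  proof -
    have "sign (?\<tau> \<circ> \<pi>) = - sign \<pi>"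
      using permutes_imp_permutation[OF _ \<tau>] permutes_imp_permutation[OF _ \<pi>] assms(3)
      by (simp add: sign_compose sign_swap_id)
    moreover have "(\<Prod>i<m. A ((?\<tau> \<circ> \<pi>) (2 * i)) ((?\<tau> \<circ> \<pi>) (2 * i + 1))) = (\<Prod>i<m. A (\<pi> (2 * i)) (\<pi> (2 * i + 1)))"
    proof (intro prod.cong refl)
      fix i assume "i \<in> {..<m}"
      then have "\<pi> (2 * i) < 2 * m" "\<pi> (2 * i + 1) < 2 * m"
        using permutes_in_image[OF \<pi>, of "2 * i"] permutes_in_image[OF \<pi>, of "2 * i + 1"] by simp_all
      from inv[OF this] show "A ((?\<tau> \<circ> \<pi>) (2 * i)) ((?\<tau> \<circ> \<pi>) (2 * i + 1)) = A (\<pi> (2 * i)) (\<pi> (2 * i + 1))"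
        by simp
    qed
    ultimately show ?thesis unfolding g_def by simp
  qed
  then have "(\<Sum>\<pi> | \<pi> permutes {..<2 * m}. g \<pi>) = (\<Sum>\<pi> | \<pi> permutes {..<2 * m}. - g \<pi>)"
    using setum_permutations_compose_left[OF \<tau>, of g] by simp
  then show ?thesis unfolding pf_def g_def by (simp add: sum_negf)
qed

text \<open>
  The alternating and multilinear character of the wedge power, in the form in which a
  vector of the radical makes it vanish: put into position \<open>j\<close>, a combination of the vectors with
  \<open>a j \<noteq> 0\<close> multiplies the sum by \<open>a j\<close>, and if the combination lies in the radical the result is zero.
\<close>

lemma pf_row_dependent:
  assumes anti: "\<And>i j. i < 2 * m \<Longrightarrow> j < 2 * m \<Longrightarrow> A i j = - A j i"
    and dep: "\<And>b. b < 2 * m \<Longrightarrow> (\<Sum>i<2 * m. a i * A i b) = 0"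
    and j: "j < 2 * m" "a j \<noteq> 0"
  shows "pf m A = 0"
proof -
  \<comment> \<open>The matrix after the \<open>j\<close>-th vector has been replaced by the \<open>i\<close>-th.\<close>
  define B where "B i r s = A (if r = j then i else r) (if s = j then i else s)" for i r s
  have term0: "(\<Sum>i<2 * m. a i * (\<Prod>l<m. B i (\<pi> (2 * l)) (\<pi> (2 * l + 1)))) = 0"
    if \<pi>: "\<pi> permutes {..<2 * m}" for \<pi>
  proof -
    \<comment> \<open>Exactly one factor of the product involves \<open>j\<close>; it pairs \<open>j\<close> with \<open>b\<close>.\<close>
    obtain q where q: "\<pi> q = j" "q < 2 * m"
      using \<pi> j(1) by (metis lessThan_iff permutes_in_image permutes_inverses(1))
    define l0 where "l0 = q div 2"
    define b where "b = \<pi> (if even q then q + 1 else q - 1)"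
    define \<epsilon> :: real where "\<epsilon> = (if even q then 1 else -1)"
    have l0: "l0 < m" "q = 2 * l0 \<or> q = 2 * l0 + 1" using q unfolding l0_def by linarith+
    have inj: "\<pi> x = \<pi> y \<longleftrightarrow> x = y" for x y using permutes_inj[OF \<pi>] by (auto simp: inj_def)
    have lt: "\<pi> x < 2 * m" if "x < 2 * m" for x using permutes_in_image[OF \<pi>, of x] that by simp
    have b: "b < 2 * m" "b \<noteq> j"
      using l0 q inj by (auto simp: b_def q(1)[symmetric] intro!: lt)
    have fac: "B i (\<pi> (2 * l0)) (\<pi> (2 * l0 + 1)) = \<epsilon> * A i b" if "i < 2 * m" for i
      using l0(2)
    proof
      assume "q = 2 * l0"
      then show ?thesis using q b by (auto simp: B_def b_def \<epsilon>_def)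
    next
      assume q': "q = 2 * l0 + 1"
      then have "B i (\<pi> (2 * l0)) (\<pi> (2 * l0 + 1)) = A b i" using q b by (auto simp: B_def b_def)
      then show ?thesis using anti[OF b(1) that] q' by (simp add: \<epsilon>_def)
    qed
    have rest: "B i (\<pi> (2 * l)) (\<pi> (2 * l + 1)) = A (\<pi> (2 * l)) (\<pi> (2 * l + 1))" if "l \<noteq> l0" for i l
    proof -
      have "\<pi> (2 * l) \<noteq> j" "\<pi> (2 * l + 1) \<noteq> j" unfolding q(1)[symmetric] inj using l0(2) that by presburger+
      then show ?thesis by (simp add: B_def)
    qed
    define R where "R = (\<Prod>l\<in>{..<m} - {l0}. A (\<pi> (2 * l)) (\<pi> (2 * l + 1)))"
    have "(\<Prod>l<m. B i (\<pi> (2 * l)) (\<pi> (2 * l + 1))) = \<epsilon> * A i b * R" if "i < 2 * m" for i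
      using l0(1) by (subst prod.remove[of _ l0]) (auto simp: R_def fac[OF that, simplified] rest[simplified])
    then have "(\<Sum>i<2 * m. a i * (\<Prod>l<m. B i (\<pi> (2 * l)) (\<pi> (2 * l + 1)))) = (\<Sum>i<2 * m. a i * A i b) * (\<epsilon> * R)"
      by (simp add: sum_distrib_left sum_distrib_right mult_ac)
    then show ?thesis using dep[OF b(1)] by simp
  qed
  have "(\<Sum>i<2 * m. a i * pf m (B i)) = (\<Sum>\<pi> | \<pi> permutes {..<2 * m}. of_int (sign \<pi>) * (\<Sum>i<2 * m. a i * (\<Prod>l<m. B i (\<pi> (2 * l)) (\<pi> (2 * l + 1)))))"
    unfolding pf_def sum_distrib_left by (subst sum.swap) (simp add: mult_ac)
  also have "\<dots> = 0" using term0 by simp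
  finally have 0: "(\<Sum>i<2 * m. a i * pf m (B i)) = 0" .
  have "pf m (B i) = 0" if "i < 2 * m" "i \<noteq> j" for i
  proof (rule pf_repeated_index[of i _ j])
    have "(if Transposition.transpose i j r = j then i else Transposition.transpose i j r) = (if r = j then i else r)" for r
      by (simp add: Transposition.transpose_def)
    then show "B i (Transposition.transpose i j r) (Transposition.transpose i j s) = B i r s" for r s
      by (simp add: B_def)
  qed (use that j(1) in auto)
  then have "(\<Sum>i<2 * m. a i * pf m (B i)) = a j * pf m (B j)"
    using j(1) by (subst sum.remove[of _ j]) auto
  moreover have "pf m (B j) = pf m A" by (intro pf_cong) (auto simp: B_def)
  ultimately show ?thesis using 0 j(2) by simp
qed

text \<open>
  The matrix of the standard symplectic form for a basis ordered
  \<open>e\<^sub>0, f\<^sub>0, e\<^sub>1, f\<^sub>1, \<dots>\<close>.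
\<close>

definition std_symp :: "nat \<Rightarrow> nat \<Rightarrow> real" where
  "std_symp r s = (if r div 2 = s div 2 then (if r < s then 1 else if s < r then -1 else 0) else 0)"

text \<open>
  A term is nonzero only if \<open>\<pi>\<close> maps pairs to pairs.  Exchanging two whole pairs is an even
  permutation, and flipping one pair changes both the sign of \<open>\<pi>\<close> and one factor; neither affects
  the term.  Such moves bring the pair containing the last index to the end, in order, and induction
  handles the remaining ones.  Hence nothing cancels in the sum and the top power of a symplectic
  form does not vanish.
\<close>

lemma std_symp_term_nonneg:
  "\<pi> permutes {..<2 * m} \<Longrightarrow>
   0 \<le> of_int (sign \<pi>) * (\<Prod>i<m. std_symp (\<pi> (2 * i)) (\<pi> (2 * i + 1)))"
proof (induction m arbitrary: \<pi>)
  case 0 then show ?case by simp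
next
  case (Suc m)
  let ?S = "{..<2 * Suc m}"
  define g where "g \<pi> = of_int (sign \<pi>) * (\<Prod>i<Suc m. std_symp (\<pi> (2 * i)) (\<pi> (2 * i + 1)))" for \<pi>
  have perm: "permutation \<sigma>" if "\<sigma> permutes ?S" for \<sigma> using that by (auto intro: permutes_imp_permutation)
  have fixing: "0 \<le> g \<sigma>" if \<sigma>: "\<sigma> permutes ?S" "\<sigma> (2 * m) = 2 * m" "\<sigma> (2 * m + 1) = 2 * m + 1" for \<sigma>
  proof -
    have "\<sigma> permutes {..<2 * m}"
    proof (rule permutes_superset[OF \<sigma>(1)])
      fix x assume "x \<in> ?S - {..<2 * m}"
      then have "x = 2 * m \<or> x = 2 * m + 1" by auto
      then show "\<sigma> x = x" using \<sigma> by auto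
    qed
    from Suc.IH[OF this] show ?thesis unfolding g_def using \<sigma> by (simp add: std_symp_def)
  qed
  have last: "0 \<le> g \<sigma>" if \<sigma>: "\<sigma> permutes ?S" "\<sigma> (2 * m) = 2 * m + 1 \<or> \<sigma> (2 * m + 1) = 2 * m + 1" for \<sigma>
  proof (cases "std_symp (\<sigma> (2 * m)) (\<sigma> (2 * m + 1)) = 0")
    case True then show ?thesis by (simp add: g_def)
  next
    case False
    then have ne: "\<sigma> (2 * m) div 2 = \<sigma> (2 * m + 1) div 2" "\<sigma> (2 * m) \<noteq> \<sigma> (2 * m + 1)"
      by (auto simp: std_symp_def split: if_splits)
    consider "\<sigma> (2 * m) = 2 * m" "\<sigma> (2 * m + 1) = 2 * m + 1" | "\<sigma> (2 * m) = 2 * m + 1" "\<sigma> (2 * m + 1) = 2 * m"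
    proof -
      have "a div 2 = b div 2 \<Longrightarrow> a \<noteq> b \<Longrightarrow> a = 2 * m + 1 \<or> b = 2 * m + 1 \<Longrightarrow>
        a = 2 * m \<and> b = 2 * m + 1 \<or> a = 2 * m + 1 \<and> b = 2 * m" for a b :: nat
        by presburger
      from this[OF ne \<sigma>(2)] show thesis using that by blast
    qed
    then show ?thesis
    proof cases
      case 1 then show ?thesis using fixing \<sigma> by blast
    next
      case 2
      let ?t = "Transposition.transpose (2 * m) (2 * m + 1)"
      have t: "?t permutes ?S" by (rule permutes_swap_id) auto
      have p: "\<sigma> \<circ> ?t permutes ?S" by (rule permutes_compose[OF t \<sigma>(1)])
      have "sign (\<sigma> \<circ> ?t) = - sign \<sigma>"
        using perm[OF t] perm[OF \<sigma>(1)] by (simp add: sign_compose sign_swap_id)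
      moreover have "(\<Prod>i<m. std_symp ((\<sigma> \<circ> ?t) (2 * i)) ((\<sigma> \<circ> ?t) (2 * i + 1))) = (\<Prod>i<m. std_symp (\<sigma> (2 * i)) (\<sigma> (2 * i + 1)))"
        by (intro prod.cong refl) (auto simp: Transposition.transpose_def)
      ultimately have "g (\<sigma> \<circ> ?t) = g \<sigma>"
        unfolding g_def prod.lessThan_Suc using 2 by (simp add: std_symp_def del: o_apply) (simp add: o_def)
      moreover have "0 \<le> g (\<sigma> \<circ> ?t)" by (rule fixing[OF p]) (use 2 in auto)
      ultimately show ?thesis by simp
    qed
  qed
  obtain q where q: "\<pi> q = 2 * m + 1" "q < 2 * Suc m"
  proof (rule that[of "inv \<pi> (2 * m + 1)"])
    show "\<pi> (inv \<pi> (2 * m + 1)) = 2 * m + 1" by (rule permutes_inverses(1)[OF Suc.prems])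
    then show "inv \<pi> (2 * m + 1) < 2 * Suc m"
      using permutes_in_image[OF Suc.prems, of "inv \<pi> (2 * m + 1)"] by simp
  qed
  define l where "l = q div 2"
  have l: "l \<le> m" "q = 2 * l \<or> q = 2 * l + 1" using q(2) unfolding l_def by auto
  \<comment> \<open>Exchanges the pair at which \<open>\<pi>\<close> takes the last index with the last pair.\<close>
  define \<beta> where "\<beta> = Transposition.transpose (2 * l) (2 * m) \<circ> Transposition.transpose (2 * l + 1) (2 * m + 1)"
  have \<beta>: "\<beta> permutes ?S" unfolding \<beta>_def using l by (intro permutes_compose permutes_swap_id) auto
  have \<beta>v: "\<beta> (2 * i) = 2 * Transposition.transpose l m i" "\<beta> (2 * i + 1) = 2 * Transposition.transpose l m i + 1" for i
  proof -
    have "2 * i \<noteq> 2 * l + 1" "2 * i \<noteq> 2 * m + 1" "2 * i + 1 \<noteq> 2 * l" "2 * i + 1 \<noteq> 2 * m"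
      "2 * m + 1 \<noteq> 2 * l" "2 * l + 1 \<noteq> 2 * m" by presburger+
    then show "\<beta> (2 * i) = 2 * Transposition.transpose l m i" "\<beta> (2 * i + 1) = 2 * Transposition.transpose l m i + 1"
      unfolding \<beta>_def Transposition.transpose_def o_def by auto
  qed
  have "sign \<beta> = sign (Transposition.transpose (2 * l) (2 * m)) * sign (Transposition.transpose (2 * l + 1) (2 * m + 1))"
    unfolding \<beta>_def by (rule sign_compose) (rule permutation_swap_id)+
  then have "sign \<beta> = 1" by (auto simp: sign_swap_id)
  then have "sign (\<pi> \<circ> \<beta>) = sign \<pi>" using perm[OF \<beta>] perm[OF Suc.prems] by (simp add: sign_compose)
  moreover have "(\<Prod>i<Suc m. std_symp ((\<pi> \<circ> \<beta>) (2 * i)) ((\<pi> \<circ> \<beta>) (2 * i + 1)))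
      = (\<Prod>i<Suc m. std_symp (\<pi> (2 * i)) (\<pi> (2 * i + 1)))"
  proof -
    have "bij_betw (Transposition.transpose l m) {..<Suc m} {..<Suc m}"
      using l by (intro permutes_imp_bij permutes_swap_id) auto
    from prod.reindex_bij_betw[OF this, of "\<lambda>i. std_symp (\<pi> (2 * i)) (\<pi> (2 * i + 1))"]
    show ?thesis by (simp only: o_def \<beta>v)
  qed
  ultimately have "g (\<pi> \<circ> \<beta>) = g \<pi>" by (simp only: g_def)
  moreover have "0 \<le> g (\<pi> \<circ> \<beta>)"
  proof (rule last)
    show "\<pi> \<circ> \<beta> permutes ?S" by (rule permutes_compose[OF \<beta> Suc.prems])
    show "(\<pi> \<circ> \<beta>) (2 * m) = 2 * m + 1 \<or> (\<pi> \<circ> \<beta>) (2 * m + 1) = 2 * m + 1"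
      using l(2) q(1) \<beta>v(1)[of m] \<beta>v(2)[of m] by auto
  qed
  ultimately show ?case by (simp only: g_def)
qed

lemma pf_std_symp_pos: "pf m std_symp > 0"
  unfolding pf_def
proof (rule sum_pos2[of _ id])
  show "0 < of_int (sign (id :: nat \<Rightarrow> nat)) * (\<Prod>i<m. std_symp (id (2 * i)) (id (2 * i + 1)))"
    by (simp add: std_symp_def)
  show "0 \<le> of_int (sign \<pi>) * (\<Prod>i<m. std_symp (\<pi> (2 * i)) (\<pi> (2 * i + 1)))"
    if "\<pi> \<in> {\<pi>. \<pi> permutes {..<2 * m}}" for \<pi>
    using that std_symp_term_nonneg by blast
qed (auto intro: finite_permutations)

section \<open>Linear systems and dimension counts\<close>

text \<open>
  Fewer equations than unknowns.  The dimension counts below reduce to this, which keeps them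
  inside function spaces that are infinite-dimensional as a whole.
\<close>

lemma homogeneous_system_solvable:
  fixes M :: "'r \<Rightarrow> 'x \<Rightarrow> real"
  assumes "finite R" "finite X" "card R < card X"
  shows "\<exists>a. (\<exists>x\<in>X. a x \<noteq> 0) \<and> (\<forall>r\<in>R. (\<Sum>x\<in>X. a x * M r x) = 0)"
  using assms
proof (induction R arbitrary: X M rule: finite_induct)
  case empty
  then obtain x where "x \<in> X" by (metis card.empty card_gt_0_iff ex_in_conv)
  then show ?case by (intro exI[of _ "\<lambda>_. 1"]) auto
next
  case (insert r R)
  show ?case
  proof (cases "\<forall>x\<in>X. M r x = 0")
    case True
    then show ?thesis using insert.IH[of X M] insert.prems insert.hyps by auto
  next
    case False
    then obtain x0 where x0: "x0 \<in> X" "M r x0 \<noteq> 0" by blast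
    define M' where "M' q x = M q x - M q x0 * (M r x / M r x0)" for q x
    have "card R < card (X - {x0})" using insert x0 by simp
    then obtain a where a: "\<exists>x\<in>X - {x0}. a x \<noteq> 0" "\<forall>q\<in>R. (\<Sum>x\<in>X - {x0}. a x * M' q x) = 0"
      using insert.IH[of "X - {x0}" M'] insert.prems by auto
    define t where "t = - (\<Sum>x\<in>X - {x0}. a x * M r x) / M r x0"
    have s: "(\<Sum>x\<in>X. (a(x0 := t)) x * M q x) = t * M q x0 + (\<Sum>x\<in>X - {x0}. a x * M q x)" for q
      using insert.prems x0 by (subst sum.remove[of X x0]) auto
    have "(\<Sum>x\<in>X. (a(x0 := t)) x * M q x) = 0" if "q \<in> insert r R" for q
    proof (cases "q = r")
      case True then show ?thesis unfolding s unfolding t_def using x0 by simp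
    next
      case False
      then have "(\<Sum>x\<in>X - {x0}. a x * M' q x) = 0" using a that by auto
      moreover have "(\<Sum>x\<in>X - {x0}. a x * M' q x) = (\<Sum>x\<in>X - {x0}. a x * M q x) - (\<Sum>x\<in>X - {x0}. a x * M r x) * (M q x0 / M r x0)"
        by (simp add: M'_def algebra_simps sum_subtractf sum_distrib_left sum_distrib_right)
      ultimately show ?thesis unfolding s unfolding t_def using x0(2) by (simp add: field_simps)
    qed
    then show ?thesis using a(1) by (intro exI[of _ "a(x0 := t)"]) auto
  qed
qed

section \<open>Alternating forms and coisotropic subspaces\<close>

definition alt_form :: "'v::real_vector set \<Rightarrow> ('v \<Rightarrow> 'v \<Rightarrow> real) \<Rightarrow> bool" where
  "alt_form V \<sigma> \<longleftrightarrow> subspace V \<and> (\<forall>u\<in>V. \<forall>v\<in>V. \<forall>w\<in>V. \<sigma> (u + v) w = \<sigma> u w + \<sigma> v w) \<and>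
     (\<forall>c. \<forall>u\<in>V. \<forall>w\<in>V. \<sigma> (c *\<^sub>R u) w = c * \<sigma> u w) \<and> (\<forall>u\<in>V. \<forall>w\<in>V. \<sigma> u w = - \<sigma> w u)"

lemma alt_formD:
  assumes "alt_form V \<sigma>"
  shows "subspace V" "\<And>u v w. u \<in> V \<Longrightarrow> v \<in> V \<Longrightarrow> w \<in> V \<Longrightarrow> \<sigma> (u + v) w = \<sigma> u w + \<sigma> v w"
    "\<And>c u w. u \<in> V \<Longrightarrow> w \<in> V \<Longrightarrow> \<sigma> (c *\<^sub>R u) w = c * \<sigma> u w"
    "\<And>u w. u \<in> V \<Longrightarrow> w \<in> V \<Longrightarrow> \<sigma> u w = - \<sigma> w u"
  using assms unfolding alt_form_def by blast+

lemma alt_form_subspace: "alt_form V \<sigma> \<Longrightarrow> subspace S \<Longrightarrow> S \<subseteq> V \<Longrightarrow> alt_form S \<sigma>"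
  unfolding alt_form_def by blast

lemma alt_form_sum:
  assumes "alt_form V \<sigma>" "w \<in> V" "\<And>i. i \<in> I \<Longrightarrow> f i \<in> V"
  shows "\<sigma> (\<Sum>i\<in>I. c i *\<^sub>R f i) w = (\<Sum>i\<in>I. c i * \<sigma> (f i) w)"
  using assms(3)
proof (induction I rule: infinite_finite_induct)
  case (insert i I)
  then have "(\<Sum>i\<in>I. c i *\<^sub>R f i) \<in> V" "c i *\<^sub>R f i \<in> V"
    using alt_formD(1)[OF assms(1)] by (auto intro!: subspace_sum subspace_scale)
  then show ?case using insert alt_formD(2,3)[OF assms(1)] assms(2) by simp
qed (use alt_formD(3)[OF assms(1) assms(2) assms(2), of 0] alt_formD(1)[OF assms(1)] alt_formD(3)[OF assms(1) _ assms(2), of 0 0] in \<open>auto simp: subspace_0\<close>)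

text \<open>
  A symplectic basis of a \<open>2 m\<close>-dimensional subspace of \<open>V\<close>, with the ordering of \<open>std_symp\<close>.
\<close>

definition symp_list :: "'v::real_vector set \<Rightarrow> ('v \<Rightarrow> 'v \<Rightarrow> real) \<Rightarrow> nat \<Rightarrow> (nat \<Rightarrow> 'v) \<Rightarrow> bool" where
  "symp_list V \<sigma> m f \<longleftrightarrow> (\<forall>i<2 * m. f i \<in> V) \<and> (\<forall>i<2 * m. \<forall>j<2 * m. \<sigma> (f i) (f j) = std_symp i j)"

text \<open>
  One step of the symplectic Gram-Schmidt process.  Either \<open>\<sigma>\<close> is nonzero on the orthogonal
  complement \<open>W\<close> of the list, which supplies a further pair; or it vanishes there, and since every
  vector can be moved into \<open>W\<close> by adding a combination of the list, \<open>W\<close> is the radical.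
\<close>

lemma symp_list_extend_or_radical:
  assumes \<sigma>: "alt_form V \<sigma>" and f: "symp_list V \<sigma> m f"
  shows "(\<exists>g. symp_list V \<sigma> (Suc m) g) \<or>
    (\<forall>w\<in>V. (\<forall>i<2 * m. \<sigma> w (f i) = 0) \<longrightarrow> (\<forall>v\<in>V. \<sigma> w v = 0))"
proof -
  note \<sigma>D = alt_formD[OF \<sigma>]
  have fV: "f i \<in> V" if "i < 2 * m" for i using f that by (auto simp: symp_list_def)
  have fJ: "\<sigma> (f i) (f j) = std_symp i j" if "i < 2 * m" "j < 2 * m" for i j using f that by (auto simp: symp_list_def)
  define W where "W = {w \<in> V. \<forall>i<2 * m. \<sigma> w (f i) = 0}"
  show ?thesis
  proof (cases "\<forall>a\<in>W. \<forall>b\<in>W. \<sigma> a b = 0")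
    case True
    have "\<sigma> w v = 0" if w: "w \<in> W" and v: "v \<in> V" for w v
    proof -
      \<comment> \<open>The combination \<open>s\<close> cancels the products of \<open>v\<close> with the list: the partner of each entry
        pairs with it to \<open>1\<close> or \<open>-1\<close>, according to parity.\<close>
      define c where "c i = (if even i then - \<sigma> v (f (i + 1)) else \<sigma> v (f (i - 1)))" for i
      define s where "s = (\<Sum>i<2 * m. c i *\<^sub>R f i)"
      have sV: "s \<in> V" unfolding s_def using fV \<sigma>D(1) by (auto intro!: subspace_sum subspace_scale)
      have "\<sigma> s (f k) = - \<sigma> v (f k)" if k: "k < 2 * m" for k
      proof -
        define p where "p = (if even k then k + 1 else k - 1)"
        have "k + 1 < 2 * m" if "even k" using that k by presburger
        then have p: "p < 2 * m" using k by (auto simp: p_def)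
        have J: "std_symp i k = (if i = p then (if even k then -1 else 1) else 0)" for i
          unfolding std_symp_def p_def by (auto; presburger)
        have "\<sigma> s (f k) = (\<Sum>i<2 * m. c i * std_symp i k)"
          unfolding s_def using fJ k by (subst alt_form_sum[OF \<sigma> fV[OF k] fV]) auto
        also have "\<dots> = c p * (if even k then -1 else 1)"
          unfolding J using p by (simp add: if_distrib[of "\<lambda>x. c _ * x"] cong: if_cong)
        also have "\<dots> = - \<sigma> v (f k)" by (auto simp: c_def p_def odd_pos)
        finally show ?thesis .
      qed
      then have "v + s \<in> W" unfolding W_def using sV v \<sigma>D(1,2) fV by (auto intro: subspace_add)
      then have "\<sigma> (v + s) w = 0" using True w by blast
      moreover have "\<sigma> s w = 0"
      proof -
        have "w \<in> V" using w by (simp add: W_def)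
        have "\<sigma> (f i) w = 0" if "i < 2 * m" for i
          using \<sigma>D(4)[OF fV[OF that] \<open>w \<in> V\<close>] w that by (simp add: W_def)
        then show ?thesis unfolding s_def using \<open>w \<in> V\<close> by (subst alt_form_sum[OF \<sigma> _ fV]) auto
      qed
      ultimately have "\<sigma> v w = 0" using \<sigma>D(2)[OF v sV] w by (simp add: W_def)
      then show ?thesis using \<sigma>D(4)[OF _ v] w by (simp add: W_def)
    qed
    then show ?thesis by (auto simp: W_def)
  next
    case False
    then obtain a b where ab: "a \<in> W" "b \<in> W" "\<sigma> a b \<noteq> 0" by blast
    define a' where "a' = (1 / \<sigma> a b) *\<^sub>R a"
    have V: "a \<in> V" "b \<in> V" "a' \<in> V" using ab \<sigma>D(1) by (auto simp: W_def a'_def intro: subspace_scale)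
    have 0: "\<sigma> a' (f i) = 0" "\<sigma> b (f i) = 0" "\<sigma> (f i) a' = 0" "\<sigma> (f i) b = 0" if "i < 2 * m" for i
      using ab that V fV[OF that] \<sigma>D(3)[OF V(1) fV[OF that]] \<sigma>D(4)[OF fV[OF that] V(3)] \<sigma>D(4)[OF fV[OF that] V(2)]
      by (auto simp: W_def a'_def)
    have self: "\<sigma> a' a' = 0" "\<sigma> b b = 0" using \<sigma>D(4)[OF V(3,3)] \<sigma>D(4)[OF V(2,2)] by auto
    have 1: "\<sigma> a' b = 1" "\<sigma> b a' = -1" using \<sigma>D(3)[OF V(1,2)] \<sigma>D(4)[OF V(2,3)] ab(3) by (auto simp: a'_def)
    define g where "g i = (if i < 2 * m then f i else if i = 2 * m then a' else b)" for i
    have "symp_list V \<sigma> (Suc m) g"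
      unfolding symp_list_def
    proof (intro conjI allI impI)
      show "g i \<in> V" if "i < 2 * Suc m" for i using that fV V by (auto simp: g_def)
      fix i j assume ij: "i < 2 * Suc m" "j < 2 * Suc m"
      have c: "x < 2 * m \<or> x = 2 * m \<or> x = 2 * m + 1" if "x < 2 * Suc m" for x using that by auto
      from c[OF ij(1)] c[OF ij(2)] show "\<sigma> (g i) (g j) = std_symp i j"
        using fJ 0 1 self by (auto simp: g_def std_symp_def)
    qed
    then show ?thesis by blast
  qed
qed

text \<open>
  Iterating the step: without a symplectic list of length \<open>2 m\<close> the radical is cut out by fewer
  than \<open>2 m\<close> linear equations.
\<close>

lemma symp_list_or_small_corank:
  assumes \<sigma>: "alt_form V \<sigma>"
  shows "(\<exists>f. symp_list V \<sigma> m f) \<or> (\<exists>j<m. \<exists>f. symp_list V \<sigma> j f \<and>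
    (\<forall>w\<in>V. (\<forall>i<2 * j. \<sigma> w (f i) = 0) \<longrightarrow> (\<forall>v\<in>V. \<sigma> w v = 0)))"
proof (induction m)
  case 0 then show ?case by (auto simp: symp_list_def)
next
  case (Suc m)
  then show ?case
    using symp_list_extend_or_radical[OF \<sigma>, of m] less_Suc_eq by metis
qed

text \<open>
  Each linear equation lowers the dimension by at most one.
\<close>

lemma solution_space_basis:
  fixes S :: "'v::real_vector set" and \<phi> :: "'r \<Rightarrow> 'v \<Rightarrow> real"
  assumes B0: "finite B0" "independent B0" "span B0 = S"
    and R: "finite R"
    and lin: "\<And>r u v. r \<in> R \<Longrightarrow> u \<in> S \<Longrightarrow> v \<in> S \<Longrightarrow> \<phi> r (u + v) = \<phi> r u + \<phi> r v"
      "\<And>r u c. r \<in> R \<Longrightarrow> u \<in> S \<Longrightarrow> \<phi> r (c *\<^sub>R u) = c * \<phi> r u"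
    and K: "K = {v \<in> S. \<forall>r\<in>R. \<phi> r v = 0}"
  shows "subspace K \<and> (\<exists>BK. finite BK \<and> independent BK \<and> span BK = K \<and> card B0 \<le> card BK + card R)"
proof -
  have S: "subspace S" using B0(3) subspace_span by metis
  have \<phi>0: "\<phi> r 0 = 0" if "r \<in> R" for r using lin(2)[OF that subspace_0[OF S], of 0] by simp
  have subK: "subspace K"
    unfolding K by (rule subspaceI) (auto simp: \<phi>0 lin subspace_0[OF S] subspace_add[OF S] subspace_scale[OF S])
  obtain BK where BK: "BK \<subseteq> K" "independent BK" "K \<subseteq> span BK"
    using maximal_independent_subset[of K] by blast
  have BKS: "BK \<subseteq> S" using BK K by auto
  obtain B where B: "BK \<subseteq> B" "B \<subseteq> S" "independent B" "S \<subseteq> span B"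
    using maximal_independent_subset_extend[OF BKS BK(2)] by blast
  have fB: "finite B" using independent_span_bound[OF B0(1) B(3)] B(2) B0(3) by auto
  have "card B0 \<le> card B" using independent_span_bound[OF fB B0(2)] B(4) B0(3) span_superset by blast
  moreover have "card (B - BK) \<le> card R"
  proof (rule ccontr)
    assume "\<not> card (B - BK) \<le> card R"
    then obtain a where a: "\<exists>x\<in>B - BK. a x \<noteq> 0" "\<And>r. r \<in> R \<Longrightarrow> (\<Sum>x\<in>B - BK. a x * \<phi> r x) = 0"
      using homogeneous_system_solvable[of R "B - BK" \<phi>] R fB by auto
    define t where "t = (\<Sum>x\<in>B - BK. a x *\<^sub>R x)"
    have "\<phi> r (\<Sum>x\<in>X. a x *\<^sub>R x) = (\<Sum>x\<in>X. a x * \<phi> r x) \<and> (\<Sum>x\<in>X. a x *\<^sub>R x) \<in> S"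
      if r: "r \<in> R" and X: "X \<subseteq> B" for r X
      using finite_subset[OF X fB] X
    proof (induction X rule: finite_induct)
      case (insert x X)
      then have "x \<in> S" "a x *\<^sub>R x \<in> S" using B(2) S by (auto intro: subspace_scale)
      then show ?case using insert lin r by (auto intro: subspace_add[OF S])
    qed (use \<phi>0 r subspace_0[OF S] in auto)
    then have "\<phi> r t = 0" if "r \<in> R" for r using a(2) that unfolding t_def by auto
    moreover have "t \<in> S" unfolding t_def using B(2) S by (auto intro!: subspace_sum subspace_scale)
    ultimately have "t \<in> span BK" using BK(3) by (auto simp: K)
    then obtain c where c: "t = (\<Sum>x\<in>BK. c x *\<^sub>R x)"
      using finite_subset[OF B(1) fB] by (auto simp: span_finite)
    define d where "d x = (if x \<in> BK then - c x else a x)" for x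
    have "(\<Sum>x\<in>B. d x *\<^sub>R x) = (\<Sum>x\<in>B - BK. d x *\<^sub>R x) + (\<Sum>x\<in>BK. d x *\<^sub>R x)"
      by (rule sum.subset_diff[OF B(1) fB])
    also have "\<dots> = t + (- t)" by (simp add: d_def) (simp add: t_def c[symmetric] sum_negf)
    finally have "(\<Sum>x\<in>B. d x *\<^sub>R x) = 0" by simp
    then have "\<forall>x\<in>B. d x = 0" using B(3) fB independent_explicit_finite_subsets[of B] by auto
    then show False using a(1) by (auto simp: d_def)
  qed
  moreover have "card B = card (B - BK) + card BK"
    using B(1) fB by (metis card_Diff_subset card_mono finite_subset le_add_diff_inverse2)
  moreover have "span BK = K" using BK subK by (metis span_subspace)
  ultimately show ?thesis using subK BK(2) finite_subset[OF B(1) fB] by (intro conjI exI[of _ BK]) auto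
qed

text \<open>
  The orthogonal complement of \<open>S\<close> has dimension at most \<open>dim T - dim S\<close>.  Otherwise a nonzero
  combination of the vectors in \<open>X\<close> would also be orthogonal to a complementary basis of \<open>S\<close> in \<open>T\<close>,
  hence to all of \<open>T\<close>, against nondegeneracy.
\<close>

lemma orthogonal_complement_card:
  fixes T :: "'v::real_vector set"
  assumes \<Omega>: "alt_form T \<Omega>" and nd: "\<And>v. v \<in> T \<Longrightarrow> (\<And>w. w \<in> T \<Longrightarrow> \<Omega> v w = 0) \<Longrightarrow> v = 0"
    and BT: "finite BT" "independent BT" "span BT = T"
    and BS: "finite BS" "independent BS" "span BS = S" "S \<subseteq> T"
    and X: "finite X" "independent X" "X \<subseteq> {t \<in> T. \<forall>w\<in>S. \<Omega> t w = 0}"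
  shows "card X + card BS \<le> card BT"
proof (rule ccontr)
  assume less: "\<not> card X + card BS \<le> card BT"
  note \<Omega>D = alt_formD[OF \<Omega>]
  have BST: "BS \<subseteq> T" using BS span_superset by blast
  obtain B where B: "BS \<subseteq> B" "B \<subseteq> T" "independent B" "T \<subseteq> span B"
    using maximal_independent_subset_extend[OF BST BS(2)] by blast
  have fB: "finite B" "card B \<le> card BT" using independent_span_bound[OF BT(1) B(3)] B(2) BT(3) by auto
  have "card (B - BS) < card X"
    using less fB(2) card_mono[OF fB(1) B(1)] by (simp add: card_Diff_subset[OF BS(1) B(1)])
  then obtain a where a: "\<exists>x\<in>X. a x \<noteq> 0" "\<And>b. b \<in> B - BS \<Longrightarrow> (\<Sum>x\<in>X. a x * \<Omega> x b) = 0"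
    using homogeneous_system_solvable[of "B - BS" X "\<lambda>b x. \<Omega> x b"] fB X by auto
  define t where "t = (\<Sum>x\<in>X. a x *\<^sub>R x)"
  have XT: "x \<in> T" if "x \<in> X" for x using X(3) that by auto
  have tT: "t \<in> T" unfolding t_def using XT \<Omega>D(1) by (auto intro!: subspace_sum subspace_scale)
  have "\<Omega> t b = 0" if b: "b \<in> B" for b
  proof -
    have e: "\<Omega> t b = (\<Sum>x\<in>X. a x * \<Omega> x b)"
      unfolding t_def using B(2) b XT by (intro alt_form_sum[OF \<Omega>]) auto
    show ?thesis
    proof (cases "b \<in> BS")
      case True
      then have "b \<in> S" using BS(3) span_superset by blast
      then show ?thesis unfolding e using X(3) by (intro sum.neutral) auto
    next
      case False then show ?thesis using e a(2) b by simp
    qed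
  qed
  moreover have "subspace {w \<in> T. \<Omega> t w = 0}"
  proof (rule subspaceI)
    have r: "\<Omega> t w = - \<Omega> w t" if "w \<in> T" for w using \<Omega>D(4)[OF tT that] .
    show "0 \<in> {w \<in> T. \<Omega> t w = 0}" using r[of 0] \<Omega>D(3)[OF tT tT, of 0] subspace_0[OF \<Omega>D(1)] \<Omega>D(3)[of 0 t 0] tT by auto
    show "x + y \<in> {w \<in> T. \<Omega> t w = 0}" if "x \<in> {w \<in> T. \<Omega> t w = 0}" "y \<in> {w \<in> T. \<Omega> t w = 0}" for x y
      using that r[of "x + y"] r[of x] r[of y] \<Omega>D(2)[of x y t] tT by (auto intro: subspace_add[OF \<Omega>D(1)])
    show "c *\<^sub>R x \<in> {w \<in> T. \<Omega> t w = 0}" if "x \<in> {w \<in> T. \<Omega> t w = 0}" for c x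
      using that r[of "c *\<^sub>R x"] r[of x] \<Omega>D(3)[of x t c] tT by (auto intro: subspace_scale[OF \<Omega>D(1)])
  qed
  ultimately have "span B \<subseteq> {w \<in> T. \<Omega> t w = 0}" using B(2) by (intro span_minimal) auto
  then have "t = 0" using nd[OF tT] B(4) by blast
  then have "\<forall>x\<in>X. a x = 0" using X(1,2) independent_explicit_finite_subsets[of X] by (auto simp: t_def)
  then show False using a(1) by blast
qed

text \<open>
  Write \<open>C\<close> for the orthogonal complement of \<open>S\<close>, which has dimension \<open>n - k\<close>, and \<open>K = S \<inter> C\<close>
  for the radical of the restriction of \<open>\<Omega>\<close> to \<open>S\<close>.  If \<open>C \<subseteq> S\<close>, then \<open>K = C\<close> has codimension
  \<open>2 k\<close> in \<open>S\<close>, so among \<open>2 k + 2\<close> vectors of \<open>S\<close> some nontrivial combination is in \<open>K\<close> and the sum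
  vanishes.  Conversely, if the sum vanishes on \<open>S\<close>, there is no symplectic list of length \<open>2 k + 2\<close>,
  so \<open>K\<close> has codimension at most \<open>2 k\<close>; then \<open>dim K \<ge> n - k = dim C\<close> and again \<open>K = C\<close>.
\<close>

lemma coisotropic_iff_pf_vanishes:
  fixes T :: "'v::real_vector set"
  assumes \<Omega>: "alt_form T \<Omega>" and nd: "\<And>v. v \<in> T \<Longrightarrow> (\<And>w. w \<in> T \<Longrightarrow> \<Omega> v w = 0) \<Longrightarrow> v = 0"
    and BT: "finite BT" "independent BT" "span BT = T" "card BT = 2 * n"
    and BS: "finite BS" "independent BS" "span BS = S" "S \<subseteq> T" "card BS = n + k" and kn: "k \<le> n"
  shows "{t \<in> T. \<forall>w\<in>S. \<Omega> t w = 0} \<subseteq> S \<longleftrightarrow>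
    (\<forall>g. (\<forall>i<2 * (k + 1). g i \<in> S) \<longrightarrow> pf (k + 1) (\<lambda>i j. \<Omega> (g i) (g j)) = 0)"
    (is "?C \<subseteq> S \<longleftrightarrow> ?P")
proof
  note \<Omega>D = alt_formD[OF \<Omega>]
  have S: "subspace S" using BS(3) subspace_span by metis
  have lin: "\<Omega> (u + v) r = \<Omega> u r + \<Omega> v r" "\<Omega> (c *\<^sub>R u) r = c * \<Omega> u r" if "r \<in> T" "u \<in> T" "v \<in> T" for u v r c
    using \<Omega>D(2,3) that by auto
  {
    assume C: "?C \<subseteq> S"
    \<comment> \<open>It is enough to test orthogonality on a basis of \<open>S\<close>; this gives \<open>n + k\<close> equations.\<close>
    define C where "C = {t \<in> T. \<forall>b\<in>BS. \<Omega> t b = 0}"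
    have bT: "b \<in> T" if "b \<in> BS" for b using that BS span_superset by blast
    have CC: "C = ?C"
    proof -
      have "\<Omega> t w = 0" if t: "t \<in> T" "\<forall>b\<in>BS. \<Omega> t b = 0" and w: "w \<in> S" for t w
      proof -
        obtain c where c: "w = (\<Sum>b\<in>BS. c b *\<^sub>R b)" using w BS(1,3) by (auto simp: span_finite)
        have "\<Omega> w t = (\<Sum>b\<in>BS. c b * \<Omega> b t)" unfolding c using bT t by (intro alt_form_sum[OF \<Omega>]) auto
        also have "\<dots> = 0" using t bT \<Omega>D(4)[OF bT t(1)] by (intro sum.neutral) auto
        finally show ?thesis using \<Omega>D(4)[OF t(1)] w BS(4) by auto
      qed
      moreover have "b \<in> S" if "b \<in> BS" for b using that BS(3) span_superset by blast
      ultimately show ?thesis unfolding C_def by blast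
    qed
    obtain BC where BC: "finite BC" "independent BC" "span BC = C" "card BT \<le> card BC + card BS"
      using solution_space_basis[OF BT(1-3) BS(1), of "\<lambda>b t. \<Omega> t b" C] lin bT C_def by auto
    have subC: "subspace C" using BC(3) subspace_span by metis
    have "BC \<subseteq> S" using BC(3) C CC span_superset by blast
    then obtain B where B: "BC \<subseteq> B" "B \<subseteq> S" "independent B" "S \<subseteq> span B"
      using maximal_independent_subset_extend[OF _ BC(2)] by blast
    have fB: "finite B" "card B \<le> n + k" using independent_span_bound[OF BS(1) B(3)] B(2) BS(3,5) by auto
    have cB: "card (B - BC) \<le> 2 * k"
      using fB BC(4) BT(4) BS(5) kn by (simp add: card_Diff_subset[OF BC(1) B(1)])
    show ?P
    proof (intro allI impI)
      fix g assume g: "\<forall>i<2 * (k + 1). g i \<in> S"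
      have "\<forall>i. \<exists>c. i < 2 * (k + 1) \<longrightarrow> g i = (\<Sum>b\<in>B. c b *\<^sub>R b)"
      proof
        fix i
        show "\<exists>c. i < 2 * (k + 1) \<longrightarrow> g i = (\<Sum>b\<in>B. c b *\<^sub>R b)"
        proof (cases "i < 2 * (k + 1)")
          case True
          then have "g i \<in> span B" using g B(4) by auto
          then show ?thesis using fB(1) by (auto simp: span_finite)
        qed simp
      qed
      from choice[OF this] obtain c where c: "\<And>i. i < 2 * (k + 1) \<Longrightarrow> g i = (\<Sum>b\<in>B. c i b *\<^sub>R b)" by blast
      obtain a where a: "\<exists>i\<in>{..<2 * (k + 1)}. a i \<noteq> 0" "\<And>b. b \<in> B - BC \<Longrightarrow> (\<Sum>i<2 * (k + 1). a i * c i b) = 0"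
        using homogeneous_system_solvable[of "B - BC" "{..<2 * (k + 1)}" "\<lambda>b i. c i b"] fB(1) cB by auto
      define t where "t = (\<Sum>i<2 * (k + 1). a i *\<^sub>R g i)"
      have "t = (\<Sum>i<2 * (k + 1). a i *\<^sub>R (\<Sum>b\<in>B. c i b *\<^sub>R b))" unfolding t_def using c by auto
      also have "\<dots> = (\<Sum>b\<in>B. (\<Sum>i<2 * (k + 1). a i * c i b) *\<^sub>R b)"
        unfolding scaleR_sum_right scaleR_sum_left by (subst sum.swap) simp
      also have "\<dots> = (\<Sum>b\<in>BC. (\<Sum>i<2 * (k + 1). a i * c i b) *\<^sub>R b)"
        using B(1) fB(1) a(2) by (intro sum.mono_neutral_right) auto
      also have "\<dots> \<in> span BC" by (intro span_sum span_scale span_base)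
      finally have tC: "t \<in> ?C" using BC(3) CC by simp
      from a(1) obtain j where j: "j < 2 * (k + 1)" "a j \<noteq> 0" by auto
      have gT: "g i \<in> T" if "i < 2 * (k + 1)" for i using g that BS(4) by auto
      show "pf (k + 1) (\<lambda>i j. \<Omega> (g i) (g j)) = 0"
      proof (rule pf_row_dependent[where a = a and j = j])
        show "\<Omega> (g i) (g j) = - \<Omega> (g j) (g i)" if "i < 2 * (k + 1)" "j < 2 * (k + 1)" for i j
          by (rule \<Omega>D(4)[OF gT[OF that(1)] gT[OF that(2)]])
        show "(\<Sum>i<2 * (k + 1). a i * \<Omega> (g i) (g b)) = 0" if b: "b < 2 * (k + 1)" for b
        proof -
          have "(\<Sum>i<2 * (k + 1). a i * \<Omega> (g i) (g b)) = \<Omega> t (g b)"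
            unfolding t_def by (rule alt_form_sum[OF \<Omega> gT[OF b] gT, symmetric]) auto
          then show ?thesis using tC g b by auto
        qed
        show "j < 2 * (k + 1)" "a j \<noteq> 0" by fact+
      qed
    qed
  }
  {
    assume P: ?P
    have aS: "alt_form S \<Omega>" by (rule alt_form_subspace[OF \<Omega> S BS(4)])
    have no: "\<not> symp_list S \<Omega> (k + 1) f" for f
    proof
      assume f: "symp_list S \<Omega> (k + 1) f"
      then have "pf (k + 1) (\<lambda>i j. \<Omega> (f i) (f j)) = 0" using P by (auto simp: symp_list_def)
      moreover have "pf (k + 1) (\<lambda>i j. \<Omega> (f i) (f j)) = pf (k + 1) std_symp"
        using f by (intro pf_cong) (auto simp: symp_list_def)
      ultimately show False using pf_std_symp_pos[of "k + 1"] by simp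
    qed
    then obtain j f where jf: "j < k + 1" "symp_list S \<Omega> j f"
       "\<And>w v. w \<in> S \<Longrightarrow> (\<forall>i<2 * j. \<Omega> w (f i) = 0) \<Longrightarrow> v \<in> S \<Longrightarrow> \<Omega> w v = 0"
      using symp_list_or_small_corank[OF aS, of "k + 1"] by metis
    define K where "K = {w \<in> S. \<forall>i\<in>{..<2 * j}. \<Omega> w (f i) = 0}"
    have fT: "f i \<in> T" if "i < 2 * j" for i using jf(2) BS(4) that by (auto simp: symp_list_def)
    have "subspace K \<and> (\<exists>BK. finite BK \<and> independent BK \<and> span BK = K \<and> card BS \<le> card BK + card {..<2 * j})"
    proof (rule solution_space_basis[OF BS(1-3)])
      show "\<Omega> (u + v) (f r) = \<Omega> u (f r) + \<Omega> v (f r)" if "r \<in> {..<2 * j}" "u \<in> S" "v \<in> S" for r u v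
        using lin(1)[OF fT, of r u v] that BS(4) by blast
      show "\<Omega> (c *\<^sub>R u) (f r) = c * \<Omega> u (f r)" if "r \<in> {..<2 * j}" "u \<in> S" for r u c
        using lin(2)[OF fT, of r u u c] that BS(4) by blast
    qed (simp_all add: K_def)
    then obtain BK where BK: "finite BK" "independent BK" "span BK = K" "card BS \<le> card BK + 2 * j"
      by auto
    have KC: "K \<subseteq> ?C" using jf(3) BS(4) by (auto simp: K_def)
    have BKC: "BK \<subseteq> ?C" using KC BK(3) span_superset by blast
    show "?C \<subseteq> S"
    proof (rule ccontr)
      assume "\<not> ?C \<subseteq> S"
      then obtain c where c: "c \<in> ?C" "c \<notin> S" by blast
      then have cK: "c \<notin> span BK" using BK(3) by (auto simp: K_def)
      then have "independent (insert c BK)" "c \<notin> BK" using BK(2) span_base independent_insertI by auto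
      then have "card (insert c BK) + card BS \<le> card BT"
        using BK(1) BKC c by (intro orthogonal_complement_card[OF \<Omega> nd BT(1-3) BS(1-4)]) auto
      then show False using \<open>c \<notin> BK\<close> BK(1,4) BS(5) BT(4) jf(1) kn by simp
    qed
  }
qed

section \<open>Differentiable maps between manifolds\<close>

text \<open>
  Differentiability at a point, in all charts.  The first clause is continuity: without it the
  coordinate expression would be taken at points outside the chart of the target.
\<close>

definition diff_at :: "'p manifold \<Rightarrow> 'q manifold \<Rightarrow> ('p \<Rightarrow> 'q) \<Rightarrow> 'p \<Rightarrow> bool" where
  "diff_at M M' f p \<longleftrightarrow> (\<forall>c\<in>charts M. p \<in> fst c \<longrightarrow> (\<forall>d\<in>charts M'. f p \<in> fst d \<longrightarrow>
     (\<forall>\<^sub>F x in nbh (mdim M) (snd c p). f (cinv c x) \<in> fst d) \<and>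
     (\<forall>j<mdim M'. tdiff (mdim M) (\<lambda>x. snd d (f (cinv c x)) j) (snd c p))))"

text \<open>
  The regularity on which tangent vectors and tangent maps rest: transition maps have total
  derivatives.  Smooth atlases have it, and it is what is shown for the charts of the dual bundle.
\<close>

definition diff_atlas :: "'p manifold \<Rightarrow> bool" where
  "diff_atlas M \<longleftrightarrow> (\<forall>c\<in>charts M. inj_on (snd c) (fst c) \<and> snd c ` fst c \<subseteq> Rn (mdim M) \<and>
     (\<forall>p\<in>fst c. \<forall>\<^sub>F x in nbh (mdim M) (snd c p). x \<in> snd c ` fst c)) \<and>
     (\<forall>p. diff_at M M (\<lambda>x. x) p)"

lemma cinv_chart: "inj_on (snd c) (fst c) \<Longrightarrow> p \<in> fst c \<Longrightarrow> cinv c (snd c p) = p"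
  by (simp add: cinv_def inv_into_f_f)

lemma chart_cinv: "x \<in> snd c ` fst c \<Longrightarrow> snd c (cinv c x) = x \<and> cinv c x \<in> fst c"
  by (simp add: cinv_def f_inv_into_f inv_into_into)

lemma diff_atlasD:
  assumes "diff_atlas M" "c \<in> charts M"
  shows "inj_on (snd c) (fst c)" "snd c ` fst c \<subseteq> Rn (mdim M)"
    "\<And>p. p \<in> fst c \<Longrightarrow> snd c p \<in> Rn (mdim M)" "\<And>p. p \<in> fst c \<Longrightarrow> cinv c (snd c p) = p"
    "\<And>p. p \<in> fst c \<Longrightarrow> \<forall>\<^sub>F x in nbh (mdim M) (snd c p). x \<in> snd c ` fst c"
    "\<And>p. p \<in> fst c \<Longrightarrow> p \<in> points M"
  using assms unfolding diff_atlas_def points_def by (auto simp: cinv_chart)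

lemma diff_atlas_id: "diff_atlas M \<Longrightarrow> diff_at M M (\<lambda>x. x) p"
  by (simp add: diff_atlas_def)

lemma diff_atD:
  assumes M': "diff_atlas M'" and M: "diff_atlas M" and f: "diff_at M M' f p"
    and c: "c \<in> charts M" "p \<in> fst c" and d: "d \<in> charts M'" "f p \<in> fst d"
  shows "\<forall>\<^sub>F x in nbh (mdim M) (snd c p). f (cinv c x) \<in> fst d"
    "\<forall>\<^sub>F x in nbh (mdim M) (snd c p). snd d (f (cinv c x)) \<in> Rn (mdim M')"
    "tdiff (mdim M) (\<lambda>x. snd d (f (cinv c x)) j) (snd c p)"
proof -
  show ev: "\<forall>\<^sub>F x in nbh (mdim M) (snd c p). f (cinv c x) \<in> fst d"
    using f c d by (auto simp: diff_at_def)
  show R: "\<forall>\<^sub>F x in nbh (mdim M) (snd c p). snd d (f (cinv c x)) \<in> Rn (mdim M')"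
    using ev by eventually_elim (rule diff_atlasD(3)[OF M' d(1)])
  have x: "snd c p \<in> Rn (mdim M)" by (rule diff_atlasD(3)[OF M c])
  show "tdiff (mdim M) (\<lambda>x. snd d (f (cinv c x)) j) (snd c p)"
  proof (cases "j < mdim M'")
    case True then show ?thesis using f c d by (auto simp: diff_at_def)
  next
    case False
    have "\<forall>\<^sub>F x in nbh (mdim M) (snd c p). 0 = snd d (f (cinv c x)) j"
      using R by eventually_elim (use False in \<open>auto simp: Rn_def\<close>)
    then show ?thesis by (rule tdiff_cong[OF tdiff_const[OF x] _ x])
  qed
qed

text \<open>
  The chain rule, passing through an arbitrary chart \<open>d\<close> of the manifold in the middle.  Taking
  identities for \<open>f\<close> or \<open>g\<close> gives the change of charts.
\<close>

lemma diff_at_chain: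
  assumes M: "diff_atlas M" and M': "diff_atlas M'" and M'': "diff_atlas M''"
    and f: "diff_at M M' f p" and g: "diff_at M' M'' g (f p)"
    and c: "c \<in> charts M" "p \<in> fst c" and d: "d \<in> charts M'" "f p \<in> fst d" and e: "e \<in> charts M''" "g (f p) \<in> fst e"
  shows "tdiff (mdim M) (\<lambda>x. snd e (g (f (cinv c x))) j) (snd c p)"
    "dmap (mdim M) (\<lambda>x. snd e (g (f (cinv c x)))) (snd c p) u =
     dmap (mdim M') (\<lambda>y. snd e (g (cinv d y))) (snd d (f p)) (dmap (mdim M) (\<lambda>x. snd d (f (cinv c x))) (snd c p) u)"
    "\<forall>\<^sub>F x in nbh (mdim M) (snd c p). g (f (cinv c x)) \<in> fst e"
proof -
  have x: "snd c p \<in> Rn (mdim M)" by (rule diff_atlasD(3)[OF M c])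
  have cp: "cinv c (snd c p) = p" by (rule diff_atlasD(4)[OF M c])
  note F = diff_atD[OF M' M f c d]
  note G = diff_atD[OF M'' M' g d e]
  have F0: "snd d (f (cinv c (snd c p))) = snd d (f p)" using cp by simp
  have bk: "\<forall>\<^sub>F x in nbh (mdim M) (snd c p). cinv d (snd d (f (cinv c x))) = f (cinv c x)"
    using F(1) by eventually_elim (rule diff_atlasD(4)[OF M' d(1)])
  have G3: "tdiff (mdim M') (\<lambda>y. snd e (g (cinv d y)) j) (snd d (f (cinv c (snd c p))))" for j
    unfolding F0 by (rule G(3))
  have T: "tdiff (mdim M) (\<lambda>x. snd e (g (cinv d (snd d (f (cinv c x))))) j) (snd c p)" for j
    by (rule tdiff_compose[of "mdim M'" "mdim M" "\<lambda>x. snd d (f (cinv c x))" "snd c p", OF F(3) F(2) x G3])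
  have eq: "\<forall>\<^sub>F x in nbh (mdim M) (snd c p). snd e (g (cinv d (snd d (f (cinv c x))))) j = snd e (g (f (cinv c x))) j" for j
    using bk by eventually_elim simp
  show "tdiff (mdim M) (\<lambda>x. snd e (g (f (cinv c x))) j) (snd c p)"
    by (rule tdiff_cong[OF T eq x])
  show "dmap (mdim M) (\<lambda>x. snd e (g (f (cinv c x)))) (snd c p) u =
     dmap (mdim M') (\<lambda>y. snd e (g (cinv d y))) (snd d (f p)) (dmap (mdim M) (\<lambda>x. snd d (f (cinv c x))) (snd c p) u)"
    unfolding dmap_def
  proof
    fix j
    show "dir_deriv (mdim M) (\<lambda>z. snd e (g (f (cinv c z))) j) (snd c p) u =
      dir_deriv (mdim M') (\<lambda>z. snd e (g (cinv d z)) j) (snd d (f p)) (\<lambda>j. dir_deriv (mdim M) (\<lambda>z. snd d (f (cinv c z)) j) (snd c p) u)"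
      using dir_deriv_compose[of "mdim M'" "mdim M" "\<lambda>x. snd d (f (cinv c x))" "snd c p", OF F(3) F(2) x G3[of j], of u]
        dir_deriv_cong[OF T eq x, of j u] by (simp add: F0)
  qed
  have "filterlim (\<lambda>x. snd d (f (cinv c x))) (nbh (mdim M') (snd d (f p))) (nbh (mdim M) (snd c p))"
    using filterlim_tdiff[of "mdim M'" "mdim M" "\<lambda>x. snd d (f (cinv c x))" "snd c p", OF F(3) F(2) x] by (simp add: F0)
  then have "\<forall>\<^sub>F x in nbh (mdim M) (snd c p). g (cinv d (snd d (f (cinv c x)))) \<in> fst e"
    using G(1) by (auto simp: filterlim_iff)
  then show "\<forall>\<^sub>F x in nbh (mdim M) (snd c p). g (f (cinv c x)) \<in> fst e"
    using bk by eventually_elim simp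
qed

lemma diff_at_compose:
  assumes M: "diff_atlas M" and M': "diff_atlas M'" and M'': "diff_atlas M''"
    and f: "diff_at M M' f p" "f p \<in> points M'" and g: "diff_at M' M'' g (f p)"
  shows "diff_at M M'' (\<lambda>x. g (f x)) p"
proof -
  obtain d where d: "d \<in> charts M'" "f p \<in> fst d" using f(2) by (auto simp: points_def)
  show ?thesis unfolding diff_at_def using diff_at_chain[OF M M' M'' f(1) g _ _ d] by blast
qed

section \<open>Tangent spaces\<close>

lemma dir_deriv_add: "dir_deriv N f x (u + v) = dir_deriv N f x u + dir_deriv N f x v"
  by (simp add: dir_deriv_def distrib_left sum.distrib)

lemma dir_deriv_scale: "dir_deriv N f x (a *\<^sub>R u) = a * dir_deriv N f x u"
  by (simp add: dir_deriv_def scaleR_fun_def sum_distrib_left mult_ac)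

lemma dmap_add: "dmap N F x (u + v) = dmap N F x u + dmap N F x v"
  by (simp add: dmap_def dir_deriv_add fun_eq_iff)

lemma scaleR_fun_apply: "(a *\<^sub>R f) x = a *\<^sub>R f x"
  by (simp add: scaleR_fun_def)

lemma dmap_scale: "dmap N F x (a *\<^sub>R u) = a *\<^sub>R dmap N F x u"
  by (rule ext) (simp only: dmap_def scaleR_fun_apply dir_deriv_scale real_scaleR_def)

lemma dmap_zero: "dmap N F x 0 = 0"
  by (simp add: dmap_def dir_deriv_def fun_eq_iff)

lemma dmap_in_Rn:
  assumes "x \<in> Rn N" "\<forall>\<^sub>F y in nbh N x. F y \<in> Rn M"
  shows "dmap N F x u \<in> Rn M"
proof -
  have "dir_deriv N (\<lambda>z. F z j) x u = 0" if j: "j \<ge> M" for j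
  proof -
    have ev: "\<forall>\<^sub>F y in nbh N x. 0 = F y j"
      using assms(2) by eventually_elim (use j in \<open>auto simp: Rn_def\<close>)
    have "dir_deriv N (\<lambda>_. 0) x u = dir_deriv N (\<lambda>z. F z j) x u"
      by (rule dir_deriv_cong[OF tdiff_const[OF assms(1)] ev assms(1)])
    then show ?thesis using has_pds_dir_deriv[OF has_pds_const assms(1)] by simp
  qed
  then show ?thesis by (auto simp: Rn_def dmap_def)
qed

lemma dir_deriv_coord:
  assumes "j < N" "x \<in> Rn N" shows "dir_deriv N (\<lambda>y. y j) x u = u j"
  using has_pds_dir_deriv[OF has_pds_coord[OF assms(1)] assms(2)] assms(1)
  by (simp add: if_distrib[of "\<lambda>a. a * _"] cong: if_cong)

lemma dmap_ident:
  assumes x: "x \<in> Rn N" and u: "u \<in> Rn N" and F: "\<forall>\<^sub>F y in nbh N x. F y = y"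
  shows "dmap N F x u = u"
proof (rule Rn_eqI[OF _ u])
  show "dmap N F x u \<in> Rn N"
    by (rule dmap_in_Rn[OF x]) (use F eventually_nbh_Rn[of N x] in eventually_elim, simp)
  fix j assume j: "j < N"
  have "\<forall>\<^sub>F y in nbh N x. y j = F y j" using F by eventually_elim simp
  from dir_deriv_cong[OF tdiff_coord[OF j x] this x, of u]
  show "dmap N F x u j = u j" by (simp add: dmap_def dir_deriv_coord[OF j x])
qed

lemma sum_fun_apply: "(\<Sum>a\<in>A. f a) x = (\<Sum>a\<in>A. f a x :: 'b::ab_group_add)"
  by (induction A rule: infinite_finite_induct) auto

text \<open>
  The transformation law in the definition of tangent vectors is the chain rule for transition maps.
\<close>

lemma coord_vec_tangent:
  assumes M: "diff_atlas M" and c: "c \<in> charts M" "p \<in> fst c" and u: "u \<in> Rn (mdim M)"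
  shows "coord_vec M c p u \<in> tangent M p" "coord_vec M c p u c = u"
proof -
  note I = diff_atlas_id[OF M, of p]
  have x: "snd c p \<in> Rn (mdim M)" by (rule diff_atlasD(3)[OF M c])
  have "\<forall>\<^sub>F y in nbh (mdim M) (snd c p). snd c (cinv c y) = y"
    using diff_atlasD(5)[OF M c] by eventually_elim (simp add: chart_cinv)
  then show "coord_vec M c p u c = u"
    using c by (simp add: coord_vec_def dmap_ident[OF x u])
  have R: "dmap (mdim M) (snd d \<circ> cinv c) (snd c p) u \<in> Rn (mdim M)" if "d \<in> charts M" "p \<in> fst d" for d
    using diff_atD(2)[OF M M I c that] by (intro dmap_in_Rn[OF x]) simp
  have ch: "dmap (mdim M) (snd e \<circ> cinv c) (snd c p) u =
      dmap (mdim M) (snd e \<circ> cinv d) (snd d p) (dmap (mdim M) (snd d \<circ> cinv c) (snd c p) u)"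
    if "d \<in> charts M" "p \<in> fst d" "e \<in> charts M" "p \<in> fst e" for d e
    using diff_at_chain(2)[OF M M M I I c that] by (simp add: o_def)
  show "coord_vec M c p u \<in> tangent M p"
    unfolding tangent_def
  proof (intro CollectI conjI ballI impI allI)
    show "coord_vec M c p u d = 0" if "d \<notin> charts M \<or> p \<notin> fst d" for d
      using that by (auto simp: coord_vec_def)
    show "coord_vec M c p u d \<in> Rn (mdim M)" if "d \<in> charts M" "p \<in> fst d" for d
      using R[OF that] that by (simp add: coord_vec_def)
    show "coord_vec M c p u e = dmap (mdim M) (snd e \<circ> cinv d) (snd d p) (coord_vec M c p u d)"
      if "d \<in> charts M" "e \<in> charts M" "p \<in> fst d \<and> p \<in> fst e" for d e
      using ch[of d e] that by (simp add: coord_vec_def)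
  qed
qed

lemma tangentD:
  assumes "v \<in> tangent M p" "c \<in> charts M" "p \<in> fst c"
  shows "v c \<in> Rn (mdim M)"
    "\<And>d. d \<in> charts M \<Longrightarrow> p \<in> fst d \<Longrightarrow> v d = dmap (mdim M) (\<lambda>x. snd d (cinv c x)) (snd c p) (v c)"
proof -
  have v: "\<forall>c\<in>charts M. p \<in> fst c \<longrightarrow> v c \<in> Rn (mdim M)"
    "\<forall>c\<in>charts M. \<forall>d\<in>charts M. p \<in> fst c \<and> p \<in> fst d \<longrightarrow>
        v d = dmap (mdim M) (snd d \<circ> cinv c) (snd c p) (v c)"
    using assms(1) unfolding tangent_def by blast+
  show "v c \<in> Rn (mdim M)" using v(1) assms(2,3) by blast
  show "v d = dmap (mdim M) (\<lambda>x. snd d (cinv c x)) (snd c p) (v c)" if "d \<in> charts M" "p \<in> fst d" for d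
    using v(2) assms(2,3) that unfolding o_def by blast
qed

lemma tangent_outside: "v \<in> tangent M p \<Longrightarrow> d \<notin> charts M \<or> p \<notin> fst d \<Longrightarrow> v d = 0"
  unfolding tangent_def by blast

lemma tangent_eqI:
  assumes "v \<in> tangent M p" "w \<in> tangent M p" "c \<in> charts M" "p \<in> fst c" "v c = w c"
  shows "v = w"
proof
  fix d
  show "v d = w d"
  proof (cases "d \<in> charts M \<and> p \<in> fst d")
    case True
    then show ?thesis using tangentD(2)[OF assms(1,3,4), of d] tangentD(2)[OF assms(2,3,4), of d] assms(5) by simp
  next
    case False
    then show ?thesis using tangent_outside[OF assms(1), of d] tangent_outside[OF assms(2), of d] by simp
  qed
qed

lemma coord_vec_of_tangent:
  assumes "diff_atlas M" "c \<in> charts M" "p \<in> fst c" "v \<in> tangent M p"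
  shows "coord_vec M c p (v c) = v"
  using assms tangentD(1)[OF assms(4,2,3)] by (intro tangent_eqI[OF coord_vec_tangent(1) _ assms(2,3)] coord_vec_tangent(2))

lemma subspace_tangent: "subspace (tangent M p)"
proof (rule subspaceI)
  show "0 \<in> tangent M p" by (simp add: tangent_def dmap_zero Rn_def)
  show "x + y \<in> tangent M p" if xy: "x \<in> tangent M p" "y \<in> tangent M p" for x y
    unfolding tangent_def
  proof (intro CollectI conjI ballI impI allI)
    show "(x + y) d = 0" if "d \<notin> charts M \<or> p \<notin> fst d" for d
      using tangent_outside[OF xy(1) that] tangent_outside[OF xy(2) that] by simp
    show "(x + y) d \<in> Rn (mdim M)" if "d \<in> charts M" "p \<in> fst d" for d
      using tangentD(1)[OF xy(1) that] tangentD(1)[OF xy(2) that] by (simp add: Rn_def)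
    show "(x + y) e = dmap (mdim M) (snd e \<circ> cinv d) (snd d p) ((x + y) d)"
      if "d \<in> charts M" "e \<in> charts M" "p \<in> fst d \<and> p \<in> fst e" for d e
      using tangentD(2)[OF xy(1), of d e] tangentD(2)[OF xy(2), of d e] that by (simp add: dmap_add o_def)
  qed
  show "a *\<^sub>R x \<in> tangent M p" if x: "x \<in> tangent M p" for a x
    unfolding tangent_def
  proof (intro CollectI conjI ballI impI allI)
    show "(a *\<^sub>R x) d = 0" if "d \<notin> charts M \<or> p \<notin> fst d" for d
      using tangent_outside[OF x that] by (simp add: scaleR_fun_apply)
    show "(a *\<^sub>R x) d \<in> Rn (mdim M)" if "d \<in> charts M" "p \<in> fst d" for d
      using tangentD(1)[OF x that] by (simp add: Rn_def scaleR_fun_apply)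
    show "(a *\<^sub>R x) e = dmap (mdim M) (snd e \<circ> cinv d) (snd d p) ((a *\<^sub>R x) d)"
      if "d \<in> charts M" "e \<in> charts M" "p \<in> fst d \<and> p \<in> fst e" for d e
      using tangentD(2)[OF x, of d e] that by (simp add: scaleR_fun_apply dmap_scale o_def)
  qed
qed

lemma coord_vec_add: "coord_vec M c p (u + v) = coord_vec M c p u + coord_vec M c p v"
  by (auto simp: coord_vec_def dmap_add fun_eq_iff)

lemma coord_vec_scale: "coord_vec M c p (a *\<^sub>R u) = a *\<^sub>R coord_vec M c p u"
  by (rule ext) (simp add: coord_vec_def scaleR_fun_apply dmap_scale)

lemma coord_vec_zero: "coord_vec M c p 0 = 0"
  by (auto simp: coord_vec_def dmap_zero fun_eq_iff)

definition unit_vec :: "nat \<Rightarrow> nat \<Rightarrow> real" where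
  "unit_vec i = (\<lambda>j. if j = i then 1 else 0)"

lemma unit_vec_Rn: "i < N \<Longrightarrow> unit_vec i \<in> Rn N"
  by (auto simp: unit_vec_def Rn_def)

lemma Rn_unit_vec_sum: "u \<in> Rn N \<Longrightarrow> u = (\<Sum>i<N. u i *\<^sub>R unit_vec i)"
  by (auto simp: fun_eq_iff sum_fun_apply scaleR_fun_def unit_vec_def Rn_def if_distrib[of "\<lambda>a. _ * a"] cong: if_cong)

lemma coord_vec_sum: "coord_vec M c p (\<Sum>i\<in>I. a i *\<^sub>R u i) = (\<Sum>i\<in>I. a i *\<^sub>R coord_vec M c p (u i))"
  by (induction I rule: infinite_finite_induct)
    (simp_all only: sum.insert sum.empty sum.infinite coord_vec_zero coord_vec_add coord_vec_scale not_False_eq_True)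

lemma tangent_basis:
  assumes M: "diff_atlas M" and p: "p \<in> points M"
  obtains B where "finite B" "independent B" "span B = tangent M p" "card B = mdim M"
proof -
  obtain c where c: "c \<in> charts M" "p \<in> fst c" using p by (auto simp: points_def)
  let ?N = "mdim M"
  define e where "e i = coord_vec M c p (unit_vec i)" for i
  have e: "e i \<in> tangent M p" "e i c = unit_vec i" if "i < ?N" for i
    unfolding e_def using coord_vec_tangent[OF M c unit_vec_Rn[OF that]] by auto
  have inj: "inj_on e {..<?N}"
  proof (rule inj_onI)
    fix i j assume "i \<in> {..<?N}" "j \<in> {..<?N}" "e i = e j"
    then have "unit_vec i = unit_vec j" using e(2) by (metis lessThan_iff)
    then show "i = j" by (metis unit_vec_def zero_neq_one)
  qed
  let ?B = "e ` {..<?N}"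
  have "independent ?B"
  proof (rule independent_if_scalars_zero)
    fix f v assume 0: "(\<Sum>x\<in>?B. f x *\<^sub>R x) = 0" and v: "v \<in> ?B"
    then obtain k where k: "v = e k" "k < ?N" by auto
    have "(\<Sum>i<?N. f (e i) *\<^sub>R e i) = 0" using 0 by (simp add: sum.reindex[OF inj])
    then have "(\<Sum>i<?N. f (e i) *\<^sub>R e i) c k = 0" by simp
    then have "(\<Sum>i<?N. f (e i) * (if k = i then 1 else 0)) = 0"
      using e(2) by (simp add: sum_fun_apply scaleR_fun_def unit_vec_def)
    then show "f v = 0" using k by (simp add: if_distrib[of "\<lambda>a. _ * a"] cong: if_cong)
  qed simp
  moreover have "span ?B = tangent M p"
  proof
    show "span ?B \<subseteq> tangent M p" using e by (intro span_minimal subspace_tangent) auto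
    show "tangent M p \<subseteq> span ?B"
    proof
      fix v assume v: "v \<in> tangent M p"
      have "v = coord_vec M c p (\<Sum>i<?N. v c i *\<^sub>R unit_vec i)"
        using coord_vec_of_tangent[OF M c v] Rn_unit_vec_sum[OF tangentD(1)[OF v c]] by simp
      also have "\<dots> = (\<Sum>i<?N. v c i *\<^sub>R e i)" unfolding coord_vec_sum e_def ..
      also have "\<dots> \<in> span ?B" by (intro span_sum span_scale span_base) auto
      finally show "v \<in> span ?B" .
    qed
  qed
  ultimately show thesis using inj by (intro that[of ?B]) (auto simp: card_image)
qed

lemma chart_at: "p \<in> points M \<Longrightarrow> chart_at M p \<in> charts M \<and> p \<in> fst (chart_at M p)"
  unfolding chart_at_def points_def by (rule someI_ex) auto

text \<open>
  The tangent map is defined through a chosen chart; the chain rule shows that every chart gives the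
  same result.
\<close>

lemma tangent_map_chart:
  assumes M: "diff_atlas M" and M': "diff_atlas M'" and f: "diff_at M M' f p" and v: "v \<in> tangent M p"
    and c: "c \<in> charts M" "p \<in> fst c" and d: "d \<in> charts M'" "f p \<in> fst d"
  shows "tangent_map M M' f p v d = dmap (mdim M) (\<lambda>x. snd d (f (cinv c x))) (snd c p) (v c)"
proof -
  have "p \<in> points M" using c by (auto simp: points_def)
  note c0 = chart_at[OF this]
  have "v c = dmap (mdim M) (\<lambda>x. snd c (cinv (chart_at M p) x)) (snd (chart_at M p) p) (v (chart_at M p))"
    using tangentD(2)[OF v] c0 c by blast
  then show ?thesis
    using diff_at_chain(2)[OF M M M' diff_atlas_id[OF M] f _ _ c d, of "chart_at M p" "v (chart_at M p)"] c0 d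
    by (simp add: tangent_map_def Let_def o_def)
qed

lemma tangent_map_in_tangent:
  assumes M: "diff_atlas M" and M': "diff_atlas M'" and f: "diff_at M M' f p" and v: "v \<in> tangent M p"
    and p: "p \<in> points M"
  shows "tangent_map M M' f p v \<in> tangent M' (f p)"
proof -
  obtain c where c: "c \<in> charts M" "p \<in> fst c" using p by (auto simp: points_def)
  note tm = tangent_map_chart[OF M M' f v c]
  have x: "snd c p \<in> Rn (mdim M)" by (rule diff_atlasD(3)[OF M c])
  show ?thesis
    unfolding tangent_def
  proof (intro CollectI conjI ballI impI allI)
    show "tangent_map M M' f p v d = 0" if "d \<notin> charts M' \<or> f p \<notin> fst d" for d
      using that by (auto simp: tangent_map_def Let_def)
    show "tangent_map M M' f p v d \<in> Rn (mdim M')" if d: "d \<in> charts M'" "f p \<in> fst d" for d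
      unfolding tm[OF d] by (rule dmap_in_Rn[OF x diff_atD(2)[OF M' M f c d]])
    fix d e assume de: "d \<in> charts M'" "e \<in> charts M'" "f p \<in> fst d \<and> f p \<in> fst e"
    then show "tangent_map M M' f p v e = dmap (mdim M') (snd e \<circ> cinv d) (snd d (f p)) (tangent_map M M' f p v d)"
      using tm[of d] tm[of e] diff_at_chain(2)[OF M M' M' f diff_atlas_id[OF M'] c, of d e] by (simp add: o_def)
  qed
qed

lemma tangent_map_add: "tangent_map M M' f p (u + v) = tangent_map M M' f p u + tangent_map M M' f p v"
  by (auto simp: tangent_map_def Let_def dmap_add fun_eq_iff)

lemma tangent_map_scale: "tangent_map M M' f p (a *\<^sub>R u) = a *\<^sub>R tangent_map M M' f p u"
  by (rule ext) (simp add: tangent_map_def Let_def scaleR_fun_apply dmap_scale)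

text \<open>
  The maps \<open>h\<close> and \<open>g \<circ> f\<close> are compared on the points of the manifold only, since a section and its
  projection compose to the identity there and nowhere else.
\<close>

lemma tangent_map_comp:
  assumes M: "diff_atlas M" and M': "diff_atlas M'" and M'': "diff_atlas M''"
    and f: "diff_at M M' f p" "f p \<in> points M'" and g: "diff_at M' M'' g (f p)"
    and h: "\<And>x. x \<in> points M \<Longrightarrow> h x = g (f x)" and p: "p \<in> points M" and v: "v \<in> tangent M p"
  shows "tangent_map M M'' h p v = tangent_map M' M'' g (f p) (tangent_map M M' f p v)"
proof
  fix e
  obtain d where d: "d \<in> charts M'" "f p \<in> fst d" using f(2) by (auto simp: points_def)
  let ?c = "chart_at M p"
  have c: "?c \<in> charts M" "p \<in> fst ?c" using chart_at[OF p] by auto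
  have x: "snd ?c p \<in> Rn (mdim M)" by (rule diff_atlasD(3)[OF M c])
  show "tangent_map M M'' h p v e = tangent_map M' M'' g (f p) (tangent_map M M' f p v) e"
  proof (cases "e \<in> charts M'' \<and> g (f p) \<in> fst e")
    case True
    note ch = diff_at_chain[OF M M' M'' f(1) g c d, of e]
    have ev: "\<forall>\<^sub>F x in nbh (mdim M) (snd ?c p). snd e (g (f (cinv ?c x))) j = snd e (h (cinv ?c x)) j" for j
      using diff_atlasD(5)[OF M c]
    proof eventually_elim
      case (elim x)
      then have "cinv ?c x \<in> points M" using chart_cinv[OF elim] c by (auto simp: points_def)
      then show ?case using h by simp
    qed
    have "dmap (mdim M) (\<lambda>x. snd e (h (cinv ?c x))) (snd ?c p) (v ?c) = dmap (mdim M) (\<lambda>x. snd e (g (f (cinv ?c x)))) (snd ?c p) (v ?c)"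
      unfolding dmap_def using dir_deriv_cong[OF ch(1) ev x] True by (auto simp: fun_eq_iff)
    also have "\<dots> = dmap (mdim M') (\<lambda>y. snd e (g (cinv d y))) (snd d (f p)) (tangent_map M M' f p v d)"
      using ch(2) True tangent_map_chart[OF M M' f(1) v c d] by simp
    also have "\<dots> = tangent_map M' M'' g (f p) (tangent_map M M' f p v) e"
      using tangent_map_chart[OF M' M'' g tangent_map_in_tangent[OF M M' f(1) v p] d] True by simp
    finally show ?thesis using True h[OF p] by (simp add: tangent_map_def Let_def o_def)
  next
    case False
    then show ?thesis using h[OF p] by (auto simp: tangent_map_def Let_def)
  qed
qed

lemma tangent_map_ident:
  assumes M: "diff_atlas M" and h: "\<And>x. x \<in> points M \<Longrightarrow> h x = x" and p: "p \<in> points M" and v: "v \<in> tangent M p"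
  shows "tangent_map M M h p v = v"
proof -
  obtain c where c: "c \<in> charts M" "p \<in> fst c" using p by (auto simp: points_def)
  have I: "tangent_map M M (\<lambda>x. x) p v = v"
  proof (rule tangent_eqI[OF _ v c])
    show "tangent_map M M (\<lambda>x. x) p v \<in> tangent M p"
      using tangent_map_in_tangent[OF M M diff_atlas_id[OF M] v p] by simp
    show "tangent_map M M (\<lambda>x. x) p v c = v c"
      using tangent_map_chart[OF M M diff_atlas_id[OF M] v c c] tangentD(2)[OF v c c] by simp
  qed
  show ?thesis
    using tangent_map_comp[OF M M M diff_atlas_id[OF M] p diff_atlas_id[OF M], of h v] h p v I by simp
qed

section \<open>Smooth manifolds and smooth maps\<close>

lemma smooth_on_tdiff: "open_Rn N W \<Longrightarrow> smooth_on N W f \<Longrightarrow> x \<in> W \<Longrightarrow> tdiff N f x"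
  unfolding smooth_on_def by (rule Ck_on_imp_tdiff[of N W 0]) (simp_all only:)

lemma smooth_map_c1_at:
  assumes inj: "\<And>c. c \<in> charts M \<Longrightarrow> inj_on (snd c) (fst c)" and f: "smooth_map M M' f"
  shows "diff_at M M' f p"
  unfolding diff_at_def
proof (intro ballI impI conjI allI)
  fix c d assume c: "c \<in> charts M" "p \<in> fst c" and d: "d \<in> charts M'" "f p \<in> fst d"
  let ?W = "snd c ` {p \<in> fst c. f p \<in> fst d}"
  have o: "open_Rn (mdim M) ?W" and s: "\<And>j. j < mdim M' \<Longrightarrow> smooth_on (mdim M) ?W (\<lambda>x. snd d (f (cinv c x)) j)"
    using f c d by (auto simp: smooth_map_def)
  have x: "snd c p \<in> ?W" using c d by auto
  show "tdiff (mdim M) (\<lambda>x. snd d (f (cinv c x)) j) (snd c p)" if "j < mdim M'" for j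
    by (rule smooth_on_tdiff[OF o s[OF that] x])
  show "\<forall>\<^sub>F x in nbh (mdim M) (snd c p). f (cinv c x) \<in> fst d"
    using open_Rn_imp_eventually[OF o x] by eventually_elim (auto simp: cinv_chart[OF inj[OF c(1)]])
qed

lemma smooth_atlas_imp_smooth_map_id: "smooth_atlas M \<Longrightarrow> smooth_map M M (\<lambda>x. x)"
  unfolding smooth_atlas_def smooth_map_def Int_def by blast

lemma smooth_atlas_imp_c1_atlas:
  assumes "smooth_atlas M" shows "diff_atlas M"
proof -
  have inj: "inj_on (snd c) (fst c)" if "c \<in> charts M" for c using assms that by (auto simp: smooth_atlas_def)
  have o: "open_Rn (mdim M) (snd c ` fst c)" if "c \<in> charts M" for c

  proof -
    have "open_Rn (mdim M) (snd c ` (fst c \<inter> fst c))" using assms that unfolding smooth_atlas_def by blast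
    then show ?thesis by simp
  qed
  show ?thesis
    unfolding diff_atlas_def
  proof (intro conjI ballI allI)
    show "diff_at M M (\<lambda>x. x) p" for p
      by (rule smooth_map_c1_at[OF inj smooth_atlas_imp_smooth_map_id[OF assms]])
    fix c assume c: "c \<in> charts M"
    show "inj_on (snd c) (fst c)" by (rule inj[OF c])
    show "snd c ` fst c \<subseteq> Rn (mdim M)" by (rule open_Rn_subset[OF o[OF c]])
    show "\<forall>\<^sub>F x in nbh (mdim M) (snd c p). x \<in> snd c ` fst c" if "p \<in> fst c" for p
      using that by (intro open_Rn_imp_eventually[OF o[OF c]]) blast
  qed
qed

section \<open>Curves\<close>

definition interval_chart :: "real \<Rightarrow> real chart" where
  "interval_chart \<epsilon> = ({-\<epsilon><..<\<epsilon>}, \<lambda>t i. if i = 0 then t else 0)"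

lemma interval_mfd:
  "mdim (open_interval_mfd \<epsilon>) = 1" "charts (open_interval_mfd \<epsilon>) = {interval_chart \<epsilon>}"
  "points (open_interval_mfd \<epsilon>) = {-\<epsilon><..<\<epsilon>}"
  by (auto simp: open_interval_mfd_def interval_chart_def points_def)

lemma interval_chart_inj: "inj_on (snd (interval_chart \<epsilon>)) (fst (interval_chart \<epsilon>))"
  by (rule inj_onI) (auto simp: interval_chart_def dest: fun_cong[of _ _ 0])

lemma interval_chart_image:
  "snd (interval_chart \<epsilon>) ` {t \<in> {-\<epsilon><..<\<epsilon>}. P t} = {z \<in> Rn 1. \<bar>z 0\<bar> < \<epsilon> \<and> P (z 0)}"
proof -
  have "z = snd (interval_chart \<epsilon>) (z 0)" if "z \<in> Rn 1" for z
    using that by (auto simp: Rn_def interval_chart_def fun_eq_iff)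
  then show ?thesis by (auto simp: interval_chart_def Rn_def image_iff abs_less_iff) (metis minus_less_iff)+
qed

lemma cinv_interval_chart: "z \<in> Rn 1 \<Longrightarrow> \<bar>z 0\<bar> < \<epsilon> \<Longrightarrow> cinv (interval_chart \<epsilon>) z = z 0"
proof -
  assume z: "z \<in> Rn 1" "\<bar>z 0\<bar> < \<epsilon>"
  have "z = snd (interval_chart \<epsilon>) (z 0)" using z by (auto simp: Rn_def interval_chart_def fun_eq_iff)
  moreover have "z 0 \<in> fst (interval_chart \<epsilon>)" using z by (auto simp: interval_chart_def)
  ultimately show ?thesis using cinv_chart[OF interval_chart_inj, of "z 0" \<epsilon>] by simp
qed

lemma eventually_small_coord:
  assumes "z \<in> Rn N" "\<bar>z i\<bar> < \<epsilon>" shows "\<forall>\<^sub>F y in nbh N z. \<bar>y i\<bar> < (\<epsilon>::real)"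
  using order_tendstoD(2)[OF tendsto_rabs[OF tendsto_coord_nbh[where i = i and x = z and N = N]] assms(2)] .

lemma diff_atlas_interval: "diff_atlas (open_interval_mfd \<epsilon>)"
proof -
  let ?c = "interval_chart \<epsilon>"
  have "fst ?c = {t \<in> {-\<epsilon><..<\<epsilon>}. True}" by (auto simp: interval_chart_def)
  then have im: "snd ?c ` fst ?c = {z \<in> Rn 1. \<bar>z 0\<bar> < \<epsilon>}"
    using interval_chart_image[of \<epsilon> "\<lambda>_. True"] by (simp del: One_nat_def)
  have ev: "\<forall>\<^sub>F z in nbh 1 (snd ?c t). z \<in> Rn 1 \<and> \<bar>z 0\<bar> < \<epsilon>" if "t \<in> fst ?c" for t
  proof -
    have "snd ?c t \<in> {z \<in> Rn 1. \<bar>z 0\<bar> < \<epsilon>}" using that im by blast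
    then show ?thesis using eventually_nbh_Rn[of 1 "snd ?c t"] by (intro eventually_conj eventually_small_coord) auto
  qed
  have "diff_at (open_interval_mfd \<epsilon>) (open_interval_mfd \<epsilon>) (\<lambda>x. x) t" for t
    unfolding diff_at_def interval_mfd
  proof (intro ballI impI conjI allI)
    fix c d and j :: nat assume cd: "c \<in> {?c}" "d \<in> {?c}" "t \<in> fst c"
    then have t: "t \<in> fst ?c" and eq: "c = ?c" "d = ?c" by auto
    have R: "snd ?c t \<in> Rn 1" using im t by blast
    show "\<forall>\<^sub>F x in nbh 1 (snd c t). cinv c x \<in> fst d"
      unfolding eq using ev[OF t] by eventually_elim (simp add: cinv_interval_chart, auto simp: interval_chart_def)
    have e: "\<forall>\<^sub>F x in nbh 1 (snd ?c t). x 0 = snd ?c (cinv ?c x) 0"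
      using ev[OF t] by eventually_elim (simp add: cinv_interval_chart, simp add: interval_chart_def)
    assume "j < 1"
    then show "tdiff 1 (\<lambda>x. snd d (cinv c x) j) (snd c t)"
      unfolding eq using tdiff_cong[OF tdiff_coord[of 0 1, OF _ R] e R] by simp
  qed
  then show ?thesis unfolding diff_atlas_def interval_mfd using interval_chart_inj ev by (auto simp: im)
qed

lemma line_in_Rn: "x \<in> Rn N \<Longrightarrow> u \<in> Rn N \<Longrightarrow> (\<lambda>i. x i + t * u i) \<in> Rn N"
  by (auto simp: Rn_def)

text \<open>
  The curve is the image under \<open>s\<close> of a coordinate line through \<open>p\<close>; for \<open>s\<close> the identity it is the
  line itself.
\<close>

lemma smooth_curve_along_chart_line:
  assumes Y: "smooth_atlas Y" and s: "smooth_map Y D s" and c: "c \<in> charts Y" "p \<in> fst c" and u: "u \<in> Rn (mdim Y)"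
    and \<epsilon>: "\<And>t. \<bar>t\<bar> < \<epsilon> \<Longrightarrow> (\<lambda>i. snd c p i + t * u i) \<in> snd c ` fst c"
  shows "smooth_map (open_interval_mfd \<epsilon>) D (\<lambda>t. s (cinv c (\<lambda>i. snd c p i + t * u i)))"
proof -
  let ?l = "\<lambda>t i. snd c p i + t * u i"
  have M: "diff_atlas Y" by (rule smooth_atlas_imp_c1_atlas[OF Y])
  have x: "snd c p \<in> Rn (mdim Y)" by (rule diff_atlasD(3)[OF M c])
  have pts: "s (cinv c (?l t)) \<in> points D" if "t \<in> {-\<epsilon><..<\<epsilon>}" for t
  proof -
    have "cinv c (?l t) \<in> fst c" using chart_cinv[OF \<epsilon>[of t]] that by auto
    then have "cinv c (?l t) \<in> points Y" by (rule diff_atlasD(6)[OF M c(1)])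
    then show ?thesis using s by (auto simp: smooth_map_def)
  qed
  have "open_Rn 1 W' \<and> (\<forall>j<mdim D. smooth_on 1 W' (\<lambda>z. snd d (s (cinv c (?l (cinv (interval_chart \<epsilon>) z)))) j))"
    if d: "d \<in> charts D" and W': "W' = {z \<in> Rn 1. \<bar>z 0\<bar> < \<epsilon> \<and> s (cinv c (?l (z 0))) \<in> fst d}" for d W'
  proof -
    let ?V = "snd c ` {p \<in> fst c. s p \<in> fst d}"
    have V: "open_Rn (mdim Y) ?V" and sm: "\<And>j. j < mdim D \<Longrightarrow> smooth_on (mdim Y) ?V (\<lambda>x. snd d (s (cinv c x)) j)"
      using s c d by (auto simp: smooth_map_def)
    have iff: "s (cinv c (?l t)) \<in> fst d \<longleftrightarrow> ?l t \<in> ?V" if "\<bar>t\<bar> < \<epsilon>" for t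
    proof -
      have 1: "snd c (cinv c (?l t)) = ?l t \<and> cinv c (?l t) \<in> fst c" by (rule chart_cinv[OF \<epsilon>[OF that]])
      show ?thesis
      proof
        assume "s (cinv c (?l t)) \<in> fst d"
        then show "?l t \<in> ?V" using 1 by (intro image_eqI[of _ _ "cinv c (?l t)"]) auto
      next
        assume "?l t \<in> ?V"
        then obtain q where q: "?l t = snd c q" "q \<in> fst c" "s q \<in> fst d" by blast
        then show "s (cinv c (?l t)) \<in> fst d" using diff_atlasD(4)[OF M c(1)] by metis
      qed
    qed
    have o: "open_Rn 1 W'"
    proof (rule open_RnI)
      show "W' \<subseteq> Rn 1" by (auto simp: W')
      fix z assume z: "z \<in> W'"
      then have zR: "z \<in> Rn 1" "\<bar>z 0\<bar> < \<epsilon>" "?l (z 0) \<in> ?V" using iff by (auto simp: W')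
      have "filterlim (\<lambda>y. ?l (y 0)) (nbh (mdim Y) (?l (z 0))) (nbh 1 z)"
        by (rule filterlim_nbh) (auto intro!: tendsto_intros tendsto_coord_nbh line_in_Rn x u always_eventually)
      then have "\<forall>\<^sub>F y in nbh 1 z. ?l (y 0) \<in> ?V"
        using open_Rn_imp_eventually[OF V zR(3)] by (auto simp: filterlim_iff)
      then show "\<forall>\<^sub>F y in nbh 1 z. y \<in> W'"
        using eventually_small_coord[OF zR(1,2)] eventually_nbh_Rn[of 1 z]
        by eventually_elim (use iff W' in blast)
    qed
    have "smooth_on 1 W' (\<lambda>z. snd d (s (cinv c (?l (cinv (interval_chart \<epsilon>) z)))) j)" if j: "j < mdim D" for j
      unfolding smooth_on_def
    proof
      fix r
      have "Ck_on 1 r W' (\<lambda>z. snd d (s (cinv c (?l (z 0)))) j)"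
        using sm[OF j] iff unfolding smooth_on_def
        by (intro Ck_on_line[OF V x u o, where f = "\<lambda>x. snd d (s (cinv c x)) j"]) (auto simp: W')
      then show "Ck_on 1 r W' (\<lambda>z. snd d (s (cinv c (?l (cinv (interval_chart \<epsilon>) z)))) j)"
        by (rule Ck_on_cong[OF o, rotated]) (auto simp: W' cinv_interval_chart)
    qed
    with o show ?thesis by blast
  qed
  note key = this
  have "fst (interval_chart \<epsilon>) = {-\<epsilon><..<\<epsilon>}" by (simp add: interval_chart_def)
  then have im: "snd (interval_chart \<epsilon>) ` {t \<in> fst (interval_chart \<epsilon>). s (cinv c (?l t)) \<in> fst d} =
      {z \<in> Rn 1. \<bar>z 0\<bar> < \<epsilon> \<and> s (cinv c (?l (z 0))) \<in> fst d}" for d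
    by (simp only: interval_chart_image)
  show ?thesis
    unfolding smooth_map_def interval_mfd
  proof (intro conjI ballI)
    show "(\<lambda>t. s (cinv c (?l t))) ` {-\<epsilon><..<\<epsilon>} \<subseteq> points D" using pts by blast
    fix ci d assume "ci \<in> {interval_chart \<epsilon>}" and d: "d \<in> charts D"
    then have ci: "ci = interval_chart \<epsilon>" by simp
    show "open_Rn 1 (snd ci ` {t \<in> fst ci. s (cinv c (?l t)) \<in> fst d})"
      unfolding ci im using key[OF d refl] by blast
    show "\<forall>j<mdim D. smooth_on 1 (snd ci ` {t \<in> fst ci. s (cinv c (?l t)) \<in> fst d})
        (\<lambda>x. snd d (s (cinv c (?l (cinv ci x)))) j)"
      unfolding ci im using key[OF d refl] by blast
  qed
qed

text \<open>
  Every tangent vector is the velocity of a curve that stays smooth after any smooth map \<open>s\<close>.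
\<close>

lemma velocity_of_chart_line:
  assumes Y: "smooth_atlas Y" and p: "p \<in> points Y" and v: "v \<in> tangent Y p"
  obtains \<epsilon> \<eta> w where "\<epsilon> > 0" "\<eta> 0 = p" "w \<in> tangent (open_interval_mfd \<epsilon>) 0"
    "tangent_map (open_interval_mfd \<epsilon>) Y \<eta> 0 w = v" "diff_at (open_interval_mfd \<epsilon>) Y \<eta> 0"
    "\<And>t. t \<in> {-\<epsilon><..<\<epsilon>} \<Longrightarrow> \<eta> t \<in> points Y"
    "\<And>D (s :: 'a \<Rightarrow> 'b). smooth_map Y D s \<Longrightarrow> smooth_map (open_interval_mfd \<epsilon>) D (\<lambda>t. s (\<eta> t))"
proof -
  have M: "diff_atlas Y" by (rule smooth_atlas_imp_c1_atlas[OF Y])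
  let ?N = "mdim Y"
  obtain c where c: "c \<in> charts Y" "p \<in> fst c" using p by (auto simp: points_def)
  have x: "snd c p \<in> Rn ?N" by (rule diff_atlasD(3)[OF M c])
  define u where "u = v c"
  have u: "u \<in> Rn ?N" unfolding u_def by (rule tangentD(1)[OF v c])
  obtain \<delta> where \<delta>: "\<delta> > 0" "\<And>y. y \<in> Rn ?N \<Longrightarrow> (\<forall>i<?N. \<bar>y i - snd c p i\<bar> < \<delta>) \<Longrightarrow> y \<in> snd c ` fst c"
    by (rule eventually_nbhE[OF diff_atlasD(5)[OF M c] x]) (rule that)
  \<comment> \<open>The summand \<open>1\<close> keeps \<open>K\<close> positive when \<open>v = 0\<close>.\<close>
  define K where "K = 1 + (\<Sum>i<?N. \<bar>u i\<bar>)"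
  define \<epsilon> where "\<epsilon> = \<delta> / K"
  have K: "K > 0" unfolding K_def by (intro add_pos_nonneg sum_nonneg) auto
  have \<epsilon>: "\<epsilon> > 0" using \<delta> K by (simp add: \<epsilon>_def)
  let ?l = "\<lambda>t i. snd c p i + t * u i"
  have l: "?l t \<in> snd c ` fst c" if t: "\<bar>t\<bar> < \<epsilon>" for t
  proof (rule \<delta>(2)[OF line_in_Rn[OF x u]], intro allI impI)
    fix i assume i: "i < ?N"
    have "\<bar>u i\<bar> \<le> (\<Sum>i<?N. \<bar>u i\<bar>)" using i by (intro member_le_sum) auto
    then have "\<bar>u i\<bar> \<le> K" by (simp add: K_def)
    then have "\<bar>t * u i\<bar> \<le> \<bar>t\<bar> * K" by (simp add: abs_mult mult_left_mono)
    also have "\<dots> < \<delta>" using t K by (simp add: \<epsilon>_def field_simps)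
    finally show "\<bar>snd c p i + t * u i - snd c p i\<bar> < \<delta>" by simp
  qed
  define \<eta> where "\<eta> t = cinv c (?l t)" for t
  let ?I = "open_interval_mfd \<epsilon>"
  let ?ci = "interval_chart \<epsilon>"
  have I: "diff_atlas ?I" by (rule diff_atlas_interval)
  have ci: "?ci \<in> charts ?I" "0 \<in> fst ?ci" using \<epsilon> by (auto simp: interval_mfd) (auto simp: interval_chart_def)
  have sm: "smooth_map ?I D (\<lambda>t. s (\<eta> t))" if "smooth_map Y D s" for D and s :: "'a \<Rightarrow> 'c"
    unfolding \<eta>_def by (rule smooth_curve_along_chart_line[OF Y that c u l])
  have \<eta>0: "\<eta> 0 = p" unfolding \<eta>_def using diff_atlasD(4)[OF M c] by simp
  have \<eta>c: "diff_at ?I Y \<eta> 0"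
    using sm[OF smooth_atlas_imp_smooth_map_id[OF Y]] by (intro smooth_map_c1_at) (auto simp: interval_mfd interval_chart_inj)
  define w where "w = coord_vec ?I ?ci 0 (unit_vec 0)"
  have w: "w \<in> tangent ?I 0" "w ?ci = unit_vec 0"
    unfolding w_def using coord_vec_tangent[OF I ci] by (auto simp: interval_mfd unit_vec_Rn)
  have z0: "snd ?ci 0 \<in> Rn 1" "\<bar>snd ?ci 0 0\<bar> < \<epsilon>" using \<epsilon> by (auto simp: interval_chart_def Rn_def)
  have "tangent_map ?I Y \<eta> 0 w c = v c"
  proof
    fix j
    have ev: "\<forall>\<^sub>F z in nbh 1 (snd ?ci 0). snd c p j + z 0 * u j = snd c (\<eta> (cinv ?ci z)) j"
      using eventually_small_coord[OF z0] eventually_nbh_Rn[of 1 "snd ?ci 0"]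
    proof eventually_elim
      case (elim z)
      then show ?case using chart_cinv[OF l[OF elim(1)]] by (simp add: cinv_interval_chart \<eta>_def)
    qed
    have "has_pds 1 (\<lambda>z. snd c p j + z 0 * u j) (snd ?ci 0) (\<lambda>i. 0 + ((if i = 0 then 1 else 0) * u j + snd ?ci 0 0 * 0))"
      by (intro has_pds_add has_pds_mult has_pds_const has_pds_coord) auto
    from has_pds_cong[OF this ev z0(1)]
    have "dir_deriv 1 (\<lambda>z. snd c (\<eta> (cinv ?ci z)) j) (snd ?ci 0) (unit_vec 0) = u j"
      using has_pds_dir_deriv[OF _ z0(1)] by (fastforce simp: unit_vec_def)
    then show "tangent_map ?I Y \<eta> 0 w c j = v c j"
      using tangent_map_chart[OF I M \<eta>c w(1) ci c(1)] \<eta>0 c(2) w(2) by (simp add: dmap_def interval_mfd u_def)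
  qed
  moreover have "tangent_map ?I Y \<eta> 0 w \<in> tangent Y p"
    using tangent_map_in_tangent[OF I M \<eta>c w(1)] \<eta>0 \<epsilon> by (simp add: interval_mfd)
  ultimately have "tangent_map ?I Y \<eta> 0 w = v" using tangent_eqI[OF _ v c] by blast
  moreover have "\<eta> t \<in> points Y" if "t \<in> {-\<epsilon><..<\<epsilon>}" for t
    unfolding \<eta>_def using chart_cinv[OF l[of t]] that diff_atlasD(6)[OF M c(1)] by (simp add: abs_less_iff)
  ultimately show thesis using that[OF \<epsilon> \<eta>0 w(1) _ \<eta>c _ sm] by blast
qed

text \<open>
  The tangent space of the image of a section is the image of the tangent map.  A curve \<open>\<gamma>\<close> in the
  image satisfies \<open>\<gamma> = s \<circ> \<pi> \<circ> \<gamma>\<close>, so its velocity is the image of the velocity of \<open>\<pi> \<circ> \<gamma>\<close>;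
  conversely \<open>s\<close> maps a curve in the base with velocity \<open>v\<close> to a curve in the image.
\<close>

lemma sub_tangent_section_image:
  assumes Y: "smooth_atlas Y" and D: "diff_atlas D" and s: "smooth_map Y D s"
    and \<pi>: "diff_at D Y \<pi> (s p)" "\<And>p. p \<in> points Y \<Longrightarrow> \<pi> (s p) = p" and p: "p \<in> points Y"
  shows "sub_tangent D (s ` points Y) (s p) = tangent_map Y D s p ` tangent Y p"
proof
  have M: "diff_atlas Y" by (rule smooth_atlas_imp_c1_atlas[OF Y])
  have inj: "\<And>c. c \<in> charts Y \<Longrightarrow> inj_on (snd c) (fst c)" using diff_atlasD(1)[OF M] .
  have sc: "diff_at Y D s q" for q by (rule smooth_map_c1_at[OF inj s])
  have sp: "s q \<in> points D" if "q \<in> points Y" for q using s that by (auto simp: smooth_map_def)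
  show "sub_tangent D (s ` points Y) (s p) \<subseteq> tangent_map Y D s p ` tangent Y p"
  proof
    fix a assume "a \<in> sub_tangent D (s ` points Y) (s p)"
    then obtain \<epsilon> \<gamma> w where a: "a = tangent_map (open_interval_mfd \<epsilon>) D \<gamma> 0 w" "\<epsilon> > 0"
      "smooth_map (open_interval_mfd \<epsilon>) D \<gamma>" "\<gamma> ` {-\<epsilon><..<\<epsilon>} \<subseteq> s ` points Y" "\<gamma> 0 = s p"
      "w \<in> tangent (open_interval_mfd \<epsilon>) 0"
      unfolding sub_tangent_def by blast
    let ?I = "open_interval_mfd \<epsilon>"
    have I: "diff_atlas ?I" by (rule diff_atlas_interval)
    have \<gamma>: "diff_at ?I D \<gamma> 0" by (rule smooth_map_c1_at[OF _ a(3)]) (simp add: interval_mfd interval_chart_inj)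
    have 0: "0 \<in> points ?I" using a(2) by (simp add: interval_mfd)
    have c: "diff_at ?I Y (\<lambda>t. \<pi> (\<gamma> t)) 0"
      using \<pi>(1) sp[OF p] by (intro diff_at_compose[OF I D M \<gamma>]) (simp_all add: a(5))
    have "a = tangent_map Y D s (\<pi> (\<gamma> 0)) (tangent_map ?I Y (\<lambda>t. \<pi> (\<gamma> t)) 0 w)"
      unfolding a(1)
    proof (rule tangent_map_comp[OF I M D c _ sc _ 0 a(6)])
      show "\<pi> (\<gamma> 0) \<in> points Y" using \<pi>(2) p a(5) by simp
      fix t assume "t \<in> points ?I"
      then have "\<gamma> t \<in> s ` points Y" using a(4) by (auto simp: interval_mfd)
      then obtain q where "\<gamma> t = s q" "q \<in> points Y" by blast
      then show "\<gamma> t = s (\<pi> (\<gamma> t))" using \<pi>(2) by simp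
    qed
    moreover have "tangent_map ?I Y (\<lambda>t. \<pi> (\<gamma> t)) 0 w \<in> tangent Y p"
      using tangent_map_in_tangent[OF I M c a(6) 0] \<pi>(2)[OF p] a(5) by simp
    ultimately show "a \<in> tangent_map Y D s p ` tangent Y p" using \<pi>(2)[OF p] a(5) by auto
  qed
  show "tangent_map Y D s p ` tangent Y p \<subseteq> sub_tangent D (s ` points Y) (s p)"
  proof
    fix a assume "a \<in> tangent_map Y D s p ` tangent Y p"
    then obtain v where v: "v \<in> tangent Y p" "a = tangent_map Y D s p v" by blast
    obtain \<epsilon> \<eta> w where \<eta>: "\<epsilon> > 0" "\<eta> 0 = p" "w \<in> tangent (open_interval_mfd \<epsilon>) 0"
      "tangent_map (open_interval_mfd \<epsilon>) Y \<eta> 0 w = v" "diff_at (open_interval_mfd \<epsilon>) Y \<eta> 0"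
      "\<And>t. t \<in> {-\<epsilon><..<\<epsilon>} \<Longrightarrow> \<eta> t \<in> points Y"
      "smooth_map (open_interval_mfd \<epsilon>) D (\<lambda>t. s (\<eta> t))"
      using velocity_of_chart_line[OF Y p v(1)] s by metis
    let ?I = "open_interval_mfd \<epsilon>"
    have "a = tangent_map ?I D (\<lambda>t. s (\<eta> t)) 0 w"
      using tangent_map_comp[OF diff_atlas_interval M D \<eta>(5) _ sc refl _ \<eta>(3)] p \<eta>(1,2,4) v(2) by (simp add: interval_mfd)
    then show "a \<in> sub_tangent D (s ` points Y) (s p)"
      unfolding sub_tangent_def using \<eta> by blast
  qed
qed

section \<open>Local frames\<close>

text \<open>
  Independence of a family, rather than of the set of its members: repetitions count as dependence,
  as for frames.
\<close>

definition indep_family :: "nat \<Rightarrow> (nat \<Rightarrow> 'v::real_vector) \<Rightarrow> bool" where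
  "indep_family M v \<longleftrightarrow> (\<forall>t. (\<Sum>a<M. t a *\<^sub>R v a) = 0 \<longrightarrow> (\<forall>a<M. t a = 0))"

lemma indep_familyD: "indep_family M v \<Longrightarrow> (\<Sum>a<M. t a *\<^sub>R v a) = 0 \<Longrightarrow> a < M \<Longrightarrow> t a = 0"
  by (simp add: indep_family_def)

lemma indep_family_of_independent:
  assumes "inj_on v {..<M}" "independent (v ` {..<M})"
  shows "indep_family M v"
  unfolding indep_family_def
proof (intro allI impI)
  fix t a assume t: "(\<Sum>a<M. t a *\<^sub>R v a) = 0" and "a < M"
  define u where "u x = t (the_inv_into {..<M} v x)" for x
  have u: "u (v a) = t a" if "a < M" for a
    unfolding u_def using the_inv_into_f_f[OF assms(1)] that by simp
  have "(\<Sum>x\<in>v ` {..<M}. u x *\<^sub>R x) = (\<Sum>a<M. t a *\<^sub>R v a)"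
    unfolding sum.reindex[OF assms(1)] using u by simp
  then have "(\<Sum>x\<in>v ` {..<M}. u x *\<^sub>R x) = 0" using t by simp
  moreover have "\<forall>S\<subseteq>v ` {..<M}. finite S \<longrightarrow> (\<forall>u. (\<Sum>x\<in>S. u x *\<^sub>R x) = 0 \<longrightarrow> (\<forall>x\<in>S. u x = 0))"
    using assms(2) independent_explicit_finite_subsets[of "v ` {..<M}"] by blast
  ultimately have "\<forall>x\<in>v ` {..<M}. u x = 0" by blast
  then show "t a = 0" using u[OF \<open>a < M\<close>] \<open>a < M\<close> by auto
qed

lemma indep_family_imp_independent:
  assumes "indep_family M v"
  shows "inj_on v {..<M}" "independent (v ` {..<M})"
proof -
  show inj: "inj_on v {..<M}"
  proof (rule inj_onI)
    fix a b assume ab: "a \<in> {..<M}" "b \<in> {..<M}" "v a = v b"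
    show "a = b"
    proof (rule ccontr)
      assume ne: "a \<noteq> b"
      define t :: "nat \<Rightarrow> real" where "t i = (if i = a then 1 else if i = b then -1 else 0)" for i
      have "(\<Sum>i<M. t i *\<^sub>R v i) = (\<Sum>i\<in>{a, b}. t i *\<^sub>R v i)"
        using ab by (intro sum.mono_neutral_right) (auto simp: t_def)
      also have "\<dots> = 0" using ne ab by (simp add: t_def)
      finally have "t a = 0" using ab indep_familyD[OF assms, of t a] by simp
      then show False by (simp add: t_def)
    qed
  qed
  show "independent (v ` {..<M})"
  proof (rule independent_if_scalars_zero)
    fix f x assume 0: "(\<Sum>x\<in>v ` {..<M}. f x *\<^sub>R x) = 0" and x: "x \<in> v ` {..<M}"
    then obtain a where a: "x = v a" "a < M" by auto
    have "(\<Sum>a<M. f (v a) *\<^sub>R v a) = 0" using 0 by (simp add: sum.reindex[OF inj])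
    then show "f x = 0" using indep_familyD[OF assms, of "\<lambda>a. f (v a)"] a by simp
  qed simp
qed

lemma span_family:
  assumes "x \<in> span (v ` {..<M})" "inj_on v {..<(M::nat)}"
  shows "\<exists>t. x = (\<Sum>a<M. t a *\<^sub>R v a)"
proof -
  obtain u where "x = (\<Sum>y\<in>v ` {..<M}. u y *\<^sub>R y)" using assms(1) by (auto simp: span_finite)
  then show ?thesis using assms(2) by (auto simp: sum.reindex intro!: exI[of _ "\<lambda>a. u (v a)"])
qed

lemma local_frameD:
  assumes "local_frame M V m W e"
  shows "open_in_mfd M W" "\<And>j. j < m \<Longrightarrow> smooth_vector_field_on M W (e j)"
    "\<And>p. p \<in> W \<Longrightarrow> indep_family m (\<lambda>a. e a p)"
    "\<And>p x. p \<in> W \<Longrightarrow> x \<in> V p \<Longrightarrow> \<exists>t. x = (\<Sum>a<m. t a *\<^sub>R e a p)"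
    "\<And>p a. p \<in> W \<Longrightarrow> a < m \<Longrightarrow> e a p \<in> V p" "\<And>p. p \<in> W \<Longrightarrow> subspace (V p)"
    "\<And>p a. p \<in> W \<Longrightarrow> a < m \<Longrightarrow> e a p \<in> tangent M p"
    "\<And>p. p \<in> W \<Longrightarrow> p \<in> points M"
    "\<And>p. p \<in> W \<Longrightarrow> inj_on (\<lambda>j. e j p) {..<m} \<and> independent ((\<lambda>j. e j p) ` {..<m}) \<and> span ((\<lambda>j. e j p) ` {..<m}) = V p"
proof -
  note l = assms[unfolded local_frame_def]
  note l1 = l[THEN conjunct1] and l2 = l[THEN conjunct2, THEN conjunct1] and l3 = l[THEN conjunct2, THEN conjunct2]
  show "open_in_mfd M W" by (rule l1)
  show "\<And>j. j < m \<Longrightarrow> smooth_vector_field_on M W (e j)" using l2 by blast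
  have f: "inj_on (\<lambda>j. e j p) {..<m}" "independent ((\<lambda>j. e j p) ` {..<m})" "span ((\<lambda>j. e j p) ` {..<m}) = V p"
    if "p \<in> W" for p
    using l3[rule_format, OF that] by blast+
  show "\<And>p. p \<in> W \<Longrightarrow> indep_family m (\<lambda>a. e a p)" by (rule indep_family_of_independent[OF f(1,2)])
  show "\<exists>t. x = (\<Sum>a<m. t a *\<^sub>R e a p)" if "p \<in> W" "x \<in> V p" for p x
    using span_family[OF _ f(1)[OF that(1)], of x] that(2) f(3)[OF that(1)] by simp
  show "e a p \<in> V p" if "p \<in> W" "a < m" for p a
  proof -
    have "e a p \<in> (\<lambda>j. e j p) ` {..<m}" using that(2) by simp
    from span_base[OF this] show ?thesis unfolding f(3)[OF that(1)] .
  qed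
  show "\<And>p. p \<in> W \<Longrightarrow> subspace (V p)" using f(3) subspace_span by metis
  show "\<And>p a. p \<in> W \<Longrightarrow> a < m \<Longrightarrow> e a p \<in> tangent M p"
    using l2 unfolding smooth_vector_field_on_def by blast
  show "\<And>p. p \<in> W \<Longrightarrow> p \<in> points M" using l1 unfolding open_in_mfd_def by blast
  show "\<And>p. p \<in> W \<Longrightarrow> inj_on (\<lambda>j. e j p) {..<m} \<and> independent ((\<lambda>j. e j p) ` {..<m}) \<and> span ((\<lambda>j. e j p) ` {..<m}) = V p"
    using f by blast
qed

lemma dual_functionals:
  assumes v: "\<And>a. a < M \<Longrightarrow> v a \<in> Rn N"
    and ind: "indep_family M v"
  shows "\<exists>D. \<forall>a<M. \<forall>b<M. (\<Sum>i<N. D a i * v b i) = (if a = b then 1 else 0 :: real)"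
proof -
  note I = indep_family_imp_independent[OF ind]
  have "\<forall>a. \<exists>g. linear g \<and> (\<forall>x\<in>v ` {..<M}. g x = (if x = v a then 1 else 0 :: real))"
    by (rule allI) (rule linear_independent_extend[OF I(2)])
  from choice[OF this] obtain g where g: "\<And>a. linear (g a)" "\<And>a b. b < M \<Longrightarrow> g a (v b) = (if v b = v a then 1 else 0 :: real)"
    by auto
  have "(\<Sum>i<N. g a (unit_vec i) * v b i) = (if a = b then 1 else 0)" if ab: "a < M" "b < M" for a b
  proof -
    have "g a (v b) = g a (\<Sum>i<N. v b i *\<^sub>R unit_vec i)" using Rn_unit_vec_sum[OF v[OF ab(2)]] by simp
    also have "\<dots> = (\<Sum>i<N. g a (unit_vec i) * v b i)"
      by (simp add: linear_sum[OF g(1)] linear_scale[OF g(1)] mult.commute)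
    finally have "(\<Sum>i<N. g a (unit_vec i) * v b i) = (if v b = v a then 1 else 0)" using g(2)[OF ab(2), of a] by simp
    moreover have "v b = v a \<longleftrightarrow> a = b" using I(1) ab by (auto dest: inj_onD)
    ultimately show ?thesis by simp
  qed
  then show ?thesis by (intro exI[of _ "\<lambda>a i. g a (unit_vec i)"]) blast
qed

text \<open>
  The moving-frame lemma for vector fields on a manifold.  Coordinate vectors of independent
  tangent vectors are independent, which provides the dual functionals.
\<close>

lemma field_coeffs_tdiff:
  assumes Y: "diff_atlas Y" and c: "c \<in> charts Y" "p \<in> fst c" "p \<in> W" and W: "open_in_mfd Y W"
    and f: "\<And>a. a < M \<Longrightarrow> smooth_vector_field_on Y W (f a)"
    and ind: "indep_family M (\<lambda>a. f a p)"
    and w: "\<And>i. i < mdim Y \<Longrightarrow> tdiff (mdim Y) (\<lambda>x. w x i) (snd c p)"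
    and eq: "\<forall>\<^sub>F x in nbh (mdim Y) (snd c p). w x = (\<Sum>a<M. C a x *\<^sub>R f a (cinv c x)) c"
    and a: "a < M"
  shows "tdiff (mdim Y) (C a) (snd c p)"
proof -
  let ?N = "mdim Y"
  have x: "snd c p \<in> Rn ?N" by (rule diff_atlasD(3)[OF Y c(1,2)])
  have cp: "cinv c (snd c p) = p" by (rule diff_atlasD(4)[OF Y c(1,2)])
  have ft: "f a p \<in> tangent Y p" if "a < M" for a using f[OF that] c(3) unfolding smooth_vector_field_on_def by blast
  have "\<exists>D. \<forall>a<M. \<forall>b<M. (\<Sum>i<?N. D a i * f b p c i) = (if a = b then 1 else 0 :: real)"
  proof (rule dual_functionals[of M "\<lambda>a. f a p c"])
    show "f a p c \<in> Rn ?N" if "a < M" for a by (rule tangentD(1)[OF ft[OF that] c(1,2)])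
    show "indep_family M (\<lambda>a. f a p c)"
      unfolding indep_family_def
    proof (intro allI impI)
      fix t a assume 0: "(\<Sum>a<M. t a *\<^sub>R f a p c) = 0" and a: "a < M"
      have "(\<Sum>a<M. t a *\<^sub>R f a p) = 0"
      proof (rule tangent_eqI[OF _ _ c(1,2)])
        show "(\<Sum>a<M. t a *\<^sub>R f a p) \<in> tangent Y p"
          using ft by (intro subspace_sum subspace_scale subspace_tangent) auto
        show "0 \<in> tangent Y p" by (rule subspace_0[OF subspace_tangent])
        show "(\<Sum>a<M. t a *\<^sub>R f a p) c = 0 c" using 0 by (simp add: sum_fun_apply scaleR_fun_apply)
      qed
      then show "t a = 0" using indep_familyD[OF ind _ a] by simp
    qed
  qed
  then obtain D where D: "\<And>a b. a < M \<Longrightarrow> b < M \<Longrightarrow> (\<Sum>i<?N. D a i * f b p c i) = (if a = b then 1 else 0 :: real)"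
    by blast
  have o: "open_Rn ?N (snd c ` (W \<inter> fst c))" using W c unfolding open_in_mfd_def by blast
  show ?thesis
  proof (rule tdiff_frame_coeffs[of "{..<M}" _ ?N ?N "\<lambda>a x. f a (cinv c x) c" w C D])
    show "tdiff ?N (\<lambda>x. f a (cinv c x) c i) (snd c p)" if "a \<in> {..<M}" "i < ?N" for a i
    proof (rule smooth_on_tdiff[OF o])
      show "smooth_on ?N (snd c ` (W \<inter> fst c)) (\<lambda>x. f a (cinv c x) c i)"
        using f[of a] that c(1) unfolding smooth_vector_field_on_def by blast
    qed (use c in auto)
    show "\<forall>\<^sub>F x in nbh ?N (snd c p). \<forall>i<?N. w x i = (\<Sum>a<M. C a x * f a (cinv c x) c i)"
      using eq by eventually_elim (simp add: sum_fun_apply scaleR_fun_apply)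
  qed (use x w D a cp in auto)
qed

section \<open>The dual bundle as a manifold\<close>

text \<open>
  The bundle projection in the coordinates of a dual chart.
\<close>

definition trunc :: "nat \<Rightarrow> (nat \<Rightarrow> real) \<Rightarrow> nat \<Rightarrow> real" where
  "trunc N z = (\<lambda>i. if i < N then z i else 0)"

lemma trunc_Rn: "trunc N z \<in> Rn N"
  by (simp add: trunc_def Rn_def)

lemma tdiff_trunc: "z \<in> Rn (N + m) \<Longrightarrow> tdiff (N + m) (\<lambda>z. trunc N z j) z"
  by (cases "j < N") (auto simp: trunc_def intro: tdiff_coord tdiff_const)

lemma tdiff_comp_trunc:
  assumes "z \<in> Rn (N + m)" "tdiff N g (trunc N z)"
  shows "tdiff (N + m) (\<lambda>z. g (trunc N z)) z"
  by (rule tdiff_compose[of N "N + m" "trunc N" z, OF tdiff_trunc[OF assms(1)] always_eventually assms]) (simp add: trunc_Rn)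

lemma filterlim_trunc: "z \<in> Rn (N + m) \<Longrightarrow> filterlim (trunc N) (nbh N (trunc N z)) (nbh (N + m) z)"
  by (rule filterlim_tdiff[OF tdiff_trunc always_eventually]) (simp_all add: trunc_Rn)

lemma dmap_trunc:
  assumes "z \<in> Rn (N + m)" shows "dmap (N + m) (trunc N) z u = trunc N u"
proof
  fix j show "dmap (N + m) (trunc N) z u j = trunc N u j"
    using dir_deriv_coord[OF _ assms, of j u] has_pds_dir_deriv[OF has_pds_const assms, of 0 u]
    by (simp add: dmap_def trunc_def)
qed

lemma dual_space_sum:
  assumes "\<alpha> \<in> dual_space V" "subspace V" "\<And>i. i \<in> I \<Longrightarrow> v i \<in> V"
  shows "\<alpha> (\<Sum>i\<in>I. t i *\<^sub>R v i) = (\<Sum>i\<in>I. t i * \<alpha> (v i))"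
proof -
  have \<alpha>: "\<And>u w. u \<in> V \<Longrightarrow> w \<in> V \<Longrightarrow> \<alpha> (u + w) = \<alpha> u + \<alpha> w" "\<And>a u. u \<in> V \<Longrightarrow> \<alpha> (a *\<^sub>R u) = a * \<alpha> u"
    using assms(1) unfolding dual_space_def by blast+
  have 0: "\<alpha> 0 = 0" using \<alpha>(2)[of 0 0] subspace_0[OF assms(2)] by simp
  show ?thesis using assms(3)
  proof (induction I rule: infinite_finite_induct)
    case (insert i I)
    have "(\<Sum>i\<in>I. t i *\<^sub>R v i) \<in> V" using insert.prems by (intro subspace_sum subspace_scale assms(2)) auto
    then show ?case using insert \<alpha> subspace_scale[OF assms(2)] by simp
  qed (simp_all add: 0)
qed

locale split_bundle =
  fixes Y :: "'y manifold" and E G :: "'y \<Rightarrow> 'y tvec set" and m :: nat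
  assumes Y: "smooth_atlas Y"
    and subE: "\<And>p. p \<in> points Y \<Longrightarrow> subspace (E p)" "\<And>p. p \<in> points Y \<Longrightarrow> E p \<subseteq> tangent Y p"
    and G: "splitting Y G E"
begin

abbreviation D where "D \<equiv> dual_bundle Y E m"
abbreviation N where "N \<equiv> mdim Y"
abbreviation dch where "dch \<equiv> dual_chart Y E m"

lemma atlasY: "diff_atlas Y" by (rule smooth_atlas_imp_c1_atlas[OF Y])

lemma dimD: "mdim D = N + m" by (simp add: dual_bundle_def)

lemma charts_D: "\<delta> \<in> charts D \<longleftrightarrow> (\<exists>c W e. \<delta> = dch c W e \<and> c \<in> charts Y \<and> W \<subseteq> fst c \<and> local_frame Y E m W e)"
  by (auto simp: dual_bundle_def)

context
  fixes c W e
  assumes c: "c \<in> charts Y" "W \<subseteq> fst c" "local_frame Y E m W e"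
begin

lemma fst_dch: "fst (dch c W e) = {q. fst q \<in> W \<and> snd q \<in> dual_space (E (fst q))}"
  by (auto simp: dual_chart_def)

lemma snd_dch: "snd (dch c W e) q i = (if i < N then snd c (fst q) i
    else if i < N + m then snd q (e (i - N) (fst q)) else 0)"
  by (simp add: dual_chart_def case_prod_beta)

lemma W_pts: "p \<in> W \<Longrightarrow> p \<in> points Y" "p \<in> W \<Longrightarrow> p \<in> fst c"
  by (rule local_frameD(8)[OF c(3)], assumption) (rule subsetD[OF c(2)])

lemma dch_Rn: "snd (dch c W e) q \<in> Rn (N + m)"
  by (auto simp: snd_dch Rn_def)

lemma trunc_dch: "fst q \<in> W \<Longrightarrow> trunc N (snd (dch c W e) q) = snd c (fst q)"
  using diff_atlasD(3)[OF atlasY c(1) W_pts(2)] by (auto simp: trunc_def snd_dch fun_eq_iff Rn_def)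

lemma dch_inj: "inj_on (snd (dch c W e)) (fst (dch c W e))"
proof (rule inj_onI)
  fix q q' assume q: "q \<in> fst (dch c W e)" and q': "q' \<in> fst (dch c W e)"
    and eq: "snd (dch c W e) q = snd (dch c W e) q'"
  have W: "fst q \<in> W" "fst q' \<in> W" using q q' by (auto simp: fst_dch)
  have "snd c (fst q) = snd c (fst q')" using eq trunc_dch W by metis
  then have p: "fst q = fst q'"
    using diff_atlasD(4)[OF atlasY c(1) W_pts(2)] W by metis
  have qd: "snd q \<in> dual_space (E (fst q))" "snd q' \<in> dual_space (E (fst q))" using q q' p by (simp_all add: fst_dch)
  have "snd q v = snd q' v" for v
  proof (cases "v \<in> E (fst q)")
    case True
    then obtain t where t: "v = (\<Sum>a<m. t a *\<^sub>R e a (fst q))" using local_frameD(4)[OF c(3) W(1)] by blast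
    have "snd q (e a (fst q)) = snd q' (e a (fst q))" if "a < m" for a
      using fun_cong[OF eq, of "N + a"] that p by (simp add: snd_dch)
    moreover have "snd q v = (\<Sum>a<m. t a * snd q (e a (fst q)))" unfolding t
      by (rule dual_space_sum[OF qd(1) local_frameD(6)[OF c(3) W(1)]]) (simp add: local_frameD(5)[OF c(3) W(1)])
    moreover have "snd q' v = (\<Sum>a<m. t a * snd q' (e a (fst q)))" unfolding t
      by (rule dual_space_sum[OF qd(2) local_frameD(6)[OF c(3) W(1)]]) (simp add: local_frameD(5)[OF c(3) W(1)])
    ultimately show ?thesis by simp
  next
    case False
    then show ?thesis using q q' p by (auto simp: fst_dch dual_space_def)
  qed
  then show "q = q'" using p by (simp add: prod_eq_iff fun_eq_iff)
qed

text \<open>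
  A dual chart hits every fibre coordinate: prescribe the functional on the frame, extend it linearly,
  and cut it off outside the fibre, as \<open>dual_space\<close> requires.
\<close>

lemma dch_image: "snd (dch c W e) ` fst (dch c W e) = {z \<in> Rn (N + m). trunc N z \<in> snd c ` W}"
proof (intro equalityI subsetI)
  fix z assume "z \<in> snd (dch c W e) ` fst (dch c W e)"
  then show "z \<in> {z \<in> Rn (N + m). trunc N z \<in> snd c ` W}"
    using dch_Rn trunc_dch by (auto simp: fst_dch)
next
  fix z assume "z \<in> {z \<in> Rn (N + m). trunc N z \<in> snd c ` W}"
  then obtain p where z: "z \<in> Rn (N + m)" "trunc N z = snd c p" and p: "p \<in> W" by blast
  note fr = local_frameD[OF c(3)]
  have I: "inj_on (\<lambda>j. e j p) {..<m}" "independent ((\<lambda>j. e j p) ` {..<m})" using fr(9)[OF p] by blast+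
  define t where "t x = z (N + the_inv_into {..<m} (\<lambda>j. e j p) x)" for x
  obtain g where g: "linear g" "\<And>x. x \<in> (\<lambda>j. e j p) ` {..<m} \<Longrightarrow> g x = t x"
    using linear_independent_extend[OF I(2), of t] by blast
  define \<alpha> where "\<alpha> v = (if v \<in> E p then g v else 0)" for v
  have "\<alpha> \<in> dual_space (E p)"
    unfolding dual_space_def \<alpha>_def using fr(6)[OF p] linear_add[OF g(1)] linear_scale[OF g(1)]
    by (auto simp: subspace_add subspace_scale)
  then have q: "(p, \<alpha>) \<in> fst (dch c W e)" using p by (simp add: fst_dch)
  have "\<alpha> (e a p) = z (N + a)" if "a < m" for a
    using fr(5)[OF p that] g(2)[of "e a p"] that the_inv_into_f_f[OF I(1), of a] by (simp add: \<alpha>_def t_def)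
  moreover have "snd c p i = (if i < N then z i else 0)" for i using z(2)[symmetric] by (simp add: trunc_def)
  ultimately have "snd (dch c W e) (p, \<alpha>) i = z i" for i
    using z(1) by (simp add: snd_dch Rn_def)
  then have "snd (dch c W e) (p, \<alpha>) = z" by blast
  then show "z \<in> snd (dch c W e) ` fst (dch c W e)" using q by blast
qed

lemma cinv_dch:
  assumes "z \<in> Rn (N + m)" "trunc N z \<in> snd c ` W"
  shows "fst (cinv (dch c W e) z) = cinv c (trunc N z)" "fst (cinv (dch c W e) z) \<in> W"
    "snd (cinv (dch c W e) z) \<in> dual_space (E (fst (cinv (dch c W e) z)))"
    "\<And>a. a < m \<Longrightarrow> snd (cinv (dch c W e) z) (e a (fst (cinv (dch c W e) z))) = z (N + a)"
    "snd (dch c W e) (cinv (dch c W e) z) = z"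
proof -
  have "z \<in> snd (dch c W e) ` fst (dch c W e)" using assms by (simp add: dch_image)
  note ci = chart_cinv[OF this]
  show W: "fst (cinv (dch c W e) z) \<in> W" and "snd (cinv (dch c W e) z) \<in> dual_space (E (fst (cinv (dch c W e) z)))"
    and eq: "snd (dch c W e) (cinv (dch c W e) z) = z"
    using ci by (auto simp: fst_dch)
  have "snd c (fst (cinv (dch c W e) z)) = trunc N z" using trunc_dch[OF W] eq by simp
  then show "fst (cinv (dch c W e) z) = cinv c (trunc N z)"
    using diff_atlasD(4)[OF atlasY c(1) W_pts(2)[OF W]] by simp
  show "snd (cinv (dch c W e) z) (e a (fst (cinv (dch c W e) z))) = z (N + a)" if "a < m" for a
    using fun_cong[OF eq, of "N + a"] that by (simp add: snd_dch)
qed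

lemma open_chart_W: "open_in_mfd Y W' \<Longrightarrow> open_Rn N (snd c ` (W' \<inter> fst c))"
  using c unfolding open_in_mfd_def by blast

lemma eventually_base:
  assumes "fst q \<in> W" "open_in_mfd Y W'" "fst q \<in> W'"
  shows "\<forall>\<^sub>F z in nbh (N + m) (snd (dch c W e) q). z \<in> Rn (N + m) \<and> trunc N z \<in> snd c ` W \<and> cinv c (trunc N z) \<in> W'"
proof -
  let ?z = "snd (dch c W e) q"
  have lim: "filterlim (trunc N) (nbh N (snd c (fst q))) (nbh (N + m) ?z)"
    using filterlim_trunc[OF dch_Rn] trunc_dch[OF assms(1)] by metis
  have W: "open_in_mfd Y W" using local_frameD(1)[OF c(3)] .
  have WW: "W \<inter> fst c = W" using c(2) by blast
  have "\<forall>\<^sub>F x in nbh N (snd c (fst q)). x \<in> snd c ` W"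
    using open_Rn_imp_eventually[OF open_chart_W[OF W]] assms(1) unfolding WW by blast
  moreover have "\<forall>\<^sub>F x in nbh N (snd c (fst q)). x \<in> snd c ` (W' \<inter> fst c)"
    using open_Rn_imp_eventually[OF open_chart_W[OF assms(2)]] assms(3) W_pts(2)[OF assms(1)] by blast
  ultimately have "\<forall>\<^sub>F x in nbh N (snd c (fst q)). x \<in> snd c ` W \<and> cinv c x \<in> W'"
    by eventually_elim (auto simp: diff_atlasD(4)[OF atlasY c(1)])
  then have "\<forall>\<^sub>F z in nbh (N + m) ?z. trunc N z \<in> snd c ` W \<and> cinv c (trunc N z) \<in> W'"
    using lim by (auto simp: filterlim_iff)
  then show ?thesis using eventually_nbh_Rn[of "N + m" ?z] by eventually_elim blast
qed

lemma frame_coeff_ex: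
  assumes "p \<in> W" "p \<in> W'" "local_frame Y E m W' e'" "l < m"
  shows "\<exists>t. e' l p = (\<Sum>a<m. t a *\<^sub>R e a p)"
  using local_frameD(4)[OF c(3) assms(1)] local_frameD(5)[OF assms(3,2,4)] by blast

text \<open>
  In the base directions this is a transition map of the base.  The fibre coordinates of the second
  chart are those of the first, multiplied by the matrix \<open>A\<close> that expresses one frame through the
  other; its entries are differentiable by the moving-frame lemma.
\<close>

lemma dch_transition_tdiff:
  assumes c': "c' \<in> charts Y" "W' \<subseteq> fst c'" "local_frame Y E m W' e'"
    and q: "q \<in> fst (dch c W e)" "fst q \<in> W'"
  shows "tdiff (N + m) (\<lambda>z. snd (dual_chart Y E m c' W' e') (cinv (dch c W e) z) j) (snd (dch c W e) q)"
proof -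
  let ?z = "snd (dch c W e) q"
  have qW: "fst q \<in> W" using q by (simp add: fst_dch)
  have W': "open_in_mfd Y W'" using local_frameD(1)[OF c'(3)] .
  note ev = eventually_base[OF qW W' q(2)]
  have z: "?z \<in> Rn (N + m)" by (rule dch_Rn)
  have pc: "fst q \<in> fst c" "fst q \<in> fst c'" using qW q(2) c'(2) W_pts(2) by auto
  have snd': "snd (dual_chart Y E m c' W' e') q i = (if i < N then snd c' (fst q) i
    else if i < N + m then snd q (e' (i - N) (fst q)) else 0)" for q i
    by (simp add: dual_chart_def case_prod_beta)
  consider "j < N" | "N \<le> j" "j < N + m" | "N + m \<le> j" by linarith
  then show ?thesis
  proof cases
    case 1
    have "tdiff N (\<lambda>x. snd c' (cinv c x) j) (trunc N ?z)"
      unfolding trunc_dch[OF qW]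
      using diff_atD(3)[OF atlasY atlasY diff_atlas_id[OF atlasY] c(1) pc(1) c'(1) pc(2)] .
    from tdiff_comp_trunc[OF z this] show ?thesis
      by (rule tdiff_cong[OF _ _ z]) (use ev in eventually_elim, use 1 in \<open>simp add: snd' cinv_dch\<close>)
  next
    case 2
    define l where "l = j - N"
    have l: "l < m" "j = N + l" using 2 by (auto simp: l_def)
    have "\<forall>x. \<exists>t. cinv c x \<in> W \<and> cinv c x \<in> W' \<longrightarrow> e' l (cinv c x) = (\<Sum>a<m. t a *\<^sub>R e a (cinv c x))"
      using frame_coeff_ex[OF _ _ c'(3) l(1)] by blast
    from choice[OF this] obtain A where A: "\<And>x. cinv c x \<in> W \<Longrightarrow> cinv c x \<in> W' \<Longrightarrow>
        e' l (cinv c x) = (\<Sum>a<m. A x a *\<^sub>R e a (cinv c x))" by blast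
    have evA: "\<forall>\<^sub>F x in nbh N (snd c (fst q)). x \<in> snd c ` (W \<inter> W' \<inter> fst c)"
    proof -
      have "\<forall>\<^sub>F x in nbh N (snd c (fst q)). x \<in> snd c ` (W \<inter> fst c)"
        using open_Rn_imp_eventually[OF open_chart_W[OF local_frameD(1)[OF c(3)]]] qW pc by blast
      moreover have "\<forall>\<^sub>F x in nbh N (snd c (fst q)). x \<in> snd c ` (W' \<inter> fst c)"
        using open_Rn_imp_eventually[OF open_chart_W[OF W']] q(2) pc by blast
      ultimately show ?thesis
      proof eventually_elim
        case (elim x)
        then obtain y y' where y: "x = snd c y" "y \<in> W" "y \<in> fst c" "x = snd c y'" "y' \<in> W'" "y' \<in> fst c" by blast
        then have "y = y'" using diff_atlasD(4)[OF atlasY c(1), of y] diff_atlasD(4)[OF atlasY c(1), of y'] by simp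
        then show ?case using y by blast
      qed
    qed
    have At: "tdiff N (\<lambda>x. A x a) (snd c (fst q))" if a: "a < m" for a
    proof (rule field_coeffs_tdiff[OF atlasY c(1) pc(1) qW local_frameD(1)[OF c(3)], of m e "\<lambda>x. e' l (cinv c x) c" "\<lambda>a x. A x a" a])
      show "smooth_vector_field_on Y W (e a)" if "a < m" for a using local_frameD(2)[OF c(3) that] .
      show "indep_family m (\<lambda>a. e a (fst q))" by (rule local_frameD(3)[OF c(3) qW])
      show "tdiff N (\<lambda>x. e' l (cinv c x) c i) (snd c (fst q))" if "i < N" for i
      proof (rule smooth_on_tdiff[OF open_chart_W[OF W']])
        show "smooth_on N (snd c ` (W' \<inter> fst c)) (\<lambda>x. e' l (cinv c x) c i)"
          using local_frameD(2)[OF c'(3) l(1)] c(1) that unfolding smooth_vector_field_on_def by blast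
      qed (use q(2) pc in blast)
      show "\<forall>\<^sub>F x in nbh N (snd c (fst q)). e' l (cinv c x) c = (\<Sum>a<m. A x a *\<^sub>R e a (cinv c x)) c"
        using evA
      proof eventually_elim
        case (elim x)
        then have "cinv c x \<in> W" "cinv c x \<in> W'" using diff_atlasD(4)[OF atlasY c(1)] by auto
        then show ?case using A by simp
      qed
    qed (rule a)
    have "tdiff (N + m) (\<lambda>z. \<Sum>a<m. A (trunc N z) a * z (N + a)) ?z"
      using At by (intro tdiff_sum tdiff_mult tdiff_coord z tdiff_comp_trunc) (auto simp: trunc_dch[OF qW])
    then show ?thesis
    proof (rule tdiff_cong[OF _ _ z])
      show "\<forall>\<^sub>F z in nbh (N + m) ?z. (\<Sum>a<m. A (trunc N z) a * z (N + a)) = snd (dual_chart Y E m c' W' e') (cinv (dch c W e) z) j"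
        using ev
      proof eventually_elim
        case (elim z)
        note ci = cinv_dch[of z]
        let ?p = "cinv c (trunc N z)"
        have p: "?p \<in> W" using ci elim by auto
        have "snd (dual_chart Y E m c' W' e') (cinv (dch c W e) z) j = snd (cinv (dch c W e) z) (e' l ?p)"
          using l ci elim by (simp add: snd')
        also have "\<dots> = snd (cinv (dch c W e) z) (\<Sum>a<m. A (trunc N z) a *\<^sub>R e a ?p)"
          using A p elim by simp
        also have "\<dots> = (\<Sum>a<m. A (trunc N z) a * snd (cinv (dch c W e) z) (e a ?p))"
        proof (rule dual_space_sum[OF _ local_frameD(6)[OF c(3) p]])
          show "snd (cinv (dch c W e) z) \<in> dual_space (E ?p)" using ci(1,3) elim by simp
        qed (simp add: local_frameD(5)[OF c(3) p])
        also have "\<dots> = (\<Sum>a<m. A (trunc N z) a * z (N + a))" using ci elim by simp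
        finally show ?case ..
      qed
    qed
  next
    case 3
    have "(\<lambda>z. snd (dual_chart Y E m c' W' e') (cinv (dch c W e) z) j) = (\<lambda>_. 0)"
      using 3 by (simp add: snd')
    then show ?thesis using tdiff_const[OF z] by simp
  qed
qed

end

lemma atlasD: "diff_atlas D"
  unfolding diff_atlas_def dimD
proof (intro conjI ballI allI)
  fix \<delta> assume "\<delta> \<in> charts D"
  then obtain c W e where \<delta>: "\<delta> = dch c W e" and c: "c \<in> charts Y" "W \<subseteq> fst c" "local_frame Y E m W e"
    unfolding charts_D by blast
  show "inj_on (snd \<delta>) (fst \<delta>)" unfolding \<delta> by (rule dch_inj[OF c])
  show "snd \<delta> ` fst \<delta> \<subseteq> Rn (N + m)" unfolding \<delta> dch_image[OF c] by blast
  fix q assume "q \<in> fst \<delta>"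
  then have "fst q \<in> W" by (simp add: \<delta> fst_dch[OF c])
  from eventually_base[OF c this local_frameD(1)[OF c(3)] this]
  show "\<forall>\<^sub>F x in nbh (N + m) (snd \<delta> q). x \<in> snd \<delta> ` fst \<delta>"
    unfolding \<delta> dch_image[OF c] by eventually_elim blast
next
  fix q
  show "diff_at D D (\<lambda>x. x) q"
    unfolding diff_at_def dimD
  proof (intro ballI impI conjI allI)
    fix \<delta> \<delta>' assume "\<delta> \<in> charts D" "q \<in> fst \<delta>" "\<delta>' \<in> charts D" "q \<in> fst \<delta>'"
    then obtain c W e c' W' e' where \<delta>: "\<delta> = dch c W e" "q \<in> fst (dch c W e)" "\<delta>' = dch c' W' e'" "q \<in> fst (dch c' W' e')"
      and c: "c \<in> charts Y" "W \<subseteq> fst c" "local_frame Y E m W e"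
      and c': "c' \<in> charts Y" "W' \<subseteq> fst c'" "local_frame Y E m W' e'"
      unfolding charts_D by blast
    have W: "fst q \<in> W" "fst q \<in> W'" using \<delta> by (simp_all add: fst_dch[OF c] fst_dch[OF c'])
    show "tdiff (N + m) (\<lambda>x. snd \<delta>' (cinv \<delta> x) j) (snd \<delta> q)" for j
      unfolding \<delta>(1,3) by (rule dch_transition_tdiff[OF c c' \<delta>(2) W(2)])
    show "\<forall>\<^sub>F x in nbh (N + m) (snd \<delta> q). cinv \<delta> x \<in> fst \<delta>'"
      unfolding \<delta>(1,3) using eventually_base[OF c W(1) local_frameD(1)[OF c'(3)] W(2)]
    proof eventually_elim
      case (elim z)
      then show ?case using cinv_dch[OF c, of z] by (simp add: fst_dch[OF c'])
    qed
  qed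
qed

lemma fst_points: "q \<in> points D \<Longrightarrow> fst q \<in> points Y"
proof -
  assume "q \<in> points D"
  then obtain \<delta> where "\<delta> \<in> charts D" "q \<in> fst \<delta>" by (auto simp: points_def)
  then obtain c W e where "q \<in> fst (dch c W e)" and c: "c \<in> charts Y" "W \<subseteq> fst c" "local_frame Y E m W e"
    unfolding charts_D by blast
  then show ?thesis using local_frameD(8)[OF c(3)] by (simp add: fst_dch[OF c])
qed

lemma diff_at_fst: "diff_at D Y fst q"
  unfolding diff_at_def dimD
proof (intro ballI impI conjI allI)
  fix \<delta> c' and j :: nat assume "\<delta> \<in> charts D" "q \<in> fst \<delta>" and c': "c' \<in> charts Y" "fst q \<in> fst c'"
  then obtain c W e where \<delta>: "\<delta> = dch c W e" "q \<in> fst (dch c W e)"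
    and c: "c \<in> charts Y" "W \<subseteq> fst c" "local_frame Y E m W e"
    unfolding charts_D by blast
  have W: "fst q \<in> W" using \<delta> by (simp_all add: fst_dch[OF c])
  have pc: "fst q \<in> fst c" using W c(2) by blast
  have z: "snd (dch c W e) q \<in> Rn (N + m)" by (rule dch_Rn[OF c])
  note ev = eventually_base[OF c W local_frameD(1)[OF c(3)] W]
  note tr = diff_atD[OF atlasY atlasY diff_atlas_id[OF atlasY] c(1) pc c']
  have "tdiff (N + m) (\<lambda>z. snd c' (cinv c (trunc N z)) j) (snd (dch c W e) q)"
    by (rule tdiff_comp_trunc[OF z]) (simp only: trunc_dch[OF c W] tr(3))
  then show "tdiff (N + m) (\<lambda>x. snd c' (fst (cinv \<delta> x)) j) (snd \<delta> q)"
    unfolding \<delta>(1) by (rule tdiff_cong[OF _ _ z]) (use ev in eventually_elim, simp add: cinv_dch[OF c])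
  have "filterlim (trunc N) (nbh N (snd c (fst q))) (nbh (N + m) (snd (dch c W e) q))"
    using filterlim_trunc[OF z] trunc_dch[OF c W] by simp
  then have "\<forall>\<^sub>F z in nbh (N + m) (snd (dch c W e) q). cinv c (trunc N z) \<in> fst c'"
    using tr(1) by (auto simp: filterlim_iff)
  then show "\<forall>\<^sub>F x in nbh (N + m) (snd \<delta> q). fst (cinv \<delta> x) \<in> fst c'"
    unfolding \<delta>(1) using ev by eventually_elim (simp add: cinv_dch[OF c])
qed

text \<open>
  In a dual chart the tangent map of the projection forgets the fibre components.
\<close>

lemma tangent_map_fst_coord_vec:
  assumes c: "c \<in> charts Y" "W \<subseteq> fst c" "local_frame Y E m W e" and q: "q \<in> fst (dch c W e)" and u: "u \<in> Rn (N + m)"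
  shows "tangent_map D Y fst q (coord_vec D (dch c W e) q u) = coord_vec Y c (fst q) (trunc N u)"
proof -
  let ?\<delta> = "dch c W e"
  have \<delta>: "?\<delta> \<in> charts D" using c charts_D by blast
  have W: "fst q \<in> W" using q by (simp_all add: fst_dch[OF c])
  have pc: "fst q \<in> fst c" using W c(2) by blast
  have z: "snd ?\<delta> q \<in> Rn (N + m)" by (rule dch_Rn[OF c])
  have cv: "coord_vec D ?\<delta> q u \<in> tangent D q" "coord_vec D ?\<delta> q u ?\<delta> = u"
    using coord_vec_tangent[OF atlasD \<delta> q] u by (simp_all add: dimD)
  have qD: "q \<in> points D" using \<delta> q by (auto simp: points_def)
  note cv' = coord_vec_tangent[OF atlasY c(1) pc trunc_Rn]
  show ?thesis
  proof (rule tangent_eqI[OF _ cv'(1) c(1) pc])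
    show "tangent_map D Y fst q (coord_vec D ?\<delta> q u) \<in> tangent Y (fst q)"
      by (rule tangent_map_in_tangent[OF atlasD atlasY diff_at_fst cv(1) qD])
    have ev: "\<forall>\<^sub>F z in nbh (N + m) (snd ?\<delta> q). trunc N z j = snd c (fst (cinv ?\<delta> z)) j" for j
      using eventually_base[OF c W local_frameD(1)[OF c(3)] W]
    proof eventually_elim
      case (elim z)
      then have "fst (cinv ?\<delta> z) \<in> W" "snd ?\<delta> (cinv ?\<delta> z) = z" using cinv_dch[OF c, of z] by auto
      then show ?case using trunc_dch[OF c, of "cinv ?\<delta> z"] by simp
    qed
    have "tangent_map D Y fst q (coord_vec D ?\<delta> q u) c = dmap (N + m) (\<lambda>x. snd c (fst (cinv ?\<delta> x))) (snd ?\<delta> q) u"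
      using tangent_map_chart[OF atlasD atlasY diff_at_fst cv(1) \<delta> q c(1) pc] cv(2) by (simp add: dimD)
    also have "\<dots> = dmap (N + m) (trunc N) (snd ?\<delta> q) u"
      unfolding dmap_def by (rule ext, rule sym, rule dir_deriv_cong[OF tdiff_trunc[OF z] ev z])
    finally show "tangent_map D Y fst q (coord_vec D ?\<delta> q u) c = coord_vec Y c (fst q) (trunc N u) c"
      using cv'(2) dmap_trunc[OF z] by simp
  qed
qed

section \<open>The projection along the splitting and the canonical one-form\<close>

definition proj_E where "proj_E p v = proj_along (G p) (E p) v"

lemma subG: "p \<in> points Y \<Longrightarrow> subspace (G p)"
  using G local_frameD(6) unfolding splitting_def smooth_subbundle_def by metis

lemma GE: "p \<in> points Y \<Longrightarrow> G p \<inter> E p = {0}"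
    "p \<in> points Y \<Longrightarrow> v \<in> tangent Y p \<Longrightarrow> \<exists>g\<in>G p. \<exists>e\<in>E p. v = g + e"
    "p \<in> points Y \<Longrightarrow> g \<in> G p \<Longrightarrow> g \<in> tangent Y p"
proof -
  note sp = G[unfolded splitting_def, THEN conjunct2, rule_format]
  show "G p \<inter> E p = {0}" if "p \<in> points Y" by (rule sp[OF that, THEN conjunct1])
  show "\<exists>g\<in>G p. \<exists>e\<in>E p. v = g + e" if p: "p \<in> points Y" and v: "v \<in> tangent Y p"
  proof -
    have "v \<in> {g + e | g e. g \<in> G p \<and> e \<in> E p}" using v unfolding sp[OF p, THEN conjunct2] .
    then show ?thesis by blast
  qed
  assume p: "p \<in> points Y" "g \<in> G p"
  then have "g + 0 \<in> {g + e | g e. g \<in> G p \<and> e \<in> E p}" using subspace_0[OF subE(1)[OF p(1)]] by blast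
  then show "g \<in> tangent Y p" unfolding sp[OF p(1), THEN conjunct2] by simp
qed

lemma proj_E_eq:
  assumes p: "p \<in> points Y" and "g \<in> G p" "e \<in> E p"
  shows "proj_E p (g + e) = e"
  unfolding proj_E_def proj_along_def
proof (rule the_equality)
  show "e \<in> E p \<and> g + e - e \<in> G p" using assms by simp
  fix e' assume e': "e' \<in> E p \<and> g + e - e' \<in> G p"
  have "(g + e - e') - g \<in> G p" by (rule subspace_diff[OF subG[OF p] conjunct2[OF e'] assms(2)])
  then have "e - e' \<in> G p" by (simp add: algebra_simps)
  moreover have "e - e' \<in> E p" by (rule subspace_diff[OF subE(1)[OF p] assms(3) conjunct1[OF e']])
  ultimately have "e - e' \<in> G p \<inter> E p" by (rule IntI)
  then have "e - e' = 0" unfolding GE(1)[OF p] by (rule singletonD)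
  then show "e' = e" by simp
qed

lemma proj_E_linear:
  assumes p: "p \<in> points Y" and v: "v \<in> tangent Y p" and w: "w \<in> tangent Y p"
  shows "proj_E p v \<in> E p" "proj_E p (v + w) = proj_E p v + proj_E p w" "proj_E p (a *\<^sub>R v) = a *\<^sub>R proj_E p v"
proof -
  obtain g e where v': "g \<in> G p" "e \<in> E p" "v = g + e" using GE(2)[OF p v] by blast
  obtain g' e' where w': "g' \<in> G p" "e' \<in> E p" "w = g' + e'" using GE(2)[OF p w] by blast
  show "proj_E p v \<in> E p" using proj_E_eq[OF p v'(1,2)] v' by simp
  have v0: "proj_E p v = e" and w0: "proj_E p w = e'" using proj_E_eq[OF p v'(1,2)] proj_E_eq[OF p w'(1,2)] v'(3) w'(3) by simp_all
  have vw: "v + w = (g + g') + (e + e')" using v'(3) w'(3) by simp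
  show "proj_E p (v + w) = proj_E p v + proj_E p w"
    unfolding v0 w0 vw by (rule proj_E_eq[OF p subspace_add[OF subG[OF p] v'(1) w'(1)] subspace_add[OF subE(1)[OF p] v'(2) w'(2)]])
  have av: "a *\<^sub>R v = a *\<^sub>R g + a *\<^sub>R e" using v'(3) by (simp add: scaleR_add_right)
  show "proj_E p (a *\<^sub>R v) = a *\<^sub>R proj_E p v"
    unfolding v0 av by (rule proj_E_eq[OF p subspace_scale[OF subG[OF p] v'(1)] subspace_scale[OF subE(1)[OF p] v'(2)]])
qed

text \<open>
  The canonical one-form \<open>\<theta>\<^sub>G\<close>, as a function of a single vector.
\<close>

definition canon where "canon q v = snd q (proj_E (fst q) (tangent_map D Y fst q v))"

lemma theta_eq: "theta Y G E m q [v] = canon q v"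
  by (simp add: theta_def canon_def proj_E_def)

lemma points_D_dual: "q \<in> points D \<Longrightarrow> snd q \<in> dual_space (E (fst q))"
proof -
  assume "q \<in> points D"
  then obtain \<delta> where "\<delta> \<in> charts D" "q \<in> fst \<delta>" by (auto simp: points_def)
  then obtain c W e where "q \<in> fst (dch c W e)" and c: "c \<in> charts Y" "W \<subseteq> fst c" "local_frame Y E m W e"
    unfolding charts_D by blast
  then show ?thesis by (simp add: fst_dch[OF c])
qed

lemma canon_linear:
  assumes q: "q \<in> points D" and v: "v \<in> tangent D q" and w: "w \<in> tangent D q"
  shows "canon q (v + w) = canon q v + canon q w" "canon q (a *\<^sub>R v) = a * canon q v"
proof -
  have p: "fst q \<in> points Y" by (rule fst_points[OF q])
  have t: "tangent_map D Y fst q v \<in> tangent Y (fst q)" "tangent_map D Y fst q w \<in> tangent Y (fst q)"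
    using tangent_map_in_tangent[OF atlasD atlasY diff_at_fst _ q] v w by blast+
  note pl = proj_E_linear[OF p t] proj_E_linear(1)[OF p t(2,1)]
  have \<alpha>: "\<And>u w. u \<in> E (fst q) \<Longrightarrow> w \<in> E (fst q) \<Longrightarrow> snd q (u + w) = snd q u + snd q w"
    "\<And>a u. u \<in> E (fst q) \<Longrightarrow> snd q (a *\<^sub>R u) = a * snd q u"
    using points_D_dual[OF q] unfolding dual_space_def by blast+
  show "canon q (v + w) = canon q v + canon q w" "canon q (a *\<^sub>R v) = a * canon q v"
    unfolding canon_def tangent_map_add tangent_map_scale pl(2,3) by (rule \<alpha> pl)+
qed

lemma canon_sum:
  assumes q: "q \<in> points D" and v: "\<And>i. i \<in> I \<Longrightarrow> v i \<in> tangent D q"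
  shows "canon q (\<Sum>i\<in>I. t i *\<^sub>R v i) = (\<Sum>i\<in>I. t i * canon q (v i))"
proof -
  have canon0: "canon q 0 = 0"
    using canon_linear(2)[OF q subspace_0[OF subspace_tangent] subspace_0[OF subspace_tangent], of 0] by simp
  show ?thesis using v
  proof (induction I rule: infinite_finite_induct)
    case (insert i I)
    have 1: "(\<Sum>i\<in>I. t i *\<^sub>R v i) \<in> tangent D q" "t i *\<^sub>R v i \<in> tangent D q"
      using insert.prems by (auto intro!: subspace_sum subspace_scale subspace_tangent)
    have 2: "canon q (t i *\<^sub>R v i) = t i * canon q (v i)"
      by (rule canon_linear(2)[OF q insert.prems insert.prems]) auto
    have 3: "canon q (\<Sum>i\<in>I. t i *\<^sub>R v i) = (\<Sum>i\<in>I. t i * canon q (v i))"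
      by (rule insert.IH) (rule insert.prems, simp)
    show ?case unfolding sum.insert[OF insert.hyps] canon_linear(1)[OF q 1(2,1)] 2 3 ..
  next
    case empty
    show ?case unfolding sum.empty by (rule canon0)
  next
    case (infinite I)
    show ?case unfolding sum.infinite[OF infinite.hyps] by (rule canon0)
  qed
qed

text \<open>
  The components of the canonical one-form in the chart \<open>\<delta>\<close>.
\<close>

definition theta_coeff where "theta_coeff \<delta> j z = canon (cinv \<delta> z) (coord_vec D \<delta> (cinv \<delta> z) (unit_vec j))"

lemma coeff_theta:
  assumes \<delta>: "\<delta> \<in> charts D" and q: "cinv \<delta> z \<in> fst \<delta>" and u: "u \<in> Rn (N + m)"
  shows "coeff D \<delta> (theta Y G E m) [u] z = (\<Sum>j<N + m. theta_coeff \<delta> j z * u j)"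
proof -
  have qD: "cinv \<delta> z \<in> points D" using \<delta> q by (auto simp: points_def)
  have "coeff D \<delta> (theta Y G E m) [u] z = canon (cinv \<delta> z) (coord_vec D \<delta> (cinv \<delta> z) (\<Sum>j<N + m. u j *\<^sub>R unit_vec j))"
    using Rn_unit_vec_sum[OF u] by (simp add: coeff_def theta_eq)
  also have "\<dots> = (\<Sum>j<N + m. u j * theta_coeff \<delta> j z)"
    unfolding coord_vec_sum theta_coeff_def
    by (intro canon_sum[OF qD] coord_vec_tangent(1)[OF atlasD \<delta> q]) (simp add: dimD unit_vec_Rn)
  finally show ?thesis by (simp add: mult.commute)
qed

text \<open>
  The splitting is differentiable: in the frame that joins a frame of \<open>E\<close> with one of \<open>G\<close>, the
  projection keeps the first \<open>m\<close> coefficients, and the moving-frame lemma applies to them.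
\<close>

lemma proj_E_coeffs_tdiff:
  assumes c: "c \<in> charts Y" "W \<subseteq> fst c" "local_frame Y E m W e" and p: "p \<in> W" and j: "j < N"
  obtains C where "\<And>a. a < m \<Longrightarrow> tdiff N (\<lambda>x. C x a) (snd c p)"
    "\<forall>\<^sub>F x in nbh N (snd c p). proj_E (cinv c x) (coord_vec Y c (cinv c x) (unit_vec j)) = (\<Sum>a<m. C x a *\<^sub>R e a (cinv c x))"
proof -
  have pY: "p \<in> points Y" and pc: "p \<in> fst c" using W_pts[OF c p] by auto
  obtain r where "smooth_subbundle Y r G" using G unfolding splitting_def by blast
  then obtain W' g where W': "p \<in> W'" "local_frame Y G r W' g" using pY unfolding smooth_subbundle_def by blast
  \<comment> \<open>The joint frame of \<open>E \<oplus> G\<close>.\<close>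
  define f where "f a = (if a < m then e a else g (a - m))" for a
  have f_sum: "(\<Sum>a<m + r. t a *\<^sub>R f a p) = (\<Sum>a<m. t a *\<^sub>R e a p) + (\<Sum>a<r. t (m + a) *\<^sub>R g a p)" for t p
  proof -
    have "(\<Sum>a<m + r. t a *\<^sub>R f a p) = (\<Sum>a<m. t a *\<^sub>R f a p) + (\<Sum>a<r. t (m + a) *\<^sub>R f (m + a) p)"
      by (induction r) (simp_all add: add.assoc)
    then show ?thesis by (simp add: f_def)
  qed
  let ?Q = "\<lambda>x. cinv c x \<in> fst c \<and> cinv c x \<in> W \<and> cinv c x \<in> W'"
  have inE: "(\<Sum>a<m. t a *\<^sub>R e a q) \<in> E q" if "q \<in> W" for t q
    using local_frameD(5,6)[OF c(3) that] by (intro subspace_sum subspace_scale) auto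
  have inG: "(\<Sum>a<r. t a *\<^sub>R g a q) \<in> G q" if "q \<in> W'" for t q
    using local_frameD(5,6)[OF W'(2) that] by (intro subspace_sum subspace_scale) auto
  have "\<forall>x. \<exists>t. ?Q x \<longrightarrow> coord_vec Y c (cinv c x) (unit_vec j) = (\<Sum>a<m + r. t a *\<^sub>R f a (cinv c x))"
  proof
    fix x
    show "\<exists>t. ?Q x \<longrightarrow> coord_vec Y c (cinv c x) (unit_vec j) = (\<Sum>a<m + r. t a *\<^sub>R f a (cinv c x))"
    proof (cases "?Q x")
      case True
      let ?q = "cinv c x"
      have q: "?q \<in> points Y" using W_pts[OF c] True by blast
      have "coord_vec Y c ?q (unit_vec j) \<in> tangent Y ?q"
        using coord_vec_tangent(1)[OF atlasY c(1)] True unit_vec_Rn[OF j] by blast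
      then obtain g' e' where ge: "g' \<in> G ?q" "e' \<in> E ?q" "coord_vec Y c ?q (unit_vec j) = g' + e'"
        using GE(2)[OF q] by blast
      obtain t1 where t1: "e' = (\<Sum>a<m. t1 a *\<^sub>R e a ?q)" using local_frameD(4)[OF c(3)] True ge(2) by blast
      obtain t2 where t2: "g' = (\<Sum>a<r. t2 a *\<^sub>R g a ?q)" using local_frameD(4)[OF W'(2)] True ge(1) by blast
      define t where "t a = (if a < m then t1 a else t2 (a - m))" for a
      have "(\<Sum>a<m + r. t a *\<^sub>R f a ?q) = e' + g'" unfolding f_sum t1 t2 by (simp add: t_def)
      then show ?thesis using ge(3) by (intro exI[of _ t]) (simp add: add.commute)
    qed blast
  qed
  from choice[OF this] obtain C where C: "\<And>x. ?Q x \<Longrightarrow> coord_vec Y c (cinv c x) (unit_vec j) = (\<Sum>a<m + r. C x a *\<^sub>R f a (cinv c x))"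
    by blast
  have WW: "open_in_mfd Y (W \<inter> W')"
    unfolding open_in_mfd_def
  proof (intro conjI ballI)
    show "W \<inter> W' \<subseteq> points Y" using W_pts[OF c] by blast
    fix d assume d: "d \<in> charts Y"
    have "snd d ` (W \<inter> W' \<inter> fst d) = snd d ` (W \<inter> fst d) \<inter> snd d ` (W' \<inter> fst d)"
      using diff_atlasD(1)[OF atlasY d] by (auto simp: inj_on_def)
    moreover have "open_Rn N (snd d ` (W \<inter> fst d))" "open_Rn N (snd d ` (W' \<inter> fst d))"
      using local_frameD(1)[OF c(3)] local_frameD(1)[OF W'(2)] d unfolding open_in_mfd_def by blast+
    ultimately show "open_Rn N (snd d ` (W \<inter> W' \<inter> fst d))" by (simp add: open_Rn_def openin_Int)
  qed
  have ev: "\<forall>\<^sub>F x in nbh N (snd c p). ?Q x"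
  proof -
    have "open_Rn N (snd c ` ((W \<inter> W') \<inter> fst c))" using WW c(1) unfolding open_in_mfd_def by blast
    from open_Rn_imp_eventually[OF this, of "snd c p"]
    have "\<forall>\<^sub>F x in nbh N (snd c p). x \<in> snd c ` ((W \<inter> W') \<inter> fst c)" using p pc W'(1) by blast
    then show ?thesis by eventually_elim (auto simp: diff_atlasD(4)[OF atlasY c(1)])
  qed
  have x: "snd c p \<in> Rn N" by (rule diff_atlasD(3)[OF atlasY c(1) pc])
  have "tdiff N (\<lambda>x. C x a) (snd c p)" if a: "a < m" for a
  proof (rule field_coeffs_tdiff[OF atlasY c(1) pc _ WW, of "m + r" f "\<lambda>_. unit_vec j" "\<lambda>a x. C x a" a])
    show "p \<in> W \<inter> W'" using p W'(1) by blast
    show "smooth_vector_field_on Y (W \<inter> W') (f a)" if a: "a < m + r" for a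
    proof -
      have sub: "smooth_vector_field_on Y (W1 \<inter> W2) X"
        if "smooth_vector_field_on Y W1 X" "open_in_mfd Y W1" "open_in_mfd Y (W1 \<inter> W2)" for W1 W2 X
      proof -
        have "smooth_on N (snd c ` (W1 \<inter> W2 \<inter> fst c)) (\<lambda>x. X (cinv c x) c i)" if "c \<in> charts Y" "i < N" for c i
        proof -
          have "smooth_on N (snd c ` (W1 \<inter> fst c)) (\<lambda>x. X (cinv c x) c i)"
            using \<open>smooth_vector_field_on Y W1 X\<close> that unfolding smooth_vector_field_on_def by blast
          moreover have "snd c ` (W1 \<inter> W2 \<inter> fst c) \<subseteq> snd c ` (W1 \<inter> fst c)" by blast
          ultimately show ?thesis unfolding smooth_on_def using Ck_on_subset by blast
        qed
        then show ?thesis using \<open>smooth_vector_field_on Y W1 X\<close> unfolding smooth_vector_field_on_def by blast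
      qed
      show ?thesis
      proof (cases "a < m")
        case True
        then show ?thesis unfolding f_def using sub[OF local_frameD(2)[OF c(3) True] local_frameD(1)[OF c(3)] WW] by simp
      next
        case False
        then have "a - m < r" using a by simp
        from sub[OF local_frameD(2)[OF W'(2) this] local_frameD(1)[OF W'(2)], of W] WW
        show ?thesis unfolding f_def using False by (simp add: Int_commute)
      qed
    qed
    show "indep_family (m + r) (\<lambda>a. f a p)"
      unfolding indep_family_def
    proof (intro allI impI)
      fix t a assume 0: "(\<Sum>a<m + r. t a *\<^sub>R f a p) = 0" and a: "a < m + r"
      let ?u = "\<Sum>a<m. t a *\<^sub>R e a p" and ?v = "\<Sum>a<r. t (m + a) *\<^sub>R g a p"
      have s: "?u + ?v = 0" using 0 f_sum by simp
      then have "?u = - ?v" by (simp add: eq_neg_iff_add_eq_0)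
      then have "?u \<in> G p" using inG[OF W'(1)] subspace_neg[OF subG[OF pY]] by simp
      then have u0: "?u = 0" using inE[OF p] GE(1)[OF pY] by blast
      then have v0: "?v = 0" using s by simp
      show "t a = 0"
      proof (cases "a < m")
        case True then show ?thesis using indep_familyD[OF local_frameD(3)[OF c(3) p] u0] by blast
      next
        case False
        then show ?thesis using indep_familyD[OF local_frameD(3)[OF W'(2,1)] v0, of "a - m"] a by simp
      qed
    qed
    show "tdiff N (\<lambda>x. unit_vec j i) (snd c p)" for i by (rule tdiff_const[OF x])
    show "\<forall>\<^sub>F x in nbh N (snd c p). unit_vec j = (\<Sum>a<m + r. C x a *\<^sub>R f a (cinv c x)) c"
      using ev
    proof eventually_elim
      case (elim x)
      then have "coord_vec Y c (cinv c x) (unit_vec j) c = unit_vec j"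
        using coord_vec_tangent(2)[OF atlasY c(1) _ unit_vec_Rn[OF j]] by blast
      then show ?case using C[OF elim] by simp
    qed
  qed (use a in simp)
  moreover have "\<forall>\<^sub>F x in nbh N (snd c p). proj_E (cinv c x) (coord_vec Y c (cinv c x) (unit_vec j)) = (\<Sum>a<m. C x a *\<^sub>R e a (cinv c x))"
    using ev
  proof eventually_elim
    case (elim x)
    have q: "cinv c x \<in> points Y" using W_pts[OF c] elim by blast
    show ?case unfolding C[OF elim] f_sum
      by (subst add.commute, rule proj_E_eq[OF q inG inE]) (use elim in blast)+
  qed
  ultimately show thesis by (rule that)
qed

text \<open>
  In a dual chart with fibre coordinates \<open>\<xi>\<^sub>a\<close>, a base component of \<open>\<theta>\<^sub>G\<close> is \<open>\<Sum>\<^sub>a C\<^sub>a \<xi>\<^sub>a\<close>, where the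
  \<open>C\<^sub>a\<close> are the coefficients of the projected coordinate vector; the fibre components vanish.
\<close>

lemma theta_coeff_tdiff:
  assumes \<delta>: "\<delta> \<in> charts D" and q: "q \<in> fst \<delta>" and j: "j < N + m"
  shows "tdiff (N + m) (theta_coeff \<delta> j) (snd \<delta> q)"
proof -
  obtain c W e where \<delta>': "\<delta> = dch c W e" and c: "c \<in> charts Y" "W \<subseteq> fst c" "local_frame Y E m W e"
    using \<delta> charts_D by blast
  have W: "fst q \<in> W" using q by (simp_all add: \<delta>' fst_dch[OF c])
  have z: "snd (dch c W e) q \<in> Rn (N + m)" by (rule dch_Rn[OF c])
  note ev = eventually_base[OF c W local_frameD(1)[OF c(3)] W]
  have \<beta>: "theta_coeff \<delta> j z = snd (cinv \<delta> z) (proj_E (fst (cinv \<delta> z)) (coord_vec Y c (fst (cinv \<delta> z)) (trunc N (unit_vec j))))"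
    if "z \<in> Rn (N + m)" "trunc N z \<in> snd c ` W" for z
  proof -
    have "cinv \<delta> z \<in> fst (dch c W e)" using cinv_dch[OF c that] by (simp add: \<delta>' fst_dch[OF c])
    from tangent_map_fst_coord_vec[OF c this unit_vec_Rn[OF j]]
    show ?thesis unfolding theta_coeff_def canon_def \<delta>' by simp
  qed
  show ?thesis
  proof (cases "j < N")
    case True
    obtain C where C: "\<And>a. a < m \<Longrightarrow> tdiff N (\<lambda>x. C x a) (snd c (fst q))"
      "\<forall>\<^sub>F x in nbh N (snd c (fst q)). proj_E (cinv c x) (coord_vec Y c (cinv c x) (unit_vec j)) = (\<Sum>a<m. C x a *\<^sub>R e a (cinv c x))"
      using proj_E_coeffs_tdiff[OF c W True] by blast
    have tj: "trunc N (unit_vec j) = unit_vec j" using True by (auto simp: trunc_def unit_vec_def)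
    have "filterlim (trunc N) (nbh N (snd c (fst q))) (nbh (N + m) (snd (dch c W e) q))"
      using filterlim_trunc[OF z] trunc_dch[OF c W] by simp
    then have ev2: "\<forall>\<^sub>F z in nbh (N + m) (snd (dch c W e) q). proj_E (cinv c (trunc N z)) (coord_vec Y c (cinv c (trunc N z)) (unit_vec j)) = (\<Sum>a<m. C (trunc N z) a *\<^sub>R e a (cinv c (trunc N z)))"
      using C(2) by (auto simp: filterlim_iff)
    have "tdiff (N + m) (\<lambda>z. \<Sum>a<m. C (trunc N z) a * z (N + a)) (snd (dch c W e) q)"
      using C(1) by (intro tdiff_sum tdiff_mult tdiff_coord z tdiff_comp_trunc) (auto simp: trunc_dch[OF c W])
    then show ?thesis unfolding \<delta>'
    proof (rule tdiff_cong[OF _ _ z])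
      show "\<forall>\<^sub>F z in nbh (N + m) (snd (dch c W e) q). (\<Sum>a<m. C (trunc N z) a * z (N + a)) = theta_coeff (dch c W e) j z"
        using ev ev2
      proof eventually_elim
        case (elim z)
        have zz: "z \<in> Rn (N + m)" "trunc N z \<in> snd c ` W" using elim by auto
        note ci = cinv_dch[OF c zz]
        have "theta_coeff (dch c W e) j z = snd (cinv (dch c W e) z) (\<Sum>a<m. C (trunc N z) a *\<^sub>R e a (fst (cinv (dch c W e) z)))"
          using \<beta>[OF zz] elim(2) by (simp add: \<delta>' tj ci(1))
        also have "\<dots> = (\<Sum>a<m. C (trunc N z) a * snd (cinv (dch c W e) z) (e a (fst (cinv (dch c W e) z))))"
          using local_frameD(5,6)[OF c(3) ci(2)] by (intro dual_space_sum[OF ci(3)]) auto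
        also have "\<dots> = (\<Sum>a<m. C (trunc N z) a * z (N + a))" using ci(4) by simp
        finally show ?case ..
      qed
    qed
  next
    case False
    then have tj: "trunc N (unit_vec j) = 0" by (auto simp: trunc_def unit_vec_def)
    have "\<forall>\<^sub>F z in nbh (N + m) (snd (dch c W e) q). 0 = theta_coeff \<delta> j z"
      using ev
    proof eventually_elim
      case (elim z)
      have zz: "z \<in> Rn (N + m)" "trunc N z \<in> snd c ` W" using elim by auto
      note ci = cinv_dch[OF c zz]
      have p: "fst (cinv (dch c W e) z) \<in> points Y" by (rule W_pts(1)[OF c ci(2)])
      have "proj_E (fst (cinv (dch c W e) z)) 0 = 0"
        using proj_E_linear(3)[OF p subspace_0[OF subspace_tangent] subspace_0[OF subspace_tangent], of 0] by simp
      moreover have "snd (cinv (dch c W e) z) 0 = 0"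
        using dual_space_sum[OF ci(3) subE(1)[OF p], of "{}"] by simp
      ultimately show ?case using \<beta>[OF zz] by (simp add: tj coord_vec_zero \<delta>')
    qed
    from tdiff_cong[OF tdiff_const[OF z] this z] show ?thesis by (simp add: \<delta>')
  qed
qed

end

section \<open>One-forms and two-forms on pairs of vectors\<close>

lemma wedge_one_one: "wedge 1 1 a b x [v, w] = a x [v] * b x [w] - a x [w] * b x [v]"
proof -
  have lt: "{..<1 + 1 :: nat} = {0, 1}" by auto
  have P: "{\<sigma>. \<sigma> permutes {..<1 + 1 :: nat}} = {id, Transposition.transpose 0 1}"
    unfolding lt by (auto simp: permutes_doubleton_iff)
  have ne: "id \<noteq> Transposition.transpose 0 (1 :: nat)"
    by (auto simp: fun_eq_iff Transposition.transpose_def intro!: exI[of _ 0])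
  have l: "permute_list \<sigma> [v, w] = [[v, w] ! \<sigma> 0, [v, w] ! \<sigma> 1]" for \<sigma>
    by (simp add: permute_list_def)
  show ?thesis
    unfolding wedge_def P l using ne by (simp add: sign_swap_id)
qed

lemma ext_deriv_one_form:
  "ext_deriv M \<alpha> p [v, w] =
    dir_deriv (mdim M) (coeff M (chart_at M p) \<alpha> [w (chart_at M p)]) (snd (chart_at M p) p) (v (chart_at M p))
  - dir_deriv (mdim M) (coeff M (chart_at M p) \<alpha> [v (chart_at M p)]) (snd (chart_at M p) p) (w (chart_at M p))"
proof -
  have "{..<length [v, w]} = {0, 1}" by auto
  then show ?thesis by (simp add: ext_deriv_def Let_def)
qed

lemma alternating_on_one_linear:
  assumes "alternating_on V 1 f" "u \<in> V" "w \<in> V"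
  shows "f [u + w] = f [u] + f [w]" "f [a *\<^sub>R u] = a * f [u]"
proof -
  have "length [u] = 1 \<and> set [u] \<subseteq> V" using assms(2) by simp
  note * = assms(1)[unfolded alternating_on_def, rule_format, OF this]
  show "f [u + w] = f [u] + f [w]" using *[THEN conjunct1, rule_format, of 0 u w] assms by simp
  show "f [a *\<^sub>R u] = a * f [u]" using *[THEN conjunct2, THEN conjunct1, rule_format, of 0 u a] assms by simp
qed

lemma alternating_on_two_alt_form:
  assumes f: "alternating_on V 2 f" and V: "subspace V"
  shows "alt_form V (\<lambda>v w. f [v, w])"
proof -
  have A: "f [u + u', w] = f [u, w] + f [u', w]" "f [w, u + u'] = f [w, u] + f [w, u']" "f [a *\<^sub>R u, w] = a * f [u, w]"
     "f [u, u] = 0"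
    if "u \<in> V" "u' \<in> V" "w \<in> V" for u u' w a
  proof -
    have l: "length [u, w] = 2 \<and> set [u, w] \<subseteq> V" "length [w, u] = 2 \<and> set [w, u] \<subseteq> V"
      "length [u, u] = 2 \<and> set [u, u] \<subseteq> V" using that by simp_all
    note * = f[unfolded alternating_on_def, rule_format, OF l(1)] and ** = f[unfolded alternating_on_def, rule_format, OF l(2)]
      and *** = f[unfolded alternating_on_def, rule_format, OF l(3)]
    show "f [u + u', w] = f [u, w] + f [u', w]" using *[THEN conjunct1, rule_format, of 0 u u'] that by simp
    show "f [w, u + u'] = f [w, u] + f [w, u']" using **[THEN conjunct1, rule_format, of 1 u u'] that by simp
    show "f [a *\<^sub>R u, w] = a * f [u, w]" using *[THEN conjunct2, THEN conjunct1, rule_format, of 0 u a] that by simp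
    show "f [u, u] = 0" using ***[THEN conjunct2, THEN conjunct2, rule_format, of 0 1] by simp
  qed
  have "f [u, w] = - f [w, u]" if uw: "u \<in> V" "w \<in> V" for u w
  proof -
    have s: "u + w \<in> V" by (rule subspace_add[OF V uw])
    have "f [u + w, u + w] = f [u, u] + f [u, w] + (f [w, u] + f [w, w])"
      using A(1)[OF uw s] A(2)[OF uw uw(1)] A(2)[OF uw uw(2)] by simp
    then show ?thesis using A(4)[OF s s s] A(4)[OF uw(1) uw(1) uw(1)] A(4)[OF uw(2) uw(2) uw(2)] by simp
  qed
  then show ?thesis unfolding alt_form_def using V A(1,3) by blast
qed

context split_bundle
begin

section \<open>The exterior derivative of the canonical one-form\<close>

lemma dir_deriv_coeff_theta:
  assumes \<delta>: "\<delta> \<in> charts D" "q \<in> fst \<delta>" and u: "u \<in> Rn (N + m)"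
  shows "tdiff (N + m) (\<lambda>z. \<Sum>j<N + m. theta_coeff \<delta> j z * u j) (snd \<delta> q)"
    "dir_deriv (N + m) (coeff D \<delta> (theta Y G E m) [u]) (snd \<delta> q) u' =
     dir_deriv (N + m) (\<lambda>z. \<Sum>j<N + m. theta_coeff \<delta> j z * u j) (snd \<delta> q) u'"
    "dir_deriv (N + m) (\<lambda>z. \<Sum>j<N + m. theta_coeff \<delta> j z * u j) (snd \<delta> q) u' =
     (\<Sum>j<N + m. dir_deriv (N + m) (theta_coeff \<delta> j) (snd \<delta> q) u' * u j)"
proof -
  have z: "snd \<delta> q \<in> Rn (N + m)" using diff_atlasD(3)[OF atlasD \<delta>] by (simp add: dimD)
  note bt = theta_coeff_tdiff[OF \<delta>]
  show T: "tdiff (N + m) (\<lambda>z. \<Sum>j<N + m. theta_coeff \<delta> j z * u j) (snd \<delta> q)"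
    using bt by (intro tdiff_sum tdiff_mult tdiff_const z) auto
  have "\<forall>\<^sub>F z in nbh (N + m) (snd \<delta> q). z \<in> snd \<delta> ` fst \<delta>"
    using diff_atlasD(5)[OF atlasD \<delta>] by (simp add: dimD)
  then have "\<forall>\<^sub>F z in nbh (N + m) (snd \<delta> q). (\<Sum>j<N + m. theta_coeff \<delta> j z * u j) = coeff D \<delta> (theta Y G E m) [u] z"
    by eventually_elim (simp add: coeff_theta[OF \<delta>(1) _ u] chart_cinv)
  from dir_deriv_cong[OF T this z]
  show "dir_deriv (N + m) (coeff D \<delta> (theta Y G E m) [u]) (snd \<delta> q) u' =
     dir_deriv (N + m) (\<lambda>z. \<Sum>j<N + m. theta_coeff \<delta> j z * u j) (snd \<delta> q) u'" ..
  have d0: "dir_deriv (N + m) (\<lambda>_. c) (snd \<delta> q) u' = 0" for c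
    using has_pds_dir_deriv[OF has_pds_const z] by simp
  show "dir_deriv (N + m) (\<lambda>z. \<Sum>j<N + m. theta_coeff \<delta> j z * u j) (snd \<delta> q) u' =
     (\<Sum>j<N + m. dir_deriv (N + m) (theta_coeff \<delta> j) (snd \<delta> q) u' * u j)"
    using bt by (subst dir_deriv_sum_mult[OF _ tdiff_const[OF z] z]) (auto simp: d0)
qed

text \<open>
  The derivative of \<open>\<theta>\<^sub>G w\<close> in the direction \<open>v\<close>, with \<open>w\<close> extended to a constant field of the chosen
  chart; \<open>d\<theta>\<^sub>G\<close> is its antisymmetrisation.  Writing it through the components makes the linearity in
  both vectors visible.
\<close>

definition theta_deriv where "theta_deriv q v w =
  (\<Sum>j<N + m. dir_deriv (N + m) (theta_coeff (chart_at D q) j) (snd (chart_at D q) q) (v (chart_at D q)) * w (chart_at D q) j)"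

lemma ext_deriv_theta:
  assumes q: "q \<in> points D" and v: "v \<in> tangent D q" "w \<in> tangent D q"
  shows "ext_deriv D (theta Y G E m) q [v, w] = theta_deriv q v w - theta_deriv q w v"
proof -
  note \<delta> = chart_at[OF q, THEN conjunct1] chart_at[OF q, THEN conjunct2]
  have u: "v (chart_at D q) \<in> Rn (N + m)" "w (chart_at D q) \<in> Rn (N + m)"
    using tangentD(1)[OF v(1) \<delta>] tangentD(1)[OF v(2) \<delta>] by (simp_all add: dimD)
  show ?thesis
    unfolding ext_deriv_one_form dimD theta_deriv_def
    using dir_deriv_coeff_theta(2,3)[OF \<delta> u(1)] dir_deriv_coeff_theta(2,3)[OF \<delta> u(2)] by simp
qed

lemma theta_deriv_linear:
  "theta_deriv q (u + v) w = theta_deriv q u w + theta_deriv q v w" "theta_deriv q w (u + v) = theta_deriv q w u + theta_deriv q w v"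
  "theta_deriv q (a *\<^sub>R v) w = a * theta_deriv q v w" "theta_deriv q w (a *\<^sub>R v) = a * theta_deriv q w v"
  unfolding theta_deriv_def plus_fun_apply dir_deriv_add scaleR_fun_apply dir_deriv_scale
  by (simp_all add: sum.distrib sum_distrib_left algebra_simps)

section \<open>The two-form on the dual bundle and its pullback along a section\<close>

context
  fixes \<omega> b :: "'y form"
  assumes \<omega>: "smooth_form Y 2 \<omega>" and b: "smooth_form Y 1 b"
begin

abbreviation \<Omega> where "\<Omega> \<equiv> omega_G Y \<omega> b G E m"
abbreviation T where "T \<equiv> tangent_map D Y fst"

lemma omega_alt: "p \<in> points Y \<Longrightarrow> alt_form (tangent Y p) (\<lambda>v w. \<omega> p [v, w])"
  using \<omega> unfolding smooth_form_def by (intro alternating_on_two_alt_form subspace_tangent) blast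

lemma omega_G_eq:
  assumes q: "q \<in> points D" and v: "v \<in> tangent D q" "w \<in> tangent D q"
  shows "\<Omega> q [v, w] = \<omega> (fst q) [T q v, T q w] - (theta_deriv q v w - theta_deriv q w v)
    - (b (fst q) [T q v] * canon q w - b (fst q) [T q w] * canon q v)"
  unfolding omega_G_def by (simp add: wedge_one_one[unfolded One_nat_def] pullback_def theta_eq ext_deriv_theta[OF q v])

lemma omega_G_alt:
  assumes q: "q \<in> points D"
  shows "alt_form (tangent D q) (\<lambda>v w. \<Omega> q [v, w])"
proof -
  have p: "fst q \<in> points Y" by (rule fst_points[OF q])
  have t: "T q v \<in> tangent Y (fst q)" if "v \<in> tangent D q" for v
    by (rule tangent_map_in_tangent[OF atlasD atlasY diff_at_fst that q])
  note \<omega>D = alt_formD[OF omega_alt[OF p]]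
  have bl: "b (fst q) [u + w] = b (fst q) [u] + b (fst q) [w]" "b (fst q) [a *\<^sub>R u] = a * b (fst q) [u]"
    if "u \<in> tangent Y (fst q)" "w \<in> tangent Y (fst q)" for u w a
    using alternating_on_one_linear[of "tangent Y (fst q)" "b (fst q)", OF _ that] b p unfolding smooth_form_def by blast+
  have sub: "subspace (tangent D q)" by (rule subspace_tangent)
  show ?thesis
    unfolding alt_form_def
  proof (intro conjI ballI allI)
    fix u w assume u: "u \<in> tangent D q" and w: "w \<in> tangent D q"
    show "\<Omega> q [u, w] = - \<Omega> q [w, u]"
      unfolding omega_G_eq[OF q u w] omega_G_eq[OF q w u] using \<omega>D(4)[OF t[OF u] t[OF w]] by simp
    show "\<Omega> q [c *\<^sub>R u, w] = c * \<Omega> q [u, w]" for c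
      unfolding omega_G_eq[OF q u w] omega_G_eq[OF q subspace_scale[OF sub u] w] tangent_map_scale theta_deriv_linear
        canon_linear(2)[OF q u u] bl(2)[OF t[OF u] t[OF u]] \<omega>D(3)[OF t[OF u] t[OF w]]
      by (simp add: algebra_simps)
    fix v assume v: "v \<in> tangent D q"
    show "\<Omega> q [u + w, v] = \<Omega> q [u, v] + \<Omega> q [w, v]"
      unfolding omega_G_eq[OF q u v] omega_G_eq[OF q w v] omega_G_eq[OF q subspace_add[OF sub u w] v] tangent_map_add theta_deriv_linear
        canon_linear(1)[OF q u w] bl(1)[OF t[OF u] t[OF w]] \<omega>D(2)[OF t[OF u] t[OF w] t[OF v]]
      by (simp add: algebra_simps)
  qed (rule sub)
qed

context
  fixes s :: "'y \<Rightarrow> 'y covec"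
  assumes s: "smooth_map Y D s" and fst_s: "\<And>p. p \<in> points Y \<Longrightarrow> fst (s p) = p"
begin

abbreviation L where "L \<equiv> tangent_map Y D s"

lemma s_points: "p \<in> points Y \<Longrightarrow> s p \<in> points D"
  using s by (auto simp: smooth_map_def)

lemma diff_at_s: "diff_at Y D s p"
  by (rule smooth_map_c1_at[OF diff_atlasD(1)[OF atlasY] s])

lemma L_tangent: "p \<in> points Y \<Longrightarrow> v \<in> tangent Y p \<Longrightarrow> L p v \<in> tangent D (s p)"
  by (rule tangent_map_in_tangent[OF atlasY atlasD diff_at_s])

text \<open>
  \<open>\<pi> \<circ> s = id\<close> on tangent vectors; in particular the tangent map of \<open>s\<close> is injective.
\<close>

lemma T_L:
  assumes p: "p \<in> points Y" and v: "v \<in> tangent Y p"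
  shows "T (s p) (L p v) = v"
  using tangent_map_comp[OF atlasY atlasD atlasY diff_at_s s_points[OF p] diff_at_fst refl p v]
    tangent_map_ident[OF atlasY fst_s p v] by simp

text \<open>
  The tautological property \<open>s\<^sup>* \<theta>\<^sub>G = p\<^sub>G\<^sup>* s\<close>.
\<close>

lemma canon_L:
  assumes p: "p \<in> points Y" and v: "v \<in> tangent Y p"
  shows "canon (s p) (L p v) = pG_star G E s p [v]"
  unfolding canon_def T_L[OF p v] fst_s[OF p] proj_E_def pG_star_def by simp

lemma coeff_pG_star:
  assumes c: "c \<in> charts Y" and \<delta>: "\<delta> \<in> charts D" and p: "p \<in> fst c" "s p \<in> fst \<delta>" and u: "u \<in> Rn N"
  shows "coeff Y c (pG_star G E s) [u] (snd c p) =
    (\<Sum>j<N + m. theta_coeff \<delta> j (snd \<delta> (s p)) * dir_deriv N (\<lambda>y. snd \<delta> (s (cinv c y)) j) (snd c p) u)"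
proof -
  have pY: "p \<in> points Y" by (rule diff_atlasD(6)[OF atlasY c p(1)])
  have cp: "cinv c (snd c p) = p" by (rule diff_atlasD(4)[OF atlasY c p(1)])
  have sp: "cinv \<delta> (snd \<delta> (s p)) = s p" by (rule diff_atlasD(4)[OF atlasD \<delta> p(2)])
  define a where "a = coord_vec Y c p u"
  have a: "a \<in> tangent Y p" "a c = u" unfolding a_def using coord_vec_tangent[OF atlasY c p(1) u] by blast+
  have La: "L p a \<delta> = dmap N (\<lambda>y. snd \<delta> (s (cinv c y))) (snd c p) u"
    using tangent_map_chart[OF atlasY atlasD diff_at_s a(1) c p(1) \<delta> p(2)] a(2) by simp
  have LR: "L p a \<delta> \<in> Rn (N + m)" using tangentD(1)[OF L_tangent[OF pY a(1)] \<delta> p(2)] by (simp add: dimD)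
  have "coeff Y c (pG_star G E s) [u] (snd c p) = pG_star G E s p [a]"
    by (simp add: coeff_def cp a_def)
  also have "\<dots> = canon (s p) (coord_vec D \<delta> (s p) (L p a \<delta>))"
    using canon_L[OF pY a(1)] coord_vec_of_tangent[OF atlasD \<delta> p(2) L_tangent[OF pY a(1)]] by simp
  also have "\<dots> = coeff D \<delta> (theta Y G E m) [L p a \<delta>] (snd \<delta> (s p))"
    by (simp add: coeff_def sp theta_eq)
  also have "\<dots> = (\<Sum>j<N + m. theta_coeff \<delta> j (snd \<delta> (s p)) * L p a \<delta> j)"
    by (rule coeff_theta[OF \<delta> _ LR]) (simp add: sp p(2))
  finally show ?thesis unfolding La dmap_def .
qed

text \<open>
  \<open>s\<^sup>* d\<theta>\<^sub>G = d(p\<^sub>G\<^sup>* s)\<close>.  The two exterior derivatives are computed in chosen charts of the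
  base and of the bundle, whose base charts may differ, so this is the coordinate rule for the
  coordinate expression \<open>F\<close> of \<open>s\<close> together with the tautological property.
\<close>

lemma ext_deriv_pullback:
  assumes p: "p \<in> points Y" and v: "v \<in> tangent Y p" "w \<in> tangent Y p"
  shows "ext_deriv D (theta Y G E m) (s p) [L p v, L p w] = ext_deriv Y (pG_star G E s) p [v, w]"
proof -
  let ?c = "chart_at Y p" and ?\<delta> = "chart_at D (s p)"
  note c = chart_at[OF p, THEN conjunct1] chart_at[OF p, THEN conjunct2]
  note \<delta> = chart_at[OF s_points[OF p], THEN conjunct1] chart_at[OF s_points[OF p], THEN conjunct2]
  define F where "F y = snd ?\<delta> (s (cinv ?c y))" for y
  define V where "V = snd ?c ` {p \<in> fst ?c. s p \<in> fst ?\<delta>}"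
  define x where "x = snd ?c p"
  have Fx: "F x = snd ?\<delta> (s p)" unfolding F_def x_def using diff_atlasD(4)[OF atlasY c] by simp
  have V: "open_Rn N V" "x \<in> V"
    using s c \<delta> unfolding smooth_map_def V_def x_def by blast+
  have xR: "x \<in> Rn N" using V open_Rn_subset by blast
  have Vc: "\<exists>p'\<in>fst ?c. y = snd ?c p' \<and> s p' \<in> fst ?\<delta> \<and> cinv ?c y = p'" if "y \<in> V" for y
    using that diff_atlasD(4)[OF atlasY c(1)] unfolding V_def by auto
  have F2: "Ck_on N 2 V (\<lambda>y. F y j)" if "j < N + m" for j
  proof -
    have "smooth_on N V (\<lambda>y. F y j)"
      using s c(1) \<delta>(1) that unfolding smooth_map_def V_def F_def dimD by blast
    then show ?thesis unfolding smooth_on_def by blast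
  qed
  have FR: "F y \<in> Rn (N + m)" if y: "y \<in> V" for y
  proof -
    obtain p' where "s p' \<in> fst ?\<delta>" "cinv ?c y = p'" using Vc[OF y] by blast
    then show ?thesis using diff_atlasD(3)[OF atlasD \<delta>(1)] by (simp add: F_def dimD)
  qed
  have bt: "tdiff (N + m) (theta_coeff ?\<delta> j) (F x)" if "j < N + m" for j
    unfolding Fx by (rule theta_coeff_tdiff[OF \<delta> that])
  have u: "v ?c \<in> Rn N" "w ?c \<in> Rn N" using tangentD(1)[OF v(1) c] tangentD(1)[OF v(2) c] by blast+
  have Lu: "L p v ?\<delta> = dmap N F x (v ?c)" "L p w ?\<delta> = dmap N F x (w ?c)"
    unfolding F_def x_def
    using tangent_map_chart[OF atlasY atlasD diff_at_s v(1) c \<delta>] tangent_map_chart[OF atlasY atlasD diff_at_s v(2) c \<delta>] by blast+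
  have Lj: "L p v ?\<delta> j = dir_deriv N (\<lambda>y. F y j) x (v ?c)" "L p w ?\<delta> j = dir_deriv N (\<lambda>y. F y j) x (w ?c)" for j
    by (simp_all add: Lu dmap_def)
  have LR: "L p v ?\<delta> \<in> Rn (N + m)" "L p w ?\<delta> \<in> Rn (N + m)"
    using tangentD(1)[OF L_tangent[OF p v(1)] \<delta>] tangentD(1)[OF L_tangent[OF p v(2)] \<delta>] by (simp_all add: dimD)
  have pull: "dir_deriv N (coeff Y ?c (pG_star G E s) [u]) x u' =
      dir_deriv N (\<lambda>y. \<Sum>j<N + m. theta_coeff ?\<delta> j (F y) * dir_deriv N (\<lambda>y. F y j) y u) x u'"
    if u: "u \<in> Rn N" for u u'
  proof (rule sym, rule dir_deriv_cong[OF _ _ xR])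
    have FR': "\<forall>\<^sub>F y in nbh N x. F y \<in> Rn (N + m)"
      using open_Rn_imp_eventually[OF V] FR by (rule eventually_mono)
    have Ft: "tdiff N (\<lambda>y. F y j) x" if "j < N + m" for j
      using F2[OF that] V by (intro Ck_on_imp_tdiff[of N V 1]) (simp_all add: numeral_2_eq_2)
    show "tdiff N (\<lambda>y. \<Sum>j<N + m. theta_coeff ?\<delta> j (F y) * dir_deriv N (\<lambda>y. F y j) y u) x"
    proof (intro tdiff_sum tdiff_mult xR)
      fix j assume "j \<in> {..<N + m}"
      then have j: "j < N + m" by simp
      show "tdiff N (\<lambda>y. theta_coeff ?\<delta> j (F y)) x"
        by (rule tdiff_compose[of "N + m" N F x, OF Ft FR' xR bt[OF j]])
      show "tdiff N (\<lambda>y. dir_deriv N (\<lambda>y. F y j) y u) x" by (rule tdiff_dir_deriv[OF V F2[OF j]])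
    qed
    show "\<forall>\<^sub>F y in nbh N x. (\<Sum>j<N + m. theta_coeff ?\<delta> j (F y) * dir_deriv N (\<lambda>y. F y j) y u) = coeff Y ?c (pG_star G E s) [u] y"
      using open_Rn_imp_eventually[OF V]
    proof eventually_elim
      case (elim y)
      then obtain p' where p': "p' \<in> fst ?c" "y = snd ?c p'" "s p' \<in> fst ?\<delta>" "cinv ?c y = p'" using Vc by blast
      then show ?case using coeff_pG_star[OF c(1) \<delta>(1) p'(1,3) u] by (simp add: F_def)
    qed
  qed
  have th: "dir_deriv (N + m) (coeff D ?\<delta> (theta Y G E m) [U]) (F x) U' =
     dir_deriv (N + m) (\<lambda>z. \<Sum>j<N + m. theta_coeff ?\<delta> j z * U j) (F x) U'" if "U \<in> Rn (N + m)" for U U'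
    unfolding Fx by (rule dir_deriv_coeff_theta(2)[OF \<delta> that])
  have "ext_deriv Y (pG_star G E s) p [v, w] =
      dir_deriv N (\<lambda>y. \<Sum>j<N + m. theta_coeff ?\<delta> j (F y) * dir_deriv N (\<lambda>y. F y j) y (w ?c)) x (v ?c)
    - dir_deriv N (\<lambda>y. \<Sum>j<N + m. theta_coeff ?\<delta> j (F y) * dir_deriv N (\<lambda>y. F y j) y (v ?c)) x (w ?c)"
    unfolding ext_deriv_one_form x_def[symmetric] pull[OF u(1)] pull[OF u(2)] ..
  also have "\<dots> = dir_deriv (N + m) (\<lambda>z. \<Sum>j<N + m. theta_coeff ?\<delta> j z * L p w ?\<delta> j) (F x) (L p v ?\<delta>)
    - dir_deriv (N + m) (\<lambda>z. \<Sum>j<N + m. theta_coeff ?\<delta> j z * L p v ?\<delta> j) (F x) (L p w ?\<delta>)"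
    by (rule one_form_pullback_deriv[OF V F2 FR bt Lj])
  also have "\<dots> = ext_deriv D (theta Y G E m) (s p) [L p v, L p w]"
    unfolding ext_deriv_one_form dimD Fx[symmetric] th[OF LR(1)] th[OF LR(2)] ..
  finally show ?thesis ..
qed

text \<open>
  \<open>s\<^sup>* \<omega>\<^sub>G = \<omega> - d\<^sup>b(p\<^sub>G\<^sup>* s)\<close>, term by term.
\<close>

lemma omega_G_pullback:
  assumes p: "p \<in> points Y" and v: "v \<in> tangent Y p" "w \<in> tangent Y p"
  shows "\<Omega> (s p) [L p v, L p w] = omega_G_section Y \<omega> b G E s p [v, w]"
  unfolding omega_G_def omega_G_section_def twisted_deriv_def
  by (simp add: wedge_one_one[unfolded One_nat_def] pullback_def theta_eq ext_deriv_pullback[OF p v] canon_L[OF p v(1)] canon_L[OF p v(2)]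
      T_L[OF p v(1)] T_L[OF p v(2)] fst_s[OF p])

lemma image_L_basis:
  assumes p: "p \<in> points Y"
  obtains B where "finite B" "independent B" "span B = L p ` tangent Y p" "card B = N"
proof -
  obtain B where B: "finite B" "independent B" "span B = tangent Y p" "card B = N"
    by (rule tangent_basis[OF atlasY p])
  have lin: "linear (L p)" by (rule linearI) (simp_all only: tangent_map_add tangent_map_scale)
  have inj: "inj_on (L p) (tangent Y p)" by (rule inj_on_inverseI[of _ "T (s p)"]) (rule T_L[OF p])
  have "B \<subseteq> tangent Y p" using B(3) span_superset by blast
  then have "card (L p ` B) = N" using card_image[OF inj_on_subset[OF inj]] B(4) by simp
  moreover have "independent (L p ` B)"
    by (rule linear_independent_injective_image[OF lin B(2)]) (simp add: B(3) inj)
  moreover have "span (L p ` B) = L p ` tangent Y p" by (simp add: linear_span_image[OF lin] B(3))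
  ultimately show thesis using B(1) by (intro that[of "L p ` B"]) auto
qed

lemma wedge_power_vanishes_iff_pf:
  assumes p: "p \<in> points Y"
  shows "(\<forall>vs. length vs = 2 * r \<and> set vs \<subseteq> tangent Y p \<longrightarrow> wedge_power (omega_G_section Y \<omega> b G E s) r p vs = 0)
    \<longleftrightarrow> (\<forall>g. (\<forall>i<2 * r. g i \<in> L p ` tangent Y p) \<longrightarrow> pf r (\<lambda>i j. \<Omega> (s p) [g i, g j]) = 0)"
proof -
  have eq: "pf r (\<lambda>i j. \<Omega> (s p) [L p (vs ! i), L p (vs ! j)]) = 2 ^ r * wedge_power (omega_G_section Y \<omega> b G E s) r p vs"
    if "length vs = 2 * r" "set vs \<subseteq> tangent Y p" for vs
  proof -
    have "vs ! i \<in> tangent Y p" if "i < 2 * r" for i using that \<open>length vs = 2 * r\<close> \<open>set vs \<subseteq> _\<close> nth_mem by auto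
    then have "pf r (\<lambda>i j. \<Omega> (s p) [L p (vs ! i), L p (vs ! j)]) = pf r (\<lambda>i j. omega_G_section Y \<omega> b G E s p [vs ! i, vs ! j])"
      by (intro pf_cong omega_G_pullback[OF p])
    then show ?thesis using that by (simp add: wedge_power_eq_pf)
  qed
  show ?thesis
  proof (intro iffI allI impI)
    fix g assume Z: "\<forall>vs. length vs = 2 * r \<and> set vs \<subseteq> tangent Y p \<longrightarrow> wedge_power (omega_G_section Y \<omega> b G E s) r p vs = 0"
      and g: "\<forall>i<2 * r. g i \<in> L p ` tangent Y p"
    have "\<forall>i. \<exists>v. i < 2 * r \<longrightarrow> v \<in> tangent Y p \<and> g i = L p v" using g by blast
    from choice[OF this] obtain h where h: "\<And>i. i < 2 * r \<Longrightarrow> h i \<in> tangent Y p \<and> g i = L p (h i)" by blast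
    define vs where "vs = map h [0..<2 * r]"
    have vs: "length vs = 2 * r" "set vs \<subseteq> tangent Y p" using h by (auto simp: vs_def)
    have "pf r (\<lambda>i j. \<Omega> (s p) [g i, g j]) = pf r (\<lambda>i j. \<Omega> (s p) [L p (vs ! i), L p (vs ! j)])"
      using h by (intro pf_cong) (simp add: vs_def)
    then show "pf r (\<lambda>i j. \<Omega> (s p) [g i, g j]) = 0" using eq[OF vs] Z vs by simp
  next
    fix vs assume Z: "\<forall>g. (\<forall>i<2 * r. g i \<in> L p ` tangent Y p) \<longrightarrow> pf r (\<lambda>i j. \<Omega> (s p) [g i, g j]) = 0"
      and vs: "length vs = 2 * r \<and> set vs \<subseteq> tangent Y p"
    have "\<forall>i<2 * r. L p (vs ! i) \<in> L p ` tangent Y p"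
    proof (intro allI impI imageI)
      fix i assume "i < 2 * r"
      then have "vs ! i \<in> set vs" using vs by simp
      then show "vs ! i \<in> tangent Y p" using vs by blast
    qed
    then have "pf r (\<lambda>i j. \<Omega> (s p) [L p (vs ! i), L p (vs ! j)]) = 0"
      using Z[THEN spec, of "\<lambda>i. L p (vs ! i)"] by blast
    then show "wedge_power (omega_G_section Y \<omega> b G E s) r p vs = 0" using eq[of vs] vs by simp
  qed
qed

text \<open>
  The linear criterion for the tangent space of the graph, of dimension \<open>n + k\<close> inside the
  \<open>2 n\<close>-dimensional tangent space of the dual bundle.
\<close>

lemma coisotropic_at_iff:
  assumes p: "p \<in> points Y" and dim: "N = n + k" "k \<le> n" "m = n - k"
    and nd: "\<And>v. v \<in> tangent D (s p) \<Longrightarrow> (\<And>w. w \<in> tangent D (s p) \<Longrightarrow> \<Omega> (s p) [v, w] = 0) \<Longrightarrow> v = 0"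
  shows "{v \<in> tangent D (s p). \<forall>w\<in>sub_tangent D (s ` points Y) (s p). \<Omega> (s p) [v, w] = 0} \<subseteq> sub_tangent D (s ` points Y) (s p)
    \<longleftrightarrow> (\<forall>vs. length vs = 2 * (k + 1) \<and> set vs \<subseteq> tangent Y p \<longrightarrow> wedge_power (omega_G_section Y \<omega> b G E s) (k + 1) p vs = 0)"
proof -
  have sub: "sub_tangent D (s ` points Y) (s p) = L p ` tangent Y p"
    by (rule sub_tangent_section_image[OF Y atlasD s diff_at_fst fst_s p])
  obtain BT where BT: "finite BT" "independent BT" "span BT = tangent D (s p)" "card BT = mdim D"
    by (rule tangent_basis[OF atlasD s_points[OF p]])
  obtain BS where BS: "finite BS" "independent BS" "span BS = L p ` tangent Y p" "card BS = N"
    by (rule image_L_basis[OF p])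
  have cT: "card BT = 2 * n" using BT(4) dim unfolding dimD by simp
  have cS: "card BS = n + k" using BS(4) dim(1) by simp
  have ST: "L p ` tangent Y p \<subseteq> tangent D (s p)" using L_tangent[OF p] by blast
  show ?thesis
    unfolding sub wedge_power_vanishes_iff_pf[OF p]
    by (rule coisotropic_iff_pf_vanishes[OF omega_G_alt[OF s_points[OF p]] nd BT(1-3) cT BS(1-3) ST cS dim(2)])
qed

end

end

end

section \<open>The coisotropy criterion\<close>

lemma form_kernel_subspace:
  assumes "alt_form (tangent Y p) (\<lambda>v w. \<omega> p [v, w])"
  shows "subspace (form_kernel Y \<omega> p)"
proof (rule subspaceI)
  note D = alt_formD[OF assms]
  have "\<omega> p [0, w] = 0" if "w \<in> tangent Y p" for w
    using D(3)[OF subspace_0[OF D(1)] that, of 0] by simp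
  then show "0 \<in> form_kernel Y \<omega> p" using subspace_0[OF D(1)] by (simp add: form_kernel_def)
  show "x + y \<in> form_kernel Y \<omega> p" if "x \<in> form_kernel Y \<omega> p" "y \<in> form_kernel Y \<omega> p" for x y
    using that D(2) subspace_add[OF D(1)] by (simp add: form_kernel_def)
  show "a *\<^sub>R x \<in> form_kernel Y \<omega> p" if "x \<in> form_kernel Y \<omega> p" for a x
    using that D(3) subspace_scale[OF D(1)] by (simp add: form_kernel_def)
qed

theorem theorem6p2:
  fixes Y :: "'y manifold" and n k :: nat and \<omega> b :: "'y form"
    and E G :: "'y \<Rightarrow> 'y tvec set" and U :: "'y covec set" and s :: "'y \<Rightarrow> 'y covec"
  assumes Y: "lcps Y \<omega> b"
    and dim: "mdim Y = n + k"
    and rank: "\<And>p. p \<in> points Y \<Longrightarrow> form_rank Y \<omega> p = 2 * k"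
    and E: "E = form_kernel Y \<omega>"
    and G: "splitting Y G E"
    and U: "U \<subseteq> points (dual_bundle Y E (n - k))"
      "\<exists>W. open_in_mfd (dual_bundle Y E (n - k)) W \<and> zero_section Y \<subseteq> W \<and> W \<subseteq> U"
    and nondeg: "nondegenerate_on (dual_bundle Y E (n - k)) U (omega_G Y \<omega> b G E (n - k))"
    and s: "smooth_map Y (dual_bundle Y E (n - k)) s"
      "\<And>p. p \<in> points Y \<Longrightarrow> fst (s p) = p"
      "s ` points Y \<subseteq> U"
  shows "coisotropic (dual_bundle Y E (n - k)) (omega_G Y \<omega> b G E (n - k)) (s ` points Y)
    \<longleftrightarrow> form_zero Y (2 * (k + 1)) (wedge_power (omega_G_section Y \<omega> b G E s) (k + 1))"
proof -
  have atlas: "smooth_atlas Y" and \<omega>: "smooth_form Y 2 \<omega>" and b: "smooth_form Y 1 b"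
    using Y unfolding lcps_def smooth_manifold_def by blast+
  have alt: "alt_form (tangent Y p) (\<lambda>v w. \<omega> p [v, w])" if "p \<in> points Y" for p
    using \<omega> that unfolding smooth_form_def by (intro alternating_on_two_alt_form subspace_tangent) blast
  interpret split_bundle Y E G "n - k"
  proof
    show "subspace (E p)" if "p \<in> points Y" for p unfolding E by (rule form_kernel_subspace[of Y p \<omega>, OF alt[OF that]])
    show "E p \<subseteq> tangent Y p" for p unfolding E form_kernel_def by blast
  qed (rule atlas, rule G)
  have kn: "k \<le> n" if p: "p \<in> points Y" for p
  proof -
    obtain B where B: "independent B" "span B = tangent Y p" "card B = n + k"
      using tangent_basis[OF atlasY p] dim by metis
    \<comment> \<open>The rank is a truncated difference, hence at most the dimension: \<open>2 k \<le> n + k\<close>.\<close>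
    have "real_vector.dim (tangent Y p) = n + k"
      using dim_span_eq_card_independent[OF B(1)] B(2,3) by simp
    then show ?thesis using rank[OF p] unfolding form_rank_def by linarith
  qed
  have "coisotropic D (omega_G Y \<omega> b G E (n - k)) (s ` points Y) \<longleftrightarrow>
    (\<forall>p\<in>points Y. {v \<in> tangent D (s p). \<forall>w\<in>sub_tangent D (s ` points Y) (s p). omega_G Y \<omega> b G E (n - k) (s p) [v, w] = 0}
       \<subseteq> sub_tangent D (s ` points Y) (s p))"
    unfolding coisotropic_def by blast
  also have "\<dots> \<longleftrightarrow> (\<forall>p\<in>points Y. \<forall>vs. length vs = 2 * (k + 1) \<and> set vs \<subseteq> tangent Y p \<longrightarrow>
      wedge_power (omega_G_section Y \<omega> b G E s) (k + 1) p vs = 0)"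
  proof (rule ball_cong[OF refl])
    fix p assume p: "p \<in> points Y"
    show "{v \<in> tangent D (s p). \<forall>w\<in>sub_tangent D (s ` points Y) (s p). omega_G Y \<omega> b G E (n - k) (s p) [v, w] = 0}
        \<subseteq> sub_tangent D (s ` points Y) (s p) \<longleftrightarrow>
      (\<forall>vs. length vs = 2 * (k + 1) \<and> set vs \<subseteq> tangent Y p \<longrightarrow>
        wedge_power (omega_G_section Y \<omega> b G E s) (k + 1) p vs = 0)"
    proof (rule coisotropic_at_iff[OF \<omega> b s(1,2) p dim kn[OF p] refl])
      fix v assume v: "v \<in> tangent D (s p)" "\<And>w. w \<in> tangent D (s p) \<Longrightarrow> omega_G Y \<omega> b G E (n - k) (s p) [v, w] = 0"
      have "s p \<in> U" using s(3) p by blast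
      then show "v = 0" using nondeg v unfolding nondegenerate_on_def by blast
    qed
  qed
  finally show ?thesis unfolding form_zero_def .
qed

end
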